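(* Let $n\ge1$ and $\lambda\in\mathcal P_+^{(n)}$. Then, coefficientwise in $x$ and with $t$ a formal variable independent of $q$, $$\lim_{q\to0}\widetilde\Phi_\lambda(x;q,t)=\frac{(1-t^2)^n}{b_\lambda(t^2)}\sum_{\substack{S=(\lambda=\mu^{(0)}\supset\mu^{(1)}\supset\dots\supset\mu^{(n-1)})\\ \mu^{(i)}\in\mathcal P_+^{(n-i)}}}sk_S(t^2)\,x^{wt(S)}.$$
   Context: **Weights.** $\mathcal P_+^{(n)}=\{(\lambda_1,\dots,\lambda_n)\in\mathbb C^n:\lambda_i-\lambda_{i+1}\in\mathbb Z_{\ge0}\}$; each element is $(a,\dots,a)+\widetilde\lambda$ with $a\in\mathbb C$, $\widetilde\lambda$ a partition with at most $n$ parts. $|\lambda|=\sum_i\lambda_i$. For $\lambda\in\mathcal P_+^{(n)}$, $\mu\in\mathcal P_+^{(n-1)}$, $\mu\subset\lambda$ means $\lambda_i-\mu_i\in\mathbb Z_{\ge0}$ for $1\le i\le n-1$ (parts may be negative). **Coefficients.** For partitions, $\lambda'$ is the conjugate, $m_i(\lambda)$ the multiplicity of $i$ as a part, $\phi_r(t)=(1-t)\cdots(1-t^r)$, $\binom ab_t=\phi_a(t)/(\phi_b(t)\phi_{a-b}(t))$, $b_\lambda(t)=\prod_{i\ge1}\phi_{m_i(\lambda)}(t)$, and $$sk_{\lambda/\mu}(t)=t^{\sum_j\binom{\lambda'_j-\mu'_j}2}\prod_{j\ge1}\binom{\lambda_j'-\mu_{j+1}'}{m_j(\mu)}_t.$$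 For general $\lambda\in\mathcal P_+^{(n)}$ and $\mu\in\mathcal P_+^{(n-1)}$ with $\mu\subset\lambda$, these are understood by shift: $b_\lambda:=b_{\lambda+(m^n)}$ and $sk_{\lambda/\mu}:=sk_{(\lambda+(m^n))/(\mu+(m^{n-1}))}$ for any $m\in\mathbb C$ such that $\lambda+(m^n)$ and $\mu+(m^{n-1})$ are partitions with exactly $n$, respectively $n-1$, nonzero parts (the result does not depend on $m$). For a chain $S=(\mu^{(0)}\supset\dots\supset\mu^{(n-1)})$ with $\mu^{(i)}\in\mathcal P_+^{(n-i)}$, $$sk_S(t)=\prod_{i=1}^{n-1}sk_{\mu^{(i-1)}/\mu^{(i)}}(t),\qquad wt(S)=\bigl(|\mu^{(n-1)}|,\ |\mu^{(n-2)}|-|\mu^{(n-1)}|,\ \dots,\ |\mu^{(0)}|-|\mu^{(1)}|\bigr).$$ **Trace function.** $(a;q)_\infty=\prod_{i\ge0}(1-aq^i)$. $P_\lambda(x;q,t)$ is the (monic) Macdonald polynomial in $x_1,\dots,x_n$, extended to $\lambda=(a^n)+\widetilde\lambda$ by $P_\lambda=(x_1\cdots x_n)^aP_{\widetilde\lambda}$. The (Etingof–Kirillov) two-parameter trace function, normalized by removing its monomial prefactor, is $$\widetilde\Phi_\lambda(x;q,t)=P_\lambda(x;q^2,t^2)\prod_{1\le m<l\le n}\frac{(q^2x_l/x_m;q^2)_\infty}{(t^2x_l/x_m;q^2)_\infty},$$ viewed as a formal series in the $x_l/x_m$ ($m<l$) times monomials. *)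

theory Defs
  imports Complex_Main "HOL-Library.Poly_Mapping"
    "HOL-Computational_Algebra.Formal_Power_Series"
    "HOL-Computational_Algebra.Formal_Laurent_Series"
begin

section \<open>Weights and partitions\<close>

definition weights :: "nat \<Rightarrow> complex list set" where
  "weights n = {lam. length lam = n \<and> (\<forall>i. Suc i < n \<longrightarrow> lam ! i - lam ! Suc i \<in> \<nat>)}"

text \<open>Only the parts that \<open>mu\<close> has are compared with those of \<open>lam\<close>; no interlacing is required.\<close>

definition weight_subset :: "complex list \<Rightarrow> complex list \<Rightarrow> bool" where
  "weight_subset mu lam \<longleftrightarrow> (\<forall>i<length mu. lam ! i - mu ! i \<in> \<nat>)"

text \<open>A partition with at most \<open>n\<close> parts is a list of length \<open>n\<close>, padded with zeros.\<close>

definition partitions_le :: "nat \<Rightarrow> nat list set" where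
  "partitions_le n = {p. length p = n \<and> sorted_wrt (\<ge>) p}"

definition shift :: "complex \<Rightarrow> complex list \<Rightarrow> complex list" where
  "shift a lam = map (\<lambda>z. z + a) lam"

definition dominated :: "nat list \<Rightarrow> nat list \<Rightarrow> bool" where
  "dominated mu lam \<longleftrightarrow> sum_list mu = sum_list lam \<and>
     (\<forall>k. sum_list (take k mu) \<le> sum_list (take k lam))"

definition conj_part :: "nat list \<Rightarrow> nat \<Rightarrow> nat" where
  "conj_part p j = card {i. i < length p \<and> p ! i \<ge> j}"


section \<open>The coefficients \<open>b\<close> and \<open>sk\<close>\<close>

definition tphi :: "'a::field \<Rightarrow> nat \<Rightarrow> 'a" where
  "tphi t r = (\<Prod>i=1..r. 1 - t ^ i)"

definition tbinom :: "'a::field \<Rightarrow> nat \<Rightarrow> nat \<Rightarrow> 'a" where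
  "tbinom t a b = tphi t a / (tphi t b * tphi t (a - b))"

text \<open>The products and sums over all \<open>j \<ge> 1\<close> have only trivial terms beyond the largest part,
  which is at most the sum of the parts.\<close>

definition b_part :: "'a::field \<Rightarrow> nat list \<Rightarrow> 'a" where
  "b_part t p = (\<Prod>i\<in>{1..sum_list p}. tphi t (count_list p i))"

definition sk_part :: "'a::field \<Rightarrow> nat list \<Rightarrow> nat list \<Rightarrow> 'a" where
  "sk_part t l m =
     t ^ (\<Sum>j\<in>{1..sum_list l}. (conj_part l j - conj_part m j) choose 2) *
     (\<Prod>j\<in>{1..sum_list l}. tbinom t (conj_part l j - conj_part m (j + 1)) (count_list m j))"

text \<open>\<open>positive_shift m lam p\<close>: the weight \<open>lam + (m, \<dots>, m)\<close> is the partition \<open>p\<close>, all of whose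
  listed parts are nonzero.\<close>

definition positive_shift :: "complex \<Rightarrow> complex list \<Rightarrow> nat list \<Rightarrow> bool" where
  "positive_shift m lam p \<longleftrightarrow> sorted_wrt (\<ge>) p \<and> 0 \<notin> set p \<and> map of_nat p = shift m lam"

definition b_weight :: "'a::field \<Rightarrow> complex list \<Rightarrow> 'a" where
  "b_weight t lam = b_part t (SOME p. \<exists>m. positive_shift m lam p)"

definition sk_weight :: "'a::field \<Rightarrow> complex list \<Rightarrow> complex list \<Rightarrow> 'a" where
  "sk_weight t lam mu =
     (case (SOME (l, k). \<exists>m. positive_shift m lam l \<and> positive_shift m mu k) of
        (l, k) \<Rightarrow> sk_part t l k)"

definition chains :: "nat \<Rightarrow> complex list \<Rightarrow> complex list list set" where
  "chains n lam = {S. length S = n \<and> S ! 0 = lam \<and> (\<forall>i<n. S ! i \<in> weights (n - i)) \<and>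
     (\<forall>i. Suc i < n \<longrightarrow> weight_subset (S ! Suc i) (S ! i))}"

definition sk_chain :: "'a::field \<Rightarrow> complex list list \<Rightarrow> 'a" where
  "sk_chain t S = (\<Prod>i=1..<length S. sk_weight t (S ! (i - 1)) (S ! i))"

definition wt :: "complex list list \<Rightarrow> complex list" where
  "wt S = (let n = length S in
     map (\<lambda>k. if k = 0 then sum_list (S ! (n - 1))
              else sum_list (S ! (n - 1 - k)) - sum_list (S ! (n - k))) [0..<n])"


section \<open>Formal series\<close>

text \<open>A finite combination of monomials in \<open>x\<^sub>0, x\<^sub>1, \<dots>\<close> with complex exponents is a finitely
  supported function on exponent vectors; multiplication is convolution.\<close>

type_synonym 'a cpoly = "(nat \<Rightarrow>\<^sub>0 complex) \<Rightarrow>\<^sub>0 'a"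

definition xmon :: "complex list \<Rightarrow> 'a::comm_ring_1 cpoly" where
  "xmon v = Poly_Mapping.single (Poly_Mapping.nth v) 1"

text \<open>Infinite products in the ratios \<open>x\<^sub>i / x\<^sub>j\<close> are formed in \<open>A[[t]][[q]]\<close>, with \<open>A\<close> the ring of
  monomial combinations over the rationals. The outer power series variable is \<open>q\<close> and the inner one
  is \<open>t\<close>. In the products and quotients below, only finitely many monomials in \<open>x\<close> occur at each
  \<open>q\<^sup>a t\<^sup>b\<close>. A series in the ratios \<open>x\<^sub>l / x\<^sub>m\<close> (\<open>m < l\<close>) has the same coefficients here,
  expanded in \<open>q\<close> and \<open>t\<close>.\<close>

type_synonym xseries = "rat cpoly fps fps"

definition qS :: xseries where "qS = fps_X"

definition tS :: xseries where "tS = fps_const fps_X"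

definition ratioS :: "nat \<Rightarrow> nat \<Rightarrow> xseries" where
  "ratioS i j = fps_const (fps_const
     (Poly_Mapping.single (Poly_Mapping.single i 1 - Poly_Mapping.single j 1) 1))"

text \<open>\<open>(a; q)\<^sub>\<infinity>\<close>, as a limit in the \<open>q\<close>-adic metric of power series.\<close>

definition qpoch_inf :: "xseries \<Rightarrow> xseries \<Rightarrow> xseries" where
  "qpoch_inf a q = lim (\<lambda>N. \<Prod>i<N. 1 - a * q ^ i)"

text \<open>The quotient by a unit.\<close>

definition unit_quot :: "'a::comm_ring_1 \<Rightarrow> 'a \<Rightarrow> 'a" where
  "unit_quot a b = (THE d. d * b = a)"

text \<open>Scalars live in \<open>\<rat>((t))((q))\<close>, which contains the rational functions in \<open>q\<close> and \<open>t\<close>.\<close>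

type_synonym scalar = "rat fls fls"

definition xcoeff :: "xseries \<Rightarrow> (nat \<Rightarrow>\<^sub>0 complex) \<Rightarrow> scalar" where
  "xcoeff f w = fps_to_fls (Abs_fps (\<lambda>a. fps_to_fls (Abs_fps (\<lambda>b.
     Poly_Mapping.lookup (fps_nth (fps_nth f a) b) w))))"


section \<open>Macdonald polynomials\<close>

definition monomial_sym :: "nat list \<Rightarrow> 'a::comm_ring_1 cpoly" where
  "monomial_sym mu = (\<Sum>v\<in>{v. mset v = mset mu}. xmon (map of_nat v))"

text \<open>Macdonald's weight function \<open>\<Prod>\<^bsub>i\<noteq>j\<^esub> (x\<^sub>i/x\<^sub>j; q)\<^sub>\<infinity> / (t x\<^sub>i/x\<^sub>j; q)\<^sub>\<infinity>\<close> in \<open>n\<close> variables.\<close>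

definition macdonald_weight :: "nat \<Rightarrow> xseries \<Rightarrow> xseries \<Rightarrow> xseries" where
  "macdonald_weight n q t =
     (let I = {(i, j). i < n \<and> j < n \<and> i \<noteq> j} in
      unit_quot (\<Prod>(i, j)\<in>I. qpoch_inf (ratioS i j) q)
                (\<Prod>(i, j)\<in>I. qpoch_inf (t * ratioS i j) q))"

text \<open>The constant term of \<open>f(x) g(1/x) \<Delta>(x)\<close>, where \<open>\<Delta>\<close> is the weight function: the monomials
  \<open>x\<^sup>v\<close> of \<open>f\<close> and \<open>x\<^sup>w\<close> of \<open>g\<close> pair to the coefficient of \<open>x\<^bsup>w-v\<^esup>\<close> in \<open>\<Delta>\<close>. The usual
  factor \<open>1/n!\<close> does not affect orthogonality.\<close>

definition macdonald_pairing ::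
    "nat \<Rightarrow> xseries \<Rightarrow> xseries \<Rightarrow> scalar cpoly \<Rightarrow> scalar cpoly \<Rightarrow> scalar" where
  "macdonald_pairing n q t f g =
     (\<Sum>v\<in>Poly_Mapping.keys f. \<Sum>w\<in>Poly_Mapping.keys g.
        Poly_Mapping.lookup f v * Poly_Mapping.lookup g w *
        xcoeff (macdonald_weight n q t) (w - v))"

text \<open>The polynomial \<open>P\<^sub>\<lambda>(x; q, t)\<close> in \<open>n\<close> variables is \<open>m\<^sub>\<lambda>\<close> plus a combination of the \<open>m\<^sub>\<mu>\<close>
  with \<open>\<mu> < \<lambda>\<close> in the dominance order, and is orthogonal to these \<open>m\<^sub>\<mu>\<close>. These two conditions determine it;
  orthogonality of \<open>P\<^sub>\<lambda>\<close> and \<open>P\<^sub>\<mu>\<close> for incomparable \<open>\<lambda>\<close> and \<open>\<mu>\<close> is then a theorem.\<close>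

definition is_macdonald ::
    "nat \<Rightarrow> xseries \<Rightarrow> xseries \<Rightarrow> nat list \<Rightarrow> scalar cpoly \<Rightarrow> bool" where
  "is_macdonald n q t lam P \<longleftrightarrow>
     (let L = {mu \<in> partitions_le n. dominated mu lam \<and> mu \<noteq> lam} in
      (\<exists>u. P = monomial_sym lam + (\<Sum>mu\<in>L. Poly_Mapping.single 0 (u mu) * monomial_sym mu)) \<and>
      (\<forall>mu\<in>L. macdonald_pairing n q t P (monomial_sym mu) = 0))"

definition macdonald_part :: "nat \<Rightarrow> xseries \<Rightarrow> xseries \<Rightarrow> nat list \<Rightarrow> scalar cpoly" where
  "macdonald_part n q t lam = (THE P. is_macdonald n q t lam P)"

definition macdonald_P :: "nat \<Rightarrow> xseries \<Rightarrow> xseries \<Rightarrow> complex list \<Rightarrow> scalar cpoly" where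
  "macdonald_P n q t lam =
     (case (SOME (a, p). p \<in> partitions_le n \<and> lam = shift a (map of_nat p)) of
        (a, p) \<Rightarrow> xmon (replicate n a) * macdonald_part n q t p)"


section \<open>The trace function\<close>

definition trace_factor :: "nat \<Rightarrow> xseries" where
  "trace_factor n =
     (let I = {(m, l). m < l \<and> l < n} in
      unit_quot (\<Prod>(m, l)\<in>I. qpoch_inf (qS ^ 2 * ratioS l m) (qS ^ 2))
                (\<Prod>(m, l)\<in>I. qpoch_inf (tS ^ 2 * ratioS l m) (qS ^ 2)))"

text \<open>The coefficient of \<open>x\<^sup>w\<close> in the product of \<open>P\<^sub>\<lambda>(x; q\<^sup>2, t\<^sup>2)\<close> and the factor above.\<close>

definition trace_coeff :: "nat \<Rightarrow> complex list \<Rightarrow> (nat \<Rightarrow>\<^sub>0 complex) \<Rightarrow> scalar" where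
  "trace_coeff n lam w =
     (let P = macdonald_P n (qS ^ 2) (tS ^ 2) lam in
      \<Sum>v\<in>Poly_Mapping.keys P. Poly_Mapping.lookup P v * xcoeff (trace_factor n) (w - v))"

text \<open>For (the expansion of) a rational function \<open>f\<close> of \<open>q\<close> the limit as \<open>q\<close> tends to \<open>0\<close> exists
  iff \<open>f\<close> has no pole at \<open>q = 0\<close>, and is then the constant term.\<close>

definition has_limit_q0 :: "'a::zero fls \<Rightarrow> 'a \<Rightarrow> bool" where
  "has_limit_q0 f c \<longleftrightarrow> (\<forall>k<0. fls_nth f k = 0) \<and> fls_nth f 0 = c"

definition tK :: "rat fls" where "tK = fls_X"

end

theory Submission
  imports Defs
    "HOL-Library.Multiset"
    "HOL-Library.FuncSet"
    "HOL-Computational_Algebra.Polynomial"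
    "HOL-Combinatorics.Multiset_Permutations"
    "Jordan_Normal_Form.Determinant"
begin

text \<open>
  Evaluating symmetric functions on finite sets of points turns Hall--Littlewood polynomials into ordered
  products of one-variable powers in a shuffle algebra with kernel \<open>(a - t b)/(a - b)\<close>.  The quadratic
  relations between the factors give the expansion of \<open>P\<^sub>\<mu> \<Prod>\<^sub>i(1 - t x\<^sub>n/x\<^sub>i)\<close> (Pieri), and a
  twisted derivation gives the expansion in powers of the last variable (branching).  A \<open>t\<close>-binomial identity,
  applied column by column, shows that the coefficients \<open>sk\<close> intertwine the two expansions.  By induction on
  \<open>n\<close> the sum over chains, multiplied by \<open>\<Prod>\<^sub>i\<^sub><\<^sub>j(1 - t x\<^sub>j/x\<^sub>i)\<close>, is therefore the
  Hall--Littlewood polynomial up to its leading coefficient; since all coefficients have bounded \<open>t\<close>-valuation,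
  dividing by the product is unambiguous.

  Macdonald polynomials at \<open>q = 0\<close> are Hall--Littlewood polynomials because the Gram matrix of the monomial
  symmetric functions is invertible over \<open>\<rat>[[t]][[q]]\<close>: its constant term at \<open>q = t = 0\<close> is positive definite.
  Hence the coefficients of the Macdonald polynomial have no pole at \<open>q = 0\<close>, and orthogonality survives the limit.
\<close>

section \<open>Identities for \<open>t\<close>-binomial coefficients\<close>

text \<open>The chain sum is an infinite series: inclusion of weights does not require interlacing,
  so the members of a chain can have arbitrarily negative parts. Partitions are therefore replaced
  by multisets of integers of any sign. A weight is such a multiset together with one complex offset
  \<open>a\<close>, common to the whole chain, and only the coefficient at a fixed exponent is a
  finite sum. Series of this kind do not form a ring. They are treated as functions on exponents on
  which Laurent polynomials act, and identities between them are proved after multiplication by a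
  polynomial. A factor 1 - T x can formally be inverted in powers of x or of 1/x; bounded valuation
  in t singles out the expansion in powers of T, which is also the expansion of the trace factor and
  of Macdonald's weight at q = 0. Hall-Littlewood polynomials are kept without division by the
  stabilizer factor, since only then are they plain products of generators. Their leading
  coefficient is b_\<lambda>(t^2) / (1 - t^2)^n, and dividing by it at the very end produces the
  prefactor of the theorem.\<close>

definition T :: "rat fls" where "T = tK ^ 2"

abbreviation tnum :: "nat \<Rightarrow> rat fls" where "tnum m \<equiv> (1 - T ^ m) / (1 - T)"

lemma T_power_neq_1: "k > 0 \<Longrightarrow> T ^ k \<noteq> 1"
proof
  assume k: "k > 0" and "T ^ k = 1"
  hence "fls_X ^ (2 * k) = (1 :: rat fls)" by (simp add: T_def tK_def power_mult)
  hence "fls_nth (fls_X ^ (2 * k) :: rat fls) 0 = 1" by simp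
  thus False using k by (simp add: fls_X_power_nth split: if_splits)
qed

lemma T_neq_1 [simp]: "T \<noteq> 1"
  using T_power_neq_1[of 1] by simp

lemma T_neq_0 [simp]: "T \<noteq> 0"
  by (simp add: T_def tK_def)

lemma tphi_Suc: "tphi t (Suc r) = (1 - t ^ Suc r) * tphi t r"
  by (simp add: tphi_def mult.commute)

lemma tphi_0 [simp]: "tphi t 0 = 1"
  by (simp add: tphi_def)

lemma tphi_neq_0 [simp]: "tphi T r \<noteq> 0"
  using T_power_neq_1 by (fastforce simp: tphi_def)

text \<open>\<open>tbinom\<close> subtracts in the natural numbers and so does not vanish for b > a.
  With the value 0 there, the Pascal rules hold without side conditions and summation ranges can be
  extended freely.\<close>

definition tb :: "nat \<Rightarrow> nat \<Rightarrow> rat fls" where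
  "tb a b = (if b \<le> a then tbinom T a b else 0)"

lemma tb_0_right [simp]: "tb a 0 = 1"
  by (simp add: tb_def tbinom_def)

lemma tb_self [simp]: "tb a a = 1"
  by (simp add: tb_def tbinom_def)

lemma tb_eq_0 [simp]: "a < b \<Longrightarrow> tb a b = 0"
  by (simp add: tb_def)

lemma tb_Suc_right: "(1 - T ^ Suc b) * tb a (Suc b) = (1 - T ^ (a - b)) * tb a b"
proof -
  consider "b < a" | "b = a" | "a < b" by linarith
  thus ?thesis
  proof cases
    case 1
    then obtain d where a: "a = Suc (b + d)" using less_imp_Suc_add by blast
    have "1 - T ^ Suc b \<noteq> 0" "1 - T ^ Suc d \<noteq> 0"
      using T_power_neq_1[of "Suc b"] T_power_neq_1[of "Suc d"] by simp_all
    thus ?thesis unfolding a tb_def tbinom_def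
      by (simp add: tphi_Suc field_simps)
  qed auto
qed

lemma tb_1_right: "tb a (Suc 0) = tnum a"
  using tb_Suc_right[of 0 a] by (simp add: field_simps)

lemma tb_pascal: "tb (Suc a) (Suc b) = tb a (Suc b) + T ^ (a - b) * tb a b"
proof -
  consider "b < a" | "b = a" | "a < b" by linarith
  thus ?thesis
  proof cases
    case 1
    then obtain d where a: "a = Suc (b + d)" using less_imp_Suc_add by blast
    define U V F where "U = 1 - T ^ Suc b" and "V = 1 - T ^ Suc d" and "F = tphi T (Suc (b + d))"
    have nz: "U \<noteq> 0" "V \<noteq> 0"
      using T_power_neq_1[of "Suc b"] T_power_neq_1[of "Suc d"] by (simp_all add: U_def V_def)
    have W: "tphi T (Suc a) = (V + T ^ Suc d * U) * F"
      unfolding a tphi_Suc[of T "Suc (b + d)"] F_def[symmetric] U_def V_def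
      by (simp add: algebra_simps power_add)
    have "tb (Suc a) (Suc b) = (V + T ^ Suc d * U) * F / ((U * tphi T b) * (V * tphi T d))"
      unfolding tb_def tbinom_def W by (simp add: a tphi_Suc U_def V_def)
    moreover have "tb a (Suc b) = F / ((U * tphi T b) * tphi T d)"
      unfolding tb_def tbinom_def by (simp add: a tphi_Suc U_def F_def)
    moreover have "tb a b = F / (tphi T b * (V * tphi T d))"
      unfolding tb_def tbinom_def by (simp add: a tphi_Suc[of _ d] V_def F_def Suc_diff_le)
    moreover have "a - b = Suc d" by (simp add: a)
    ultimately show ?thesis using nz by (simp only: tphi_neq_0) (simp add: field_simps)
  qed auto
qed

lemma tb_pascal': "tb (Suc a) (Suc b) = T ^ Suc b * tb a (Suc b) + tb a b"
proof (cases "b \<le> a")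
  case True
  have "tb (Suc a) (Suc b) - (T ^ Suc b * tb a (Suc b) + tb a b)
      = (1 - T ^ Suc b) * tb a (Suc b) - (1 - T ^ (a - b)) * tb a b"
    unfolding tb_pascal by (simp add: algebra_simps)
  thus ?thesis unfolding tb_Suc_right by simp
qed simp

text \<open>The Gauss binomial formula, homogenized. The rule \<open>tb_pascal'\<close> turns the
  sum for A + 1 into y + T^A x times the sum for A, which splits off the last factor of the
  product.\<close>

lemma t_binomial_theorem:
  "(\<Sum>c\<le>A. x ^ (A - c) * y ^ c * T ^ ((A - c) choose 2) * tb A c) = (\<Prod>l<A. y + T ^ l * x)"
proof (induction A)
  case (Suc A)
  let ?g = "\<lambda>A c. x ^ (A - c) * y ^ c * T ^ ((A - c) choose 2) * tb A c"
  have "(\<Sum>c\<le>Suc A. ?g (Suc A) c)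
      = ?g (Suc A) 0 + (\<Sum>c\<le>A. ?g (Suc A) (Suc c))"
    by (rule sum.atMost_Suc_shift)
  also have "(\<Sum>c\<le>A. ?g (Suc A) (Suc c)) = (\<Sum>c\<le>A. T ^ A * x * (x ^ (A - Suc c) * y ^ Suc c * T ^ ((A - Suc c) choose 2) * tb A (Suc c))) + (\<Sum>c\<le>A. y * ?g A c)"
    unfolding sum.distrib[symmetric]
  proof (rule sum.cong[OF refl], goal_cases)
    case (1 c)
    have "T ^ ((A - c) choose 2) * T ^ Suc c * x ^ (A - c) * tb A (Suc c)
        = T ^ A * x * (x ^ (A - Suc c) * T ^ ((A - Suc c) choose 2)) * tb A (Suc c)"
    proof (cases "Suc c \<le> A")
      case True
      then obtain d where A: "A = Suc (c + d)" using less_imp_Suc_add[of c A] by auto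
      have "Suc d choose 2 = d + (d choose 2)"
        by (simp add: numeral_2_eq_2)
      thus ?thesis unfolding A by (simp add: power_add)
    qed simp
    thus ?case unfolding tb_pascal' by (simp add: algebra_simps)
  qed
  also have "(\<Sum>c\<le>A. T ^ A * x * (x ^ (A - Suc c) * y ^ Suc c * T ^ ((A - Suc c) choose 2) * tb A (Suc c)))
     = T ^ A * x * (\<Sum>c\<le>A. ?g A c) - T ^ A * x * ?g A 0"
    using sum.atMost_Suc_shift[of "?g A" A] by (simp add: sum_distrib_left algebra_simps)
  also have "T ^ A * x * ?g A 0 = ?g (Suc A) 0"
    by (simp add: numeral_2_eq_2 power_add)
  finally have "(\<Sum>c\<le>Suc A. ?g (Suc A) c) = (y + T ^ A * x) * (\<Sum>c\<le>A. ?g A c)"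
    by (simp only: sum_distrib_left[symmetric]) (simp add: algebra_simps)
  thus ?case unfolding Suc.IH by simp
qed (simp add: numeral_2_eq_2)

text \<open>The factor of one column in the branching coefficient: in \<open>branch A D m\<close>, \<open>D\<close> and \<open>A\<close> are the
  numbers of boxes removed from columns \<open>i\<close> and \<open>i + 1\<close>, and \<open>m\<close> is the multiplicity of the part \<open>i\<close>.\<close>

definition branch :: "nat \<Rightarrow> nat \<Rightarrow> nat \<Rightarrow> rat fls" where
  "branch A D m = (if A = 0 then (if D = 0 then 1 else tnum m)
                   else if A = 1 then (if D = 0 then 1 - T else 1) else 0)"

lemma prod_T: "(\<Prod>l<A. - T + T ^ l) = (if A = 0 then 1 else if A = 1 then 1 - T else 0)"
proof (cases "A \<ge> 2")
  case True
  hence "(\<Prod>l<A. - T + T ^ l) = 0"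
    by (intro prod_zero) (auto intro: bexI[of _ 1])
  thus ?thesis using True by simp
next
  case False
  hence "A = 0 \<or> A = 1" by linarith
  thus ?thesis by auto
qed

text \<open>For D \<le> 1 the last binomial is 1 or (1 - T^m T^(A-c)) / (1 - T), so the sum combines
  the values of \<open>t_binomial_theorem\<close> at (x, y) = (1, -T) and (T, -T). The first product
  contains -T + T = 0 once A \<ge> 2, the second once A \<ge> 1.\<close>

lemma branch_sum:
  assumes "D \<le> 1"
  shows "(\<Sum>c\<le>A. (- T) ^ c * T ^ ((A - c) choose 2) * tb A c * tb (m + A - c) D) = branch A D m"
proof -
  have g: "(\<Sum>c\<le>A. (- T) ^ c * T ^ ((A - c) choose 2) * tb A c) = (\<Prod>l<A. - T + T ^ l)" for A
    using t_binomial_theorem[of 1 A "- T"] by simp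
  have h: "(\<Sum>c\<le>A. T ^ (A - c) * (- T) ^ c * T ^ ((A - c) choose 2) * tb A c) = (if A = 0 then 1 else 0)"
  proof -
    have "(\<Prod>l<A. - T + T ^ l * T) = 0" if "A > 0"
      using that by (intro prod_zero) (auto intro: bexI[of _ 0])
    thus ?thesis using t_binomial_theorem[of T A "- T"] by simp
  qed
  show ?thesis
  proof (cases "D = 0")
    case True
    hence "(\<Sum>c\<le>A. (- T) ^ c * T ^ ((A - c) choose 2) * tb A c * tb (m + A - c) D) = (\<Prod>l<A. - T + T ^ l)"
      by (simp only: True tb_0_right mult_1_right g)
    thus ?thesis unfolding prod_T branch_def True by simp
  next
    case False
    hence D: "D = Suc 0" using assms by simp
    have "(\<Sum>c\<le>A. (- T) ^ c * T ^ ((A - c) choose 2) * tb A c * tb (m + A - c) D)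
        = (\<Sum>c\<le>A. ((- T) ^ c * T ^ ((A - c) choose 2) * tb A c
            - T ^ m * (T ^ (A - c) * (- T) ^ c * T ^ ((A - c) choose 2) * tb A c)) / (1 - T))"
    proof (rule sum.cong[OF refl], goal_cases)
      case (1 c)
      hence "m + A - c = m + (A - c)" by simp
      thus ?case by (simp add: D tb_1_right power_add algebra_simps diff_divide_distrib)
    qed
    also have "\<dots> = ((\<Prod>l<A. - T + T ^ l) - T ^ m * (if A = 0 then 1 else 0)) / (1 - T)"
      by (simp only: sum_divide_distrib[symmetric] sum_subtractf sum_distrib_left[symmetric] g h)
    also have "\<dots> = branch A D m"
      unfolding prod_T branch_def D by simp
    finally show ?thesis .
  qed
qed

section \<open>The shuffle algebra\<close>

text \<open>A symmetric function of any number of distinct nonzero variables is stored as a function of the finite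
  set of these variables.\<close>

type_synonym setfun = "rat fls set \<Rightarrow> rat fls"

typedef shuf = "{f :: setfun. \<forall>X. f X \<noteq> 0 \<longrightarrow> finite X \<and> 0 \<notin> X}"
  morphisms val Abs_shuf by (rule exI[of _ "\<lambda>_. 0"]) simp

setup_lifting type_definition_shuf

lemma val_eq_0: "\<not> (finite X \<and> 0 \<notin> X) \<Longrightarrow> val f X = 0"
  using val[of f] by blast

lemma shuf_eqI:
  assumes "\<And>X. finite X \<Longrightarrow> 0 \<notin> X \<Longrightarrow> val f X = val g X"
  shows "f = g"
proof -
  have "val f X = val g X" for X
    using assms[of X] val_eq_0[of X f] val_eq_0[of X g] by (cases "finite X \<and> 0 \<notin> X") simp_all
  thus ?thesis by (simp add: val_inject[symmetric] fun_eq_iff)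
qed

definition kern :: "rat fls set \<Rightarrow> rat fls set \<Rightarrow> rat fls" where
  "kern A B = (\<Prod>a\<in>A. \<Prod>b\<in>B. (a - T * b) / (a - b))"

lemma kern_empty [simp]: "kern {} B = 1" "kern A {} = 1"
  by (simp_all add: kern_def)

lemma kern_Un_left:
  "finite A \<Longrightarrow> finite A' \<Longrightarrow> A \<inter> A' = {} \<Longrightarrow> kern (A \<union> A') B = kern A B * kern A' B"
  by (simp add: kern_def prod.union_disjoint)

lemma kern_Un_right:
  "finite B \<Longrightarrow> finite B' \<Longrightarrow> B \<inter> B' = {} \<Longrightarrow> kern A (B \<union> B') = kern A B * kern A B'"
  by (simp add: kern_def prod.union_disjoint prod.distrib)

instantiation shuf :: ring_1
begin

lift_definition zero_shuf :: shuf is "\<lambda>_. 0" by simp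
lift_definition one_shuf :: shuf is "\<lambda>X. if X = {} then 1 else 0"
  by (metis (mono_tags) empty_iff finite.emptyI)
lift_definition plus_shuf :: "shuf \<Rightarrow> shuf \<Rightarrow> shuf" is "\<lambda>f g X. f X + g X" by force
lift_definition minus_shuf :: "shuf \<Rightarrow> shuf \<Rightarrow> shuf" is "\<lambda>f g X. f X - g X" by force
lift_definition uminus_shuf :: "shuf \<Rightarrow> shuf" is "\<lambda>f X. - f X" by force
text \<open>The sum over all ways of giving some of the variables to f and the others to g; the
  kernel makes the product noncommutative.\<close>

definition times_shuf :: "shuf \<Rightarrow> shuf \<Rightarrow> shuf" where
  "times_shuf f g = Abs_shuf (\<lambda>X. \<Sum>A\<in>Pow X. val f A * val g (X - A) * kern A (X - A))"

lemma val_mult: "val (f * g) X = (\<Sum>A\<in>Pow X. val f A * val g (X - A) * kern A (X - A))"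
  unfolding times_shuf_def
proof (subst Abs_shuf_inverse; (intro CollectI allI impI)?)
  fix X assume "(\<Sum>A\<in>Pow X. val f A * val g (X - A) * kern A (X - A)) \<noteq> 0"
  then obtain A where A: "A \<in> Pow X" "val f A * val g (X - A) * kern A (X - A) \<noteq> 0"
    by (rule sum.not_neutral_contains_not_neutral)
  hence "finite A \<and> 0 \<notin> A" "finite (X - A) \<and> 0 \<notin> X - A"
    using val_eq_0[of A f] val_eq_0[of "X - A" g] by auto
  thus "finite X \<and> 0 \<notin> X" by (metis DiffI finite_Diff2)
qed simp

instance
proof
  fix a b c :: shuf
  \<comment> \<open>Both sides run over ordered decompositions of X into three blocks. The kernels
    agree because \<open>kern\<close> is multiplicative over disjoint unions in either
    argument.\<close>
  show "a * b * c = a * (b * c)"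
  proof (rule shuf_eqI)
    fix X :: "rat fls set" assume fin: "finite X"
    have fin': "finite Y" if "Y \<subseteq> X" for Y using fin that by (rule rev_finite_subset)
    have "val (a * b * c) X
        = (\<Sum>C\<in>Pow X. \<Sum>A\<in>Pow C. val a A * val b (C - A) * kern A (C - A) * val c (X - C) * kern C (X - C))"
      by (simp add: val_mult sum_distrib_right)
    also have "\<dots> = (\<Sum>(C, A)\<in>(SIGMA C:Pow X. Pow C). val a A * val b (C - A) * kern A (C - A) * val c (X - C) * kern C (X - C))"
      by (rule sum.Sigma) (use fin fin' in auto)
    also have "\<dots> = (\<Sum>(A, B)\<in>(SIGMA A:Pow X. Pow (X - A)). val a A * (val b B * val c (X - A - B) * kern B (X - A - B)) * kern A (X - A))"
    proof (rule sum.reindex_bij_witness[where i = "\<lambda>(A, B). (A \<union> B, A)" and j = "\<lambda>(C, A). (A, C - A)"], goal_cases)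
      case (5 p)
      then obtain C A where p: "p = (C, A)" and C: "C \<subseteq> X" and A: "A \<subseteq> C" by auto
      have 1: "C = A \<union> (C - A)" "X - A = (C - A) \<union> (X - C)" "X - A - (C - A) = X - C"
        using A C by auto
      have "kern C (X - C) = kern A (X - C) * kern (C - A) (X - C)"
        using A C by (subst 1(1), subst kern_Un_left) (auto intro!: fin')
      moreover have "kern A (X - A) = kern A (C - A) * kern A (X - C)"
        using A C by (subst 1(2), subst kern_Un_right) (auto intro!: fin')
      ultimately show ?case by (simp add: p 1(3))
    qed auto
    also have "\<dots> = (\<Sum>A\<in>Pow X. \<Sum>B\<in>Pow (X - A). val a A * (val b B * val c (X - A - B) * kern B (X - A - B)) * kern A (X - A))"
      by (rule sum.Sigma[symmetric]) (use fin in auto)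
    also have "\<dots> = val (a * (b * c)) X"
      by (simp add: val_mult sum_distrib_left sum_distrib_right)
    finally show "val (a * b * c) X = val (a * (b * c)) X" .
  qed
  show "1 * a = a"
  proof (rule shuf_eqI)
    fix X :: "rat fls set" assume "finite X"
    hence "val (1 * a) X = (\<Sum>A\<in>Pow X. if A = {} then val a X else 0)"
      unfolding val_mult one_shuf.rep_eq by (intro sum.cong) auto
    thus "val (1 * a) X = val a X" using \<open>finite X\<close> by (subst (asm) sum.delta) auto
  qed
  show "a * 1 = a"
  proof (rule shuf_eqI)
    fix X :: "rat fls set" assume "finite X"
    hence "val (a * 1) X = (\<Sum>A\<in>Pow X. if A = X then val a X else 0)"
      unfolding val_mult one_shuf.rep_eq by (intro sum.cong) auto
    thus "val (a * 1) X = val a X" using \<open>finite X\<close> by (subst (asm) sum.delta) auto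
  qed
  show "(a + b) * c = a * c + b * c" "a * (b + c) = a * b + a * c"
    by (rule shuf_eqI; simp add: val_mult plus_shuf.rep_eq algebra_simps sum.distrib)+
  show "(0::shuf) \<noteq> 1"
  proof
    assume "(0::shuf) = 1"
    hence "val 0 {} = val 1 {}" by simp
    thus False by (simp add: zero_shuf.rep_eq one_shuf.rep_eq)
  qed
qed (rule shuf_eqI; simp add: zero_shuf.rep_eq plus_shuf.rep_eq minus_shuf.rep_eq uminus_shuf.rep_eq algebra_simps)+

end

definition sc :: "rat fls \<Rightarrow> shuf" where
  "sc c = Abs_shuf (\<lambda>X. if X = {} then c else 0)"

lemma val_sc: "val (sc c) X = (if X = {} then c else 0)"
  by (auto simp: sc_def Abs_shuf_inverse)

lemma val_sc_mult [simp]: "val (sc c * f) X = c * val f X"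
proof (cases "finite X")
  case True
  have "val (sc c * f) X = (\<Sum>A\<in>Pow X. if A = {} then c * val f X else 0)"
    unfolding val_mult val_sc by (intro sum.cong) auto
  thus ?thesis using True by (subst (asm) sum.delta) auto
next
  case False
  hence "val (sc c * f) X = 0" "val f X = 0" by (simp_all add: val_eq_0)
  thus ?thesis by simp
qed

lemma val_mult_sc [simp]: "val (f * sc c) X = c * val f X"
proof (cases "finite X")
  case True
  have "val (f * sc c) X = (\<Sum>A\<in>Pow X. if A = X then c * val f X else 0)"
    unfolding val_mult val_sc by (intro sum.cong) auto
  thus ?thesis using True by (subst (asm) sum.delta) auto
next
  case False
  hence "val (f * sc c) X = 0" "val f X = 0" by (simp_all add: val_eq_0)
  thus ?thesis by simp
qed

lemma sc_commute: "f * sc c = sc c * f"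
  by (rule shuf_eqI) simp

lemma sc_left_commute: "f * (sc c * g) = sc c * (f * g)"
  by (simp add: mult.assoc[symmetric] sc_commute)

lemma sc_0 [simp]: "sc 0 = 0" and sc_1 [simp]: "sc 1 = 1"
  by (rule shuf_eqI; simp add: val_sc zero_shuf.rep_eq one_shuf.rep_eq)+

lemma sc_add: "sc (a + b) = sc a + sc b" and sc_diff: "sc (a - b) = sc a - sc b"
  and sc_uminus: "sc (- a) = - sc a"
  by (rule shuf_eqI; simp add: val_sc plus_shuf.rep_eq minus_shuf.rep_eq uminus_shuf.rep_eq)+

lemma sc_mult: "sc (a * b) = sc a * sc b"
  by (rule shuf_eqI) (simp add: val_sc)

lemma val_sum: "val (\<Sum>i\<in>I. f i) X = (\<Sum>i\<in>I. val (f i) X)"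
  by (induction I rule: infinite_finite_induct) (simp_all add: zero_shuf.rep_eq plus_shuf.rep_eq)

section \<open>Generators of the shuffle algebra, their quadratic relation, and twists\<close>

definition ee :: "int \<Rightarrow> shuf" where
  "ee a = Abs_shuf (\<lambda>X. if X \<noteq> {0} \<and> is_singleton X then the_elem X powi a else 0)"

lemma val_ee: "val (ee a) X = (if X \<noteq> {0} \<and> is_singleton X then the_elem X powi a else 0)"
  unfolding ee_def by (subst Abs_shuf_inverse) (auto simp: is_singleton_def)

lemma val_ee_singleton [simp]: "val (ee a) {y} = (if y = 0 then 0 else y powi a)"
  by (simp add: val_ee)

lemma val_ee_eq_0: "\<not> is_singleton X \<Longrightarrow> val (ee a) X = 0"
  by (simp add: val_ee)

lemma val_ee_mult: 
  assumes "finite X" "0 \<notin> X"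
  shows "val (ee a * f) X = (\<Sum>y\<in>X. y powi a * val f (X - {y}) * kern {y} (X - {y}))"
proof -
  have "val (ee a * f) X = (\<Sum>A\<in>(\<lambda>y. {y}) ` X. val (ee a) A * val f (X - A) * kern A (X - A))"
    unfolding val_mult
    by (rule sum.mono_neutral_right) (use assms in \<open>auto simp: val_ee is_singleton_def\<close>)
  also have "\<dots> = (\<Sum>y\<in>X. val (ee a) {y} * val f (X - {y}) * kern {y} (X - {y}))"
    by (subst sum.reindex) auto
  also have "\<dots> = (\<Sum>y\<in>X. y powi a * val f (X - {y}) * kern {y} (X - {y}))"
    using assms by (intro sum.cong) auto
  finally show ?thesis .
qed

text \<open>On two points y and w both sides equal T (y w)^(a-1) (y + w); on all other sets both
  vanish.\<close>

lemma ee_swap: "ee (a - 1) * ee a = sc T * ee a * ee (a - 1)"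
proof (rule shuf_eqI)
  fix X :: "rat fls set" assume fin: "finite X" and nz: "0 \<notin> X"
  show "val (ee (a - 1) * ee a) X = val (sc T * ee a * ee (a - 1)) X"
  proof (cases "\<exists>y w. y \<noteq> w \<and> X = {y, w}")
    case True
    then obtain y w where yw: "y \<noteq> w" "X = {y, w}" by blast
    have X: "{y, w} - {y} = {w}" "{y, w} - {w} = {y}" using yw(1) by auto
    from nz yw have nz': "y \<noteq> 0" "w \<noteq> 0" by auto
    have [simp]: "y powi (a - 1) = y powi a / y" "w powi (a - 1) = w powi a / w"
      using nz' by (simp_all add: power_int_diff)
    have "y - w \<noteq> 0" "w - y \<noteq> 0" using yw by auto
    thus ?thesis
      using yw nz' unfolding mult.assoc val_sc_mult val_ee_mult[OF fin nz]
      by (simp add: X kern_def divide_simps) (simp add: algebra_simps)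
  next
    case False
    have "val (ee b) (X - {y}) = 0" if "y \<in> X" for b y
    proof (rule val_ee_eq_0)
      show "\<not> is_singleton (X - {y})"
      proof
        assume "is_singleton (X - {y})"
        then obtain w where "X - {y} = {w}" by (auto simp: is_singleton_def)
        hence "y \<noteq> w \<and> X = {y, w}" using that by auto
        with False show False by blast
      qed
    qed
    thus ?thesis unfolding mult.assoc val_sc_mult val_ee_mult[OF fin nz] by simp
  qed
qed

text \<open>A product over the variables splits along every decomposition of the set, so this is a
  ring endomorphism. Sets through z are discarded to match \<open>skew_deriv\<close> below; the
  choice z = 0 discards nothing.\<close>

definition twist :: "rat fls \<Rightarrow> (rat fls \<Rightarrow> rat fls) \<Rightarrow> shuf \<Rightarrow> shuf" where
  "twist z g f = Abs_shuf (\<lambda>X. if z \<in> X then 0 else (\<Prod>y\<in>X. g y) * val f X)"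

lemma val_twist: "val (twist z g f) X = (if z \<in> X then 0 else (\<Prod>y\<in>X. g y) * val f X)"
  unfolding twist_def by (subst Abs_shuf_inverse) (use val_eq_0[of _ f] in auto)

lemma twist_mult: "twist z g (f * h) = twist z g f * twist z g h"
proof (rule shuf_eqI)
  fix X :: "rat fls set" assume fin: "finite X"
  have "val (twist z g f) A * val (twist z g h) (X - A) * kern A (X - A)
      = (if z \<in> X then 0 else (\<Prod>y\<in>X. g y) * (val f A * val h (X - A) * kern A (X - A)))"
    if "A \<in> Pow X" for A
  proof -
    have "(\<Prod>y\<in>X. g y) = (\<Prod>y\<in>X - A. g y) * (\<Prod>y\<in>A. g y)"
      using that fin by (intro prod.subset_diff) auto
    thus ?thesis using that by (auto simp: val_twist)
  qed
  thus "val (twist z g (f * h)) X = val (twist z g f * twist z g h) X"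
    unfolding val_mult[of "twist z g f"] by (simp add: val_twist val_mult sum_distrib_left)
qed

lemma twist_1 [simp]: "twist z g 1 = 1"
  by (rule shuf_eqI) (auto simp: val_twist one_shuf.rep_eq)

lemma twist_sc [simp]: "twist z g (sc c) = sc c"
  by (rule shuf_eqI) (auto simp: val_twist val_sc)

lemma twist_power: "twist z g (f ^ m) = twist z g f ^ m"
  by (induction m) (simp_all add: twist_mult)

lemma twist_add: "twist z g (f + h) = twist z g f + twist z g h"
  and twist_diff: "twist z g (f - h) = twist z g f - twist z g h"
  by (rule shuf_eqI; simp add: val_twist plus_shuf.rep_eq minus_shuf.rep_eq algebra_simps)+

text \<open>The twisted generator stays in the span of the exponents j and j - 1, precisely the pair
  that \<open>ee_swap\<close> can reorder.\<close>

lemma twist_ee: "twist z (\<lambda>y. \<alpha> - \<beta> / y) (ee j)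
  = sc \<alpha> * twist z (\<lambda>_. 1) (ee j) - sc \<beta> * twist z (\<lambda>_. 1) (ee (j - 1))"
proof (rule shuf_eqI)
  fix X :: "rat fls set" assume "finite X" "0 \<notin> X"
  show "val (twist z (\<lambda>y. \<alpha> - \<beta> / y) (ee j)) X
      = val (sc \<alpha> * twist z (\<lambda>_. 1) (ee j) - sc \<beta> * twist z (\<lambda>_. 1) (ee (j - 1))) X"
  proof (cases "is_singleton X")
    case True
    then obtain y where "X = {y}" by (auto simp: is_singleton_def)
    thus ?thesis using \<open>0 \<notin> X\<close>
      by (simp add: val_twist minus_shuf.rep_eq power_int_diff field_simps)
  qed (simp add: val_twist minus_shuf.rep_eq val_ee_eq_0)
qed

lemma twist_0_1: "twist 0 (\<lambda>_. 1) f = f"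
  by (rule shuf_eqI) (simp add: val_twist)

section \<open>The Pieri rule\<close>

text \<open>On \<open>n\<close> points \<open>ordered_prod \<mu>\<close> is \<open>\<Sum>\<^sub>\<sigma> \<sigma>(x\<^sup>\<mu> \<Prod>(x\<^sub>i - t x\<^sub>j)/(x\<^sub>i - x\<^sub>j))\<close>, the product over \<open>i < j\<close>
  with no stabilizer factor divided out; \<open>hl_lead \<mu>\<close> below is its leading coefficient.\<close>

definition ordered_prod :: "int multiset \<Rightarrow> shuf" where
  "ordered_prod \<mu> = prod_list (map ee (rev (sorted_list_of_multiset \<mu>)))"

lemma ordered_prod_empty [simp]: "ordered_prod {#} = 1"
  by (simp add: ordered_prod_def)

lemma ordered_prod_add_max: "(\<And>b. b \<in># \<mu> \<Longrightarrow> b \<le> a) \<Longrightarrow> ordered_prod (add_mset a \<mu>) = ee a * ordered_prod \<mu>"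
  by (simp add: ordered_prod_def sorted_insort_is_snoc)

lemma ordered_prod_add_min: "(\<And>b. b \<in># \<mu> \<Longrightarrow> a \<le> b) \<Longrightarrow> ordered_prod (add_mset a \<mu>) = ordered_prod \<mu> * ee a"
  by (simp add: ordered_prod_def insort_is_Cons)

lemma ordered_prod_replicate_max:
  "(\<And>b. b \<in># \<mu> \<Longrightarrow> b \<le> a) \<Longrightarrow> ordered_prod (replicate_mset m a + \<mu>) = ee a ^ m * ordered_prod \<mu>"
proof (induction m)
  case (Suc m)
  have "ordered_prod (add_mset a (replicate_mset m a + \<mu>)) = ee a * ordered_prod (replicate_mset m a + \<mu>)"
    using Suc.prems by (intro ordered_prod_add_max) (auto split: if_splits)
  thus ?case using Suc by (simp add: mult.assoc)
qed simp

lemma ordered_prod_replicate_min: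
  "(\<And>b. b \<in># \<mu> \<Longrightarrow> a \<le> b) \<Longrightarrow> ordered_prod (\<mu> + replicate_mset m a) = ordered_prod \<mu> * ee a ^ m"
proof (induction m)
  case (Suc m)
  have "ordered_prod (add_mset a (\<mu> + replicate_mset m a)) = ordered_prod (\<mu> + replicate_mset m a) * ee a"
    using Suc.prems by (intro ordered_prod_add_min) (auto split: if_splits)
  thus ?case using Suc by (simp add: mult.assoc power_commutes)
qed simp

lemma ee_swap_power: "ee (a - 1) * ee a ^ p = sc (T ^ p) * (ee a ^ p * ee (a - 1))"
proof (induction p)
  case (Suc p)
  have "ee (a - 1) * ee a ^ Suc p = sc T * ee a * (ee (a - 1) * ee a ^ p)"
    by (simp add: mult.assoc[symmetric] ee_swap)
  also have "\<dots> = sc (T ^ Suc p) * (ee a ^ Suc p * ee (a - 1))"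
    unfolding Suc.IH by (simp add: sc_mult mult.assoc sc_left_commute[of "ee a"])
  finally show ?case .
qed simp

text \<open>A generator of exponent a - 1 stands one place too far left only with respect to the
  copies of a. Each exchange costs a factor T, and no other exponents have to be crossed.\<close>

lemma ordered_prod_insert:
  assumes "\<And>b. b \<in># \<kappa> \<Longrightarrow> b \<le> a"
  shows "ee (a - 1) * ordered_prod \<kappa> = sc (T ^ count \<kappa> a) * ordered_prod (add_mset (a - 1) \<kappa>)"
proof -
  define \<kappa>0 where "\<kappa>0 = filter_mset (\<lambda>b. b < a) \<kappa>"
  have \<kappa>: "\<kappa> = replicate_mset (count \<kappa> a) a + \<kappa>0"
    using assms by (intro multiset_eqI) (auto simp: \<kappa>0_def count_eq_zero_iff not_less dest: antisym)
  have le: "b \<le> a - 1" if "b \<in># \<kappa>0" for b using that by (auto simp: \<kappa>0_def)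
  have "ee (a - 1) * ordered_prod \<kappa> = ee (a - 1) * (ee a ^ count \<kappa> a * ordered_prod \<kappa>0)"
    by (subst \<kappa>, subst ordered_prod_replicate_max) (use le in force)+
  also have "\<dots> = sc (T ^ count \<kappa> a) * (ee a ^ count \<kappa> a * (ee (a - 1) * ordered_prod \<kappa>0))"
    by (simp add: mult.assoc[symmetric] ee_swap_power)
  also have "ee (a - 1) * ordered_prod \<kappa>0 = ordered_prod (add_mset (a - 1) \<kappa>0)"
    using le by (rule ordered_prod_add_max[symmetric])
  also have "ee a ^ count \<kappa> a * \<dots> = ordered_prod (replicate_mset (count \<kappa> a) a + add_mset (a - 1) \<kappa>0)"
    by (rule ordered_prod_replicate_max[symmetric]) (use le in force)
  also have "replicate_mset (count \<kappa> a) a + add_mset (a - 1) \<kappa>0 = add_mset (a - 1) \<kappa>"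
    using \<kappa> by (metis union_mset_add_mset_right)
  finally show ?thesis .
qed

abbreviation dec :: "int multiset \<Rightarrow> int multiset" where
  "dec r \<equiv> image_mset (\<lambda>j. j - 1) r"

text \<open>A T-count of the ways to choose, among equal parts of \<mu>, those parts r that are
  lowered.\<close>

definition pcoef :: "int multiset \<Rightarrow> int multiset \<Rightarrow> rat fls" where
  "pcoef \<mu> r = (\<Prod>j\<in>set_mset \<mu>. tb (count \<mu> j) (count r j))"

lemma submultisets_add:
  "{r. r \<subseteq># add_mset a \<mu>} = {r. r \<subseteq># \<mu>} \<union> add_mset a ` {r. r \<subseteq># \<mu>}"
proof (intro equalityI subsetI)
  fix r assume "r \<in> {r. r \<subseteq># add_mset a \<mu>}"
  hence r: "r \<subseteq># add_mset a \<mu>" by simp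
  show "r \<in> {r. r \<subseteq># \<mu>} \<union> add_mset a ` {r. r \<subseteq># \<mu>}"
  proof (cases "a \<in># r")
    case True
    then obtain r' where "r = add_mset a r'" by (metis insert_DiffM)
    thus ?thesis using r by auto
  next
    case False
    hence "r \<subseteq># \<mu>" using r
      by (metis add_mset_remove_trivial diff_single_trivial subset_eq_diff_conv add_mset_add_single)
    thus ?thesis by simp
  qed
qed (auto intro: subset_mset.order_trans)

lemma finite_submultisets [simp]: "finite {r. r \<subseteq># (\<mu> :: 'a multiset)}"
  by (induction \<mu>) (simp_all add: submultisets_add)

lemma submultiset_max:
  assumes "\<And>b. b \<in># \<mu> \<Longrightarrow> b \<le> (a::int)" "r \<subseteq># \<mu>" "b \<in># \<mu> - r + dec r"
  shows "b \<le> a"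
  using assms by (fastforce dest: in_diffD mset_subset_eqD)

text \<open>The product of the factors 1 - s/y generates the elementary symmetric functions of the
  inverse variables. Induction peels off the largest part a, whose twist
  \<open>ee a - sc s * ee (a - 1)\<close> either keeps the part or lowers it by one.\<close>

theorem pieri:
  "twist 0 (\<lambda>y. 1 - s / y) (ordered_prod \<mu>)
    = (\<Sum>r | r \<subseteq># \<mu>. sc ((- s) ^ size r * pcoef \<mu> r) * ordered_prod (\<mu> - r + dec r))"
proof (induction "size \<mu>" arbitrary: \<mu>)
  case 0
  thus ?case by (simp add: pcoef_def)
next
  case (Suc k)
  hence ne: "set_mset \<mu> \<noteq> {}" by auto
  define a where "a = Max (set_mset \<mu>)"
  have "a \<in># \<mu>" using ne by (simp add: a_def)
  then obtain \<nu> where \<mu>: "\<mu> = add_mset a \<nu>" by (metis insert_DiffM)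
  have le: "b \<le> a" if "b \<in># \<nu>" for b
  proof -
    have "b \<in># \<mu>" using that unfolding \<mu> by simp
    thus ?thesis by (simp add: a_def)
  qed
  define m where "m = count \<nu> a"
  define P where "P r = (\<Prod>j\<in>set_mset \<nu> - {a}. tb (count \<nu> j) (count r j))" for r
  have pcoef_\<nu>: "pcoef \<nu> r = tb m (count r a) * P r" if "r \<subseteq># \<nu>" for r
  proof (cases "a \<in># \<nu>")
    case True
    thus ?thesis unfolding pcoef_def P_def m_def by (subst prod.remove[of _ a]) auto
  next
    case False
    have "count r a \<le> count \<nu> a" using that by (simp add: mset_subset_eq_count)
    thus ?thesis using False unfolding pcoef_def P_def m_def by (simp add: not_in_iff)
  qed
  have pcoef_\<mu>: "pcoef \<mu> r = tb (Suc m) (count r a) * P r" for r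
  proof -
    have "(\<Prod>j\<in>set_mset \<nu> - {a}. tb (count \<mu> j) (count r j)) = P r"
      unfolding P_def by (intro prod.cong) (auto simp: \<mu>)
    thus ?thesis unfolding pcoef_def
      by (subst prod.remove[of _ a]) (auto simp: \<mu> m_def)
  qed
  define F where "F r = sc ((- s) ^ size r) * ordered_prod (\<mu> - r + dec r)" for r
  have "twist 0 (\<lambda>y. 1 - s / y) (ordered_prod \<mu>) = (ee a - sc s * ee (a - 1)) * twist 0 (\<lambda>y. 1 - s / y) (ordered_prod \<nu>)"
  proof -
    have "ordered_prod \<mu> = ee a * ordered_prod \<nu>" unfolding \<mu> using le by (rule ordered_prod_add_max)
    thus ?thesis by (simp add: twist_mult twist_ee[of 0 1 s] twist_0_1)
  qed
  also have "\<dots> = (\<Sum>r | r \<subseteq># \<nu>. (ee a - sc s * ee (a - 1)) * (sc ((- s) ^ size r * pcoef \<nu> r) * ordered_prod (\<nu> - r + dec r)))"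
    using Suc by (simp add: \<mu> sum_distrib_left)
  \<comment> \<open>Each r contributes to r (a is kept) and to \<open>add_mset a r\<close> (a is
    lowered). The power of T comes from moving \<open>ee (a - 1)\<close> past the m - count r a
    remaining copies of a; it is written in terms of \<open>add_mset a r\<close> to allow
    reindexing.\<close>
  also have "\<dots> = (\<Sum>r | r \<subseteq># \<nu>. sc (tb m (count r a) * P r) * F r
      + sc (T ^ (Suc m - count (add_mset a r) a) * tb m (count r a) * P (add_mset a r)) * F (add_mset a r))"
  proof (rule sum.cong[OF refl], goal_cases)
    case (1 r)
    hence r: "r \<subseteq># \<nu>" by simp
    define \<kappa> where "\<kappa> = \<nu> - r + dec r"
    have le': "b \<le> a" if "b \<in># \<kappa>" for b
      using submultiset_max[OF le r] that by (simp add: \<kappa>_def)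
    have "a \<notin># dec r" using r le by (fastforce dest: mset_subset_eqD)
    hence count: "count \<kappa> a = m - count r a" by (simp add: \<kappa>_def m_def count_eq_zero_iff)
    have eq1: "\<mu> - r + dec r = add_mset a \<kappa>"
      using r by (auto simp: \<mu> \<kappa>_def mset_subset_eq_exists_conv)
    have eq2: "\<mu> - add_mset a r + dec (add_mset a r) = add_mset (a - 1) \<kappa>"
      by (simp add: \<mu> \<kappa>_def)
    have P: "P (add_mset a r) = P r" unfolding P_def by (intro prod.cong) auto
    have e1: "ee a * ordered_prod \<kappa> = ordered_prod (add_mset a \<kappa>)" using le' by (simp add: ordered_prod_add_max)
    have e2: "ee (a - 1) * ordered_prod \<kappa> = sc (T ^ (m - count r a)) * ordered_prod (add_mset (a - 1) \<kappa>)"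
      using ordered_prod_insert[OF le'] by (simp add: count)
    define c where "c = (- s) ^ size r * pcoef \<nu> r"
    have c1: "c = tb m (count r a) * P r * (- s) ^ size r" by (simp add: c_def pcoef_\<nu>[OF r])
    have c2: "T ^ (Suc m - count (add_mset a r) a) * tb m (count r a) * P (add_mset a r) * (- s) ^ size (add_mset a r)
        = - (s * (c * T ^ (m - count r a)))" by (simp add: c1 P)
    have "(ee a - sc s * ee (a - 1)) * (sc c * ordered_prod \<kappa>) = sc c * (ee a * ordered_prod \<kappa>) - sc s * (sc c * (ee (a - 1) * ordered_prod \<kappa>))"
      by (simp only: left_diff_distrib mult.assoc sc_left_commute[of "ee a"] sc_left_commute[of "ee (a - 1)"])
    also have "\<dots> = sc c * ordered_prod (add_mset a \<kappa>) + sc (- (s * (c * T ^ (m - count r a)))) * ordered_prod (add_mset (a - 1) \<kappa>)"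
      by (simp only: e1 e2 sc_mult sc_uminus mult.assoc) (simp add: mult.assoc)
    finally show ?case
      unfolding F_def eq1 eq2 \<kappa>_def[symmetric] c_def[symmetric] mult.assoc[symmetric] sc_mult[symmetric] c2 c1[symmetric] .
  qed
  also have "\<dots> = (\<Sum>r | r \<subseteq># \<nu>. sc (tb m (count r a) * P r) * F r)
      + (\<Sum>r | r \<subseteq># \<nu>. sc (T ^ (Suc m - count (add_mset a r) a) * tb m (count (add_mset a r) a - 1) * P (add_mset a r)) * F (add_mset a r))"
    by (simp add: sum.distrib)
  \<comment> \<open>The additional sub-multisets contain a more than m times, where the binomial is
    zero.\<close>
  also have "(\<Sum>r | r \<subseteq># \<nu>. sc (tb m (count r a) * P r) * F r) = (\<Sum>r | r \<subseteq># \<mu>. sc (tb m (count r a) * P r) * F r)"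
  proof (rule sum.mono_neutral_left)
    show "\<forall>r\<in>{r. r \<subseteq># \<mu>} - {r. r \<subseteq># \<nu>}. sc (tb m (count r a) * P r) * F r = 0"
    proof
      fix r assume r: "r \<in> {r. r \<subseteq># \<mu>} - {r. r \<subseteq># \<nu>}"
      have "m < count r a"
      proof (rule ccontr)
        assume "\<not> m < count r a"
        hence "count r b \<le> count \<nu> b" for b
          using r mset_subset_eq_count[of r \<mu> b] by (cases "b = a") (auto simp: m_def \<mu>)
        thus False using r by (auto simp: subseteq_mset_def)
      qed
      thus "sc (tb m (count r a) * P r) * F r = 0" by simp
    qed
  qed (auto simp: \<mu> intro: subset_mset.order_trans)
  also have "(\<Sum>r | r \<subseteq># \<nu>. sc (T ^ (Suc m - count (add_mset a r) a) * tb m (count (add_mset a r) a - 1) * P (add_mset a r)) * F (add_mset a r))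
     = (\<Sum>r\<in>add_mset a ` {r. r \<subseteq># \<nu>}. sc (T ^ (Suc m - count r a) * tb m (count r a - 1) * P r) * F r)"
    by (subst sum.reindex) (auto simp: inj_on_def)
  also have "\<dots> = (\<Sum>r\<in>add_mset a ` {r. r \<subseteq># \<nu>}. if a \<in># r then sc (T ^ (Suc m - count r a) * tb m (count r a - 1) * P r) * F r else 0)"
    by (rule sum.cong) auto
  also have "\<dots> = (\<Sum>r | r \<subseteq># \<mu>. if a \<in># r then sc (T ^ (Suc m - count r a) * tb m (count r a - 1) * P r) * F r else 0)"
  proof (rule sum.mono_neutral_left, goal_cases)
    case 3
    show ?case
    proof (intro ballI if_not_P notI)
      fix r assume r: "r \<in> {r. r \<subseteq># \<mu>} - add_mset a ` {r. r \<subseteq># \<nu>}" and "a \<in># r"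
      then obtain r' where "r = add_mset a r'" by (metis insert_DiffM)
      thus False using r by (auto simp: \<mu>)
    qed
  qed (auto simp: \<mu>)
  \<comment> \<open>For r containing a, the contributions with a kept and with a lowered add up by
    \<open>tb_pascal\<close>.\<close>
  also have "(\<Sum>r | r \<subseteq># \<mu>. sc (tb m (count r a) * P r) * F r) + \<dots> = (\<Sum>r | r \<subseteq># \<mu>. sc (pcoef \<mu> r) * F r)"
    unfolding sum.distrib[symmetric]
  proof (rule sum.cong[OF refl], goal_cases)
    case (1 r)
    show ?case
    proof (cases "count r a")
      case 0
      hence "a \<notin># r" by (simp add: not_in_iff)
      thus ?thesis unfolding pcoef_\<mu> 0 by simp
    next
      case (Suc c)
      hence "a \<in># r" by (metis count_greater_zero_iff zero_less_Suc)
      thus ?thesis by (simp add: pcoef_\<mu> Suc tb_pascal sc_add[symmetric] distrib_right[symmetric])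
    qed
  qed
  also have "\<dots> = (\<Sum>r | r \<subseteq># \<mu>. sc ((- s) ^ size r * pcoef \<mu> r) * ordered_prod (\<mu> - r + dec r))"
    by (simp add: F_def mult.assoc[symmetric] sc_mult[symmetric] mult.commute)
  finally show ?case .
qed

section \<open>The branching rule\<close>

text \<open>Specializing one variable to \<open>z\<close> is a twisted derivation of the shuffle product once the poles of the
  kernel at \<open>y = z\<close> are cleared by the factors \<open>1 - z/y\<close>.\<close>

definition skew_deriv :: "rat fls \<Rightarrow> shuf \<Rightarrow> shuf" where
  "skew_deriv z f = Abs_shuf (\<lambda>X. if z \<in> X then 0 else (\<Prod>y\<in>X. 1 - z / y) * val f (insert z X))"

lemma val_skew_deriv: "val (skew_deriv z f) X = (if z \<in> X then 0 else (\<Prod>y\<in>X. 1 - z / y) * val f (insert z X))"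
  unfolding skew_deriv_def
proof (subst Abs_shuf_inverse; (intro CollectI allI impI)?)
  fix X assume "(if z \<in> X then 0 else (\<Prod>y\<in>X. 1 - z / y) * val f (insert z X)) \<noteq> 0"
  thus "finite X \<and> 0 \<notin> X" using val_eq_0[of "insert z X" f] by (auto split: if_splits)
qed simp

lemma kern_insert_left:
  "finite A \<Longrightarrow> z \<notin> A \<Longrightarrow> kern (insert z A) B = (\<Prod>b\<in>B. (z - T * b) / (z - b)) * kern A B"
  by (simp add: kern_def)

lemma kern_insert_right:
  "finite B \<Longrightarrow> z \<notin> B \<Longrightarrow> kern A (insert z B) = (\<Prod>a\<in>A. (a - T * z) / (a - z)) * kern A B"
  unfolding kern_def by (simp only: prod.insert prod.distrib not_False_eq_True)

text \<open>The subsets of \<open>insert z X\<close> either contain z or do not. In the first case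
  the kernel gives (z - T b)/(z - b), in the second (a - T z)/(a - z); multiplied by the clearing
  factor 1 - z/y these become T - z/y and 1 - T z/y, so no pole at z is left.\<close>

lemma skew_deriv_mult:
  "skew_deriv z (f * g) = skew_deriv z f * twist z (\<lambda>y. T - z / y) g + twist z (\<lambda>y. 1 - T * z / y) f * skew_deriv z g"
proof (rule shuf_eqI)
  fix X :: "rat fls set" assume fin: "finite X" and nz: "0 \<notin> X"
  let ?R = "skew_deriv z f * twist z (\<lambda>y. T - z / y) g + twist z (\<lambda>y. 1 - T * z / y) f * skew_deriv z g"
  show "val (skew_deriv z (f * g)) X = val ?R X"
  proof (cases "z \<in> X")
    case True
    have "val (skew_deriv z f) A * val (twist z (\<lambda>y. T - z / y) g) (X - A) * kern A (X - A) = 0"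
         "val (twist z (\<lambda>y. 1 - T * z / y) f) A * val (skew_deriv z g) (X - A) * kern A (X - A) = 0" for A
      using True by (auto simp: val_skew_deriv val_twist)
    hence "val ?R X = 0" unfolding plus_shuf.rep_eq val_mult by (simp only: sum.neutral_const add_0)
    thus ?thesis using True by (simp add: val_skew_deriv)
  next
    case z: False
    have inj: "inj_on (insert z) (Pow X)" using z by (auto simp: inj_on_def) 
    have disj: "Pow X \<inter> insert z ` Pow X = {}" using z by auto
    let ?t = "\<lambda>A. val f A * val g (insert z X - A) * kern A (insert z X - A)"
    have "val (f * g) (insert z X) = sum ?t (Pow X) + sum ?t (insert z ` Pow X)"
      unfolding val_mult Pow_insert using fin disj by (intro sum.union_disjoint) auto
    also have "sum ?t (insert z ` Pow X) = (\<Sum>A\<in>Pow X. ?t (insert z A))"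
      using inj by (simp add: sum.reindex)
    finally have eq: "val (skew_deriv z (f * g)) X
        = (\<Sum>A\<in>Pow X. (\<Prod>y\<in>X. 1 - z / y) * ?t (insert z A)) + (\<Sum>A\<in>Pow X. (\<Prod>y\<in>X. 1 - z / y) * ?t A)"
      using z by (simp add: val_skew_deriv algebra_simps sum_distrib_left)
    have split: "(\<Prod>y\<in>X. 1 - z / y) = (\<Prod>y\<in>X - A. 1 - z / y) * (\<Prod>y\<in>A. 1 - z / y)" if "A \<subseteq> X" for A
      using that fin by (intro prod.subset_diff) auto
    have 1: "(\<Prod>y\<in>X. 1 - z / y) * ?t (insert z A)
        = val (skew_deriv z f) A * val (twist z (\<lambda>y. T - z / y) g) (X - A) * kern A (X - A)" if A: "A \<subseteq> X" for A
    proof -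
      have "insert z X - insert z A = X - A" using z by auto
      moreover have "(\<Prod>b\<in>X - A. (z - T * b) / (z - b)) * (\<Prod>y\<in>X - A. 1 - z / y) = (\<Prod>y\<in>X - A. T - z / y)"
        unfolding prod.distrib[symmetric]
      proof (rule prod.cong[OF refl], goal_cases)
        case (1 b)
        hence "b \<noteq> 0" "z - b \<noteq> 0" using nz z by auto
        thus ?case by (simp add: divide_simps) (simp add: algebra_simps)
      qed
      moreover have "z \<notin> A" "finite A" using A z fin by (auto intro: finite_subset)
      ultimately show ?thesis using z A
        by (simp add: split[OF A] val_skew_deriv val_twist kern_insert_left) (simp add: mult_ac)
    qed
    have 2: "(\<Prod>y\<in>X. 1 - z / y) * ?t A
        = val (twist z (\<lambda>y. 1 - T * z / y) f) A * val (skew_deriv z g) (X - A) * kern A (X - A)" if A: "A \<subseteq> X" for A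
    proof -
      have "insert z X - A = insert z (X - A)" using z A by auto
      moreover have "(\<Prod>a\<in>A. (a - T * z) / (a - z)) * (\<Prod>y\<in>A. 1 - z / y) = (\<Prod>y\<in>A. 1 - T * z / y)"
        unfolding prod.distrib[symmetric]
      proof (rule prod.cong[OF refl], goal_cases)
        case (1 b)
        hence "b \<noteq> 0" "b - z \<noteq> 0" using nz z A by auto
        thus ?case by (simp add: divide_simps)
      qed
      moreover have "z \<notin> A" "finite A" "finite (X - A)" using A z fin by (auto intro: finite_subset)
      ultimately show ?thesis using z A
        by (simp add: split[OF A] val_skew_deriv val_twist kern_insert_right) (simp add: mult_ac)
    qed
    show ?thesis unfolding eq plus_shuf.rep_eq val_mult
      by (intro arg_cong2[where f = "(+)"] sum.cong refl) (simp_all only: 1 2 Pow_iff)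
  qed
qed

lemma skew_deriv_sc [simp]: "skew_deriv z (sc c) = 0"
  by (rule shuf_eqI) (simp add: val_skew_deriv val_sc zero_shuf.rep_eq)

lemma skew_deriv_1 [simp]: "skew_deriv z 1 = 0"
  using skew_deriv_sc[of z 1] by (simp del: skew_deriv_sc)

lemma skew_deriv_ee: "z \<noteq> 0 \<Longrightarrow> skew_deriv z (ee j) = sc (z powi j)"
proof (rule shuf_eqI)
  fix X :: "rat fls set" assume z: "z \<noteq> 0" and X: "finite X" "0 \<notin> X"
  show "val (skew_deriv z (ee j)) X = val (sc (z powi j)) X"
  proof (cases "X = {}")
    case False
    have "\<not> is_singleton (insert z X)" if "z \<notin> X"
      using that False by (auto simp: is_singleton_def)
    thus ?thesis using False by (simp add: val_skew_deriv val_sc val_ee_eq_0)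
  qed (use z in \<open>simp add: val_skew_deriv val_sc\<close>)
qed

subsection \<open>Powers in a quantum plane\<close>

context
  fixes A B :: shuf
  assumes BA: "B * A = sc T * (A * B)"
begin

lemma BA': "B * (A * x) = sc T * (A * (B * x))"
  by (metis BA mult.assoc)

lemma sc_merge: "sc a * sc b = sc (a * b)" "sc a * (sc b * x) = sc (a * b) * x"
  by (simp_all add: sc_mult mult.assoc)

lemmas qplane = algebra_simps BA BA' sc_left_commute[of A] sc_left_commute[of B]
  sc_commute[of A] sc_commute[of B] sc_merge

text \<open>In the application A is \<open>ee j\<close> and B is z times \<open>ee (j - 1)\<close>,
  both restricted to sets without z, and the commutation rule is \<open>ee_swap\<close>. The three
  twists of \<open>ee j\<close> are then T A - B, A - B and A - T B. These lemmas rewrite powers of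
  the outer two through powers of A - B.\<close>

lemma qpow_A: "(sc T * A - B) ^ Suc m = (sc (T ^ Suc m) * A - B) * (A - B) ^ m"
proof (induction m)
  case (Suc m)
  have "(sc T * A - B) * (sc (T ^ Suc m) * A - B) = (sc (T ^ Suc (Suc m)) * A - B) * (A - B)"
    by (simp add: qplane)
  thus ?case using Suc by (metis mult.assoc power_Suc)
qed simp

lemma qpow_B: "(A - sc T * B) ^ Suc m = (A - B) ^ m * (A - sc (T ^ Suc m) * B)"
proof (induction m)
  case (Suc m)
  have "(A - sc (T ^ Suc m) * B) * (A - sc T * B) = (A - B) * (A - sc (T ^ Suc (Suc m)) * B)"
    by (simp add: qplane)
  thus ?case using Suc
    by (metis mult.assoc power_Suc2)
qed simp

lemma qpow_commute: "A * (A - sc T * B) ^ m = (A - B) ^ m * A"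
proof (induction m)
  case (Suc m)
  have "(A - B) * A = A * (A - sc T * B)" by (simp add: qplane)
  thus ?case using Suc by (metis mult.assoc power_Suc2 power_Suc)
qed simp

text \<open>The only way in which T A - B enters the branching rule. At m = 0 the scalar 1 - T^m is
  zero, so the truncated exponent m - 1 is harmless.\<close>

lemma qpow_tA: "(sc T * A - B) ^ m + sc (1 - T ^ m) * (A * (A - B) ^ (m - 1)) = (A - B) ^ m"
proof (cases m)
  case (Suc k)
  show ?thesis unfolding Suc qpow_A
    by (simp add: left_diff_distrib sc_diff mult.assoc)
qed simp

lemma qpow_tB: "(A - sc T * B) ^ m = (A - B) ^ m + sc (1 - T ^ m) * ((A - B) ^ (m - 1) * B)"
proof (cases m)
  case (Suc k)
  show ?thesis unfolding Suc qpow_B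
    by (simp add: power_Suc2 right_diff_distrib left_diff_distrib sc_diff mult.assoc sc_left_commute del: power_Suc)
qed simp

end

text \<open>The Leibniz rule and \<open>qpow_B\<close> leave (A - B)^(m-1) times a combination of A
  and B. Its coefficients agree because [m] T + 1 and [m] + T^m are both [m + 1], where [m] is
  \<open>tnum m\<close>.\<close>

lemma skew_deriv_power:
  fixes j z
  assumes z: "z \<noteq> 0"
  defines "A \<equiv> twist z (\<lambda>_. 1) (ee j)" and "B \<equiv> sc z * twist z (\<lambda>_. 1) (ee (j - 1))"
  shows "B * A = sc T * (A * B)" (is ?comm)
    and "skew_deriv z (ee j ^ m) = sc (z powi j * tnum m) * (A - B) ^ (m - 1)" (is ?pow)
proof -
  show comm: ?comm
  proof -
    have "twist z (\<lambda>_. 1) (ee (j - 1)) * A = sc T * (A * twist z (\<lambda>_. 1) (ee (j - 1)))"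
      unfolding A_def twist_mult[symmetric] ee_swap by (simp add: twist_mult mult.assoc)
    thus ?thesis unfolding B_def
      by (simp add: mult.assoc sc_left_commute[of A] sc_left_commute[of "sc T"])
  qed
  have T: "twist z (\<lambda>y. T - z / y) (ee j) = sc T * A - B"
    unfolding A_def B_def by (rule twist_ee)
  have T': "twist z (\<lambda>y. 1 - T * z / y) (ee j) = A - sc T * B"
    using twist_ee[of z 1 "T * z" j] by (simp add: A_def B_def sc_mult mult.assoc)
  show ?pow
  proof (induction m)
    case (Suc m)
    show ?case
    proof (cases m)
      case 0
      thus ?thesis using skew_deriv_ee[OF z, of j] by simp
    next
      case (Suc k)
      let ?u = "z powi j * tnum m" and ?v = "z powi j"
      have "skew_deriv z (ee j ^ Suc m) = skew_deriv z (ee j ^ m * ee j)" by (simp only: power_Suc2)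
      also have "\<dots> = sc ?u * (A - B) ^ k * (sc T * A - B) + (A - sc T * B) ^ Suc k * sc ?v"
        unfolding skew_deriv_mult Suc.IH twist_power T T' skew_deriv_ee[OF z] by (simp add: Suc)
      also have "\<dots> = (A - B) ^ k * (sc (?u * T + ?v) * A - sc (?u + ?v * T ^ Suc k) * B)"
      proof -
        define C where "C = (A - B) ^ k"
        have "sc u * C * (sc T * A - B) + C * (A - sc t * B) * sc v = C * (sc (u * T + v) * A - sc (u + v * t) * B)" for u v t
        proof -
          have "C * (A - sc t * B) * sc v = sc v * (C * (A - sc t * B))" by (rule sc_commute)
          moreover have "C * ((sc u * sc T + sc v) * A - (sc u + sc v * sc t) * B)
              = sc u * (C * (sc T * A - B)) + sc v * (C * (A - sc t * B))"
            by (simp add: distrib_left distrib_right right_diff_distrib mult.assoc sc_left_commute[of C])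
          ultimately show ?thesis by (simp only: sc_add sc_mult mult.assoc)
        qed
        thus ?thesis unfolding qpow_B[OF comm] C_def .
      qed
      also have "?u * T + ?v = ?v * tnum (Suc m)"
        by (simp add: field_simps)
      also have "?u + ?v * T ^ Suc k = ?v * tnum (Suc m)"
        by (simp add: field_simps Suc)
      also have "(A - B) ^ k * (sc (?v * tnum (Suc m)) * A - sc (?v * tnum (Suc m)) * B) = sc (?v * tnum (Suc m)) * (A - B) ^ m"
        unfolding Suc power_Suc2 by (simp add: right_diff_distrib sc_left_commute[of "(A - B) ^ k"])
      finally show ?thesis by simp
    qed
  qed simp
qed

text \<open>The conjugate partition, indexed by all integers because parts may be negative.\<close>

definition column :: "int multiset \<Rightarrow> int \<Rightarrow> nat" where
  "column \<mu> j = size (filter_mset (\<lambda>b. j \<le> b) \<mu>)"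

lemma column_empty [simp]: "column {#} j = 0"
  and column_union [simp]: "column (\<mu> + \<nu>) j = column \<mu> j + column \<nu> j"
  and column_add_mset [simp]: "column (add_mset a \<mu>) j = (if j \<le> a then 1 else 0) + column \<mu> j"
  by (simp_all add: column_def)

lemma column_replicate [simp]: "column (replicate_mset m a) j = (if j \<le> a then m else 0)"
  by (induction m) auto

lemma column_count: "column \<mu> j = column \<mu> (j + 1) + count \<mu> j"
  by (induction \<mu>) auto

lemma column_le_size: "column \<mu> j \<le> size \<mu>"
  by (simp add: column_def size_filter_mset_lesseq)

lemma column_eq_size: "(\<And>b. b \<in># \<mu> \<Longrightarrow> j \<le> b) \<Longrightarrow> column \<mu> j = size \<mu>"
  unfolding column_def by (metis filter_mset_True filter_mset_cong)

lemma column_eq_0: "(\<And>b. b \<in># \<mu> \<Longrightarrow> b < j) \<Longrightarrow> column \<mu> j = 0"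
  by (induction \<mu>) force+

lemma column_filter: "i \<ge> j \<Longrightarrow> column (filter_mset (\<lambda>b. j \<le> b) \<mu>) i = column \<mu> i"
  by (induction \<mu>) auto

text \<open>The states of a column-by-column transfer: the columns from j on of a horizontal strip
  between \<kappa> and \<mu>, where \<theta> (0 or 1) tells whether a box is removed in column j.
  The size of \<kappa> is left open until the lowest column is reached.\<close>

definition strips :: "int multiset \<Rightarrow> nat \<Rightarrow> int \<Rightarrow> int multiset set" where
  "strips \<mu> \<theta> j = {\<kappa>. (\<forall>b\<in>#\<kappa>. j \<le> b) \<and> (\<forall>i\<ge>j. column \<kappa> i \<le> column \<mu> i \<and> column \<mu> i \<le> Suc (column \<kappa> i))
     \<and> column \<mu> j = column \<kappa> j + \<theta>}"

definition branch_weight_upto :: "int multiset \<Rightarrow> int \<Rightarrow> int \<Rightarrow> int multiset \<Rightarrow> rat fls" where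
  "branch_weight_upto \<mu> h j \<kappa> = (\<Prod>i\<in>{j..<h}. branch (column \<mu> (i + 1) - column \<kappa> (i + 1)) (column \<mu> i - column \<kappa> i) (count \<mu> i))"

lemma split_at_min:
  fixes j :: int
  assumes "\<forall>b\<in>#\<kappa>. j \<le> b"
  shows "\<kappa> = filter_mset (\<lambda>b. j + 1 \<le> b) \<kappa> + replicate_mset (count \<kappa> j) j"
proof (rule multiset_eqI)
  fix x
  have "count \<kappa> x = 0" if "x < j"
  proof -
    have "x \<notin># \<kappa>" using assms that by fastforce
    thus ?thesis by (simp add: not_in_iff)
  qed
  thus "count \<kappa> x = count (filter_mset (\<lambda>b. j + 1 \<le> b) \<kappa> + replicate_mset (count \<kappa> j) j) x"
    by (cases x j rule: linorder_cases) auto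
qed

lemma strips_top:
  assumes "\<And>b. b \<in># \<mu> \<Longrightarrow> b < h"
  shows "strips \<mu> \<theta> h = (if \<theta> = 0 then {{#}} else {})"
proof -
  have 0: "column \<mu> i = 0" if "i \<ge> h" for i using assms that by (intro column_eq_0) force
  have "\<kappa> = {#}" if "\<kappa> \<in> strips \<mu> \<theta> h" for \<kappa>
    using that column_eq_size[of \<kappa> h] 0[of h] by (auto simp: strips_def)
  thus ?thesis using 0 by (auto simp: strips_def)
qed

text \<open>Passing from column j + 1 to column j leaves no freedom beyond the two states:
  \<open>column_count\<close> forces the multiplicity of j in the new multiset to be count \<mu> j +
  \<theta>' - \<theta>. The side condition keeps this difference nonnegative.\<close>

lemma strips_step:
  assumes "\<theta> \<le> 1"
  shows "strips \<mu> \<theta> j = (\<Union>\<theta>'\<in>{\<theta>'\<in>{0, 1}. \<theta> \<le> count \<mu> j + \<theta>'}.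
     (\<lambda>\<kappa>. \<kappa> + replicate_mset (count \<mu> j + \<theta>' - \<theta>) j) ` strips \<mu> \<theta>' (j + 1))" (is "?L = ?R")
proof (intro equalityI subsetI)
  fix \<kappa>' assume "\<kappa>' \<in> ?L"
  hence \<kappa>': "\<forall>b\<in>#\<kappa>'. j \<le> b" "\<And>i. i \<ge> j \<Longrightarrow> column \<kappa>' i \<le> column \<mu> i \<and> column \<mu> i \<le> Suc (column \<kappa>' i)"
    "column \<mu> j = column \<kappa>' j + \<theta>" by (auto simp: strips_def)
  define \<kappa> where "\<kappa> = filter_mset (\<lambda>b. j + 1 \<le> b) \<kappa>'"
  have column\<kappa>: "column \<kappa> i = column \<kappa>' i" if "i \<ge> j + 1" for i using that by (simp add: \<kappa>_def column_filter)
  define \<theta>' where "\<theta>' = column \<mu> (j + 1) - column \<kappa> (j + 1)"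
  have \<theta>': "column \<mu> (j + 1) = column \<kappa> (j + 1) + \<theta>'" "\<theta>' \<in> {0, 1}"
    using \<kappa>'(2)[of "j + 1"] by (auto simp: \<theta>'_def column\<kappa>)
  have "count \<kappa>' j + \<theta> = count \<mu> j + \<theta>'"
    using \<kappa>'(3) column_count[of \<mu> j] column_count[of \<kappa>' j] \<theta>' by (simp add: column\<kappa>)
  hence "count \<kappa>' j = count \<mu> j + \<theta>' - \<theta>" "\<theta> \<le> count \<mu> j + \<theta>'" by linarith+
  moreover have "\<kappa>' = \<kappa> + replicate_mset (count \<kappa>' j) j"
    unfolding \<kappa>_def using \<kappa>'(1) by (rule split_at_min)
  moreover have "\<kappa> \<in> strips \<mu> \<theta>' (j + 1)"
    using \<theta>' \<kappa>'(2) by (auto simp: strips_def column\<kappa>) (auto simp: \<kappa>_def)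
  ultimately show "\<kappa>' \<in> ?R" using \<theta>' by auto
next
  fix \<kappa>' assume "\<kappa>' \<in> ?R"
  then obtain \<theta>' \<kappa> where \<theta>': "\<theta>' \<le> 1" "\<theta> \<le> count \<mu> j + \<theta>'" and \<kappa>: "\<kappa> \<in> strips \<mu> \<theta>' (j + 1)"
    and \<kappa>': "\<kappa>' = \<kappa> + replicate_mset (count \<mu> j + \<theta>' - \<theta>) j" by auto
  have ge: "\<forall>b\<in>#\<kappa>. j + 1 \<le> b" using \<kappa> by (auto simp: strips_def)
  hence "count \<kappa> j = 0" by (auto simp: not_in_iff[symmetric])
  hence "column \<kappa> j = column \<kappa> (j + 1)" using column_count[of \<kappa> j] by simp
  hence clj: "column \<mu> j = column \<kappa>' j + \<theta>"
    using \<kappa> \<theta>' column_count[of \<mu> j] by (simp add: strips_def \<kappa>')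
  moreover have "column \<kappa>' i \<le> column \<mu> i \<and> column \<mu> i \<le> Suc (column \<kappa>' i)" if "i \<ge> j" for i
    using that \<kappa> clj assms by (cases "i = j") (auto simp: strips_def \<kappa>')
  moreover have "\<forall>b\<in>#\<kappa>'. j \<le> b" using ge by (auto simp: \<kappa>' split: if_splits)
  ultimately show "\<kappa>' \<in> ?L" by (auto simp: strips_def)
qed

lemma strips_below: "\<kappa> \<in> strips \<mu> \<theta> (j + 1) \<Longrightarrow> b \<in># \<kappa> \<Longrightarrow> j < b"
  by (auto simp: strips_def)

lemma finite_strips:
  assumes "\<And>b. b \<in># \<mu> \<Longrightarrow> b < h"
  shows "j \<le> h \<Longrightarrow> \<theta> \<le> 1 \<Longrightarrow> finite (strips \<mu> \<theta> j)"
proof (induction j arbitrary: \<theta> rule: int_le_induct)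
  case base
  show ?case using assms by (simp add: strips_top)
next
  case (step i)
  thus ?case using strips_step[of \<theta> \<mu> "i - 1"] by auto
qed

lemma sum_strips_step:
  assumes "\<And>b. b \<in># \<mu> \<Longrightarrow> b < h" "j < h" "\<theta> \<le> 1"
  shows "(\<Sum>\<kappa>\<in>strips \<mu> \<theta> j. G \<kappa>) = (\<Sum>\<theta>'\<in>{\<theta>'\<in>{0, 1}. \<theta> \<le> count \<mu> j + \<theta>'}.
    \<Sum>\<kappa>\<in>strips \<mu> \<theta>' (j + 1). G (\<kappa> + replicate_mset (count \<mu> j + \<theta>' - \<theta>) j))"
proof -
  have fin: "finite (strips \<mu> \<theta>' (j + 1))" if "\<theta>' \<in> {0, 1}" for \<theta>'
    using that assms by (intro finite_strips) auto
  have "(\<Sum>\<kappa>\<in>strips \<mu> \<theta> j. G \<kappa>) = (\<Sum>\<theta>'\<in>{\<theta>'\<in>{0, 1}. \<theta> \<le> count \<mu> j + \<theta>'}.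
     \<Sum>\<kappa>\<in>(\<lambda>\<kappa>. \<kappa> + replicate_mset (count \<mu> j + \<theta>' - \<theta>) j) ` strips \<mu> \<theta>' (j + 1). G \<kappa>)"
    unfolding strips_step[OF assms(3)]
  proof (rule sum.UNION_disjoint)
    have col: "\<theta>' = column \<mu> (j + 1) - column \<kappa> (j + 1)"
      if "\<kappa> \<in> (\<lambda>\<kappa>. \<kappa> + replicate_mset k j) ` strips \<mu> \<theta>' (j + 1)" for \<kappa> \<theta>' k
      using that by (auto simp: strips_def)
    show "\<forall>i\<in>{\<theta>' \<in> {0, 1}. \<theta> \<le> count \<mu> j + \<theta>'}. \<forall>i'\<in>{\<theta>' \<in> {0, 1}. \<theta> \<le> count \<mu> j + \<theta>'}. i \<noteq> i' \<longrightarrow>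
      (\<lambda>\<kappa>. \<kappa> + replicate_mset (count \<mu> j + i - \<theta>) j) ` strips \<mu> i (j + 1) \<inter>
      (\<lambda>\<kappa>. \<kappa> + replicate_mset (count \<mu> j + i' - \<theta>) j) ` strips \<mu> i' (j + 1) = {}"
    proof (intro ballI impI equals0I, elim IntE)
      fix i i' \<kappa> assume "i \<noteq> i'"
        and "\<kappa> \<in> (\<lambda>\<kappa>. \<kappa> + replicate_mset (count \<mu> j + i - \<theta>) j) ` strips \<mu> i (j + 1)"
        and "\<kappa> \<in> (\<lambda>\<kappa>. \<kappa> + replicate_mset (count \<mu> j + i' - \<theta>) j) ` strips \<mu> i' (j + 1)"
      thus False using col[of \<kappa> _ i] col[of \<kappa> _ i'] by metis
    qed
  qed (use fin in auto)
  thus ?thesis by (simp add: sum.reindex inj_on_def)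
qed

lemma branch_weight_upto_step:
  assumes "\<kappa> \<in> strips \<mu> \<theta>' (j + 1)" "\<theta> \<le> count \<mu> j + \<theta>'" "j < h"
  shows "branch_weight_upto \<mu> h j (\<kappa> + replicate_mset (count \<mu> j + \<theta>' - \<theta>) j) = branch \<theta>' \<theta> (count \<mu> j) * branch_weight_upto \<mu> h (j + 1) \<kappa>"
proof -
  have "{j..<h} = insert j {j + 1..<h}" using assms by auto
  moreover have "count \<kappa> j = 0" using assms(1) by (auto simp: strips_def not_in_iff[symmetric])
  hence "column \<kappa> j = column \<kappa> (j + 1)" using column_count[of \<kappa> j] by simp
  moreover have "column \<mu> (j + 1) = column \<kappa> (j + 1) + \<theta>'" using assms by (simp add: strips_def)
  moreover have "column \<mu> j = column \<mu> (j + 1) + count \<mu> j" by (rule column_count)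
  ultimately show ?thesis unfolding branch_weight_upto_def using assms(2) by (auto intro!: prod.cong)
qed

definition upper :: "int multiset \<Rightarrow> int \<Rightarrow> int multiset" where
  "upper \<mu> j = filter_mset (\<lambda>b. j \<le> b) \<mu>"

text \<open>The part of the branching expansion that is visible from column j upward, in state
  \<theta>.\<close>

definition branch_sum :: "int multiset \<Rightarrow> int \<Rightarrow> rat fls \<Rightarrow> nat \<Rightarrow> int \<Rightarrow> shuf" where
  "branch_sum \<mu> h z \<theta> j = (\<Sum>\<kappa>\<in>strips \<mu> \<theta> j.
     sc (branch_weight_upto \<mu> h j \<kappa> * z powi (sum_mset (upper \<mu> j) - sum_mset \<kappa>)) * ordered_prod \<kappa>)"

context
  fixes \<mu> :: "int multiset" and h :: int and z :: "rat fls"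
  assumes h: "\<And>b. b \<in># \<mu> \<Longrightarrow> b < h" and z: "z \<noteq> 0"
begin

lemma upper_step: "upper \<mu> j = upper \<mu> (j + 1) + replicate_mset (count \<mu> j) j"
proof -
  have "upper \<mu> j = filter_mset (\<lambda>b. j + 1 \<le> b) (upper \<mu> j) + replicate_mset (count (upper \<mu> j) j) j"
    by (rule split_at_min) (simp add: upper_def)
  also have "filter_mset (\<lambda>b. j + 1 \<le> b) (upper \<mu> j) = upper \<mu> (j + 1)"
    unfolding upper_def filter_filter_mset by (rule filter_mset_cong) auto
  finally show ?thesis by (simp add: upper_def)
qed

lemma ordered_prod_upper: "ordered_prod (upper \<mu> j) = ordered_prod (upper \<mu> (j + 1)) * ee j ^ count \<mu> j"
  by (subst upper_step, rule ordered_prod_replicate_min) (auto simp: upper_def)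

lemma branch_sum_step:
  assumes "j < h" "\<theta> \<le> 1"
  shows "branch_sum \<mu> h z \<theta> j = (\<Sum>\<theta>'\<in>{\<theta>'\<in>{0, 1}. \<theta> \<le> count \<mu> j + \<theta>'}.
    sc (branch \<theta>' \<theta> (count \<mu> j) * z powi (j * (int \<theta> - int \<theta>')))
      * (branch_sum \<mu> h z \<theta>' (j + 1) * ee j ^ (count \<mu> j + \<theta>' - \<theta>)))"
  unfolding branch_sum_def
proof (subst sum_strips_step[of \<mu> h j \<theta>], goal_cases)
  case 4
  show ?case
  proof (rule sum.cong[OF refl], goal_cases)
  case (1 \<theta>')
  hence \<theta>': "\<theta>' \<le> 1" "\<theta> \<le> count \<mu> j + \<theta>'" by auto
  show ?case unfolding sum_distrib_left sum_distrib_right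
  proof (rule sum.cong[OF refl], goal_cases)
    case (1 \<kappa>)
    let ?k = "count \<mu> j + \<theta>' - \<theta>"
    have e: "sum_mset (upper \<mu> j) - sum_mset (\<kappa> + replicate_mset ?k j)
        = j * (int \<theta> - int \<theta>') + (sum_mset (upper \<mu> (j + 1)) - sum_mset \<kappa>)"
      using \<theta>'(2) by (subst upper_step) (simp add: sum_mset_replicate_mset of_nat_diff algebra_simps)
    have pw: "z powi (sum_mset (upper \<mu> j) - sum_mset (\<kappa> + replicate_mset ?k j))
        = z powi (j * (int \<theta> - int \<theta>')) * z powi (sum_mset (upper \<mu> (j + 1)) - sum_mset \<kappa>)"
      unfolding e by (rule power_int_add) (use z in simp)
    have 2: "ordered_prod (\<kappa> + replicate_mset ?k j) = ordered_prod \<kappa> * ee j ^ ?k"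
      by (rule ordered_prod_replicate_min) (use strips_below[OF 1(1)] in force)
    have merge: "sc a * (sc b * R * e) = sc (a * b) * (R * e)" for a b R e
      by (simp add: sc_mult mult.assoc)
    show ?case unfolding pw 2 branch_weight_upto_step[OF 1 \<theta>'(2) assms(1)] merge
      by (simp add: mult_ac)
  qed
  qed
qed (use h assms in auto)

text \<open>Downward induction on j, adding the parts equal to j on the right. The Leibniz rule then
  also needs the twist of the earlier product by 1 - T z/y, so a second invariant expresses that
  twist through both states. Its correction term carries \<open>ee (j - 1)\<close>, the generator
  that is added next.\<close>

lemma branch_invariants:
  assumes "j \<le> h"
  shows "skew_deriv z (ordered_prod (upper \<mu> j)) = twist z (\<lambda>y. 1 - z / y) (branch_sum \<mu> h z 1 j) \<and>
    twist z (\<lambda>y. 1 - T * z / y) (ordered_prod (upper \<mu> j)) = twist z (\<lambda>y. 1 - z / y) (branch_sum \<mu> h z 0 j)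
      + sc ((1 - T) * z powi (- j)) * (twist z (\<lambda>y. 1 - z / y) (branch_sum \<mu> h z 1 j) * (sc z * twist z (\<lambda>_. 1) (ee (j - 1))))"
  using assms
proof (induction j rule: int_le_induct)
  case base
  have "upper \<mu> h = {#}" using h by (fastforce simp: upper_def)
  moreover have "branch_sum \<mu> h z 1 h = 0" "branch_sum \<mu> h z 0 h = 1"
    using calculation h by (simp_all add: branch_sum_def strips_top branch_weight_upto_def)
  ultimately show ?case using twist_sc[of z _ 0] by simp
next
  case (step i)
  define j where "j = i - 1"
  have j: "i = j + 1" "j < h" using step.hyps by (auto simp: j_def)
  let ?m = "count \<mu> j"
  define L where "L = ordered_prod (upper \<mu> (j + 1))"
  define A where "A = twist z (\<lambda>_. 1) (ee j)"
  define B where "B = sc z * twist z (\<lambda>_. 1) (ee (j - 1))"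
  define X where "X \<theta> = twist z (\<lambda>y. 1 - z / y) (branch_sum \<mu> h z \<theta> (j + 1))" for \<theta>
  note comm = skew_deriv_power(1)[OF z, of j, folded A_def B_def]
  have tw1: "twist z (\<lambda>y. 1 - z / y) (ee j) = A - B"
    using twist_ee[of z 1 z j] by (simp add: A_def B_def)
  have tw2: "twist z (\<lambda>y. T - z / y) (ee j) = sc T * A - B"
    unfolding A_def B_def by (rule twist_ee)
  have tw3: "twist z (\<lambda>y. 1 - T * z / y) (ee j) = A - sc T * B"
    using twist_ee[of z 1 "T * z" j] by (simp add: A_def B_def sc_mult mult.assoc)
  define c where "c = (1 - T) * z powi (- j)"
  have zz: "z powi (- (j + 1)) * z = z powi (- j)"
    using z power_int_add[of z "- (j + 1)" 1] by simp
  have IH1: "skew_deriv z L = X 1" using step.IH unfolding j(1) L_def X_def by blast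
  \<comment> \<open>The correction term of the previous step was written with the generator one
    below j + 1, which is \<open>ee j\<close>; the factor z turns the power for j + 1 into the one
    for j.\<close>
  have IH2: "twist z (\<lambda>y. 1 - T * z / y) L = X 0 + sc c * (X 1 * A)"
  proof -
    have "sc ((1 - T) * z powi (- (j + 1))) * (X 1 * (sc z * twist z (\<lambda>_. 1) (ee (j + 1 - 1)))) = sc c * (X 1 * A)"
      unfolding c_def A_def zz[symmetric]
      by (simp add: sc_mult mult.assoc sc_left_commute[of "X (Suc 0)"])
    thus ?thesis using step.IH unfolding j(1) L_def X_def by simp
  qed
  define d where "d = z powi j * tnum ?m"
  have branch_1: "twist z (\<lambda>y. 1 - z / y) (branch_sum \<mu> h z 1 j)
      = sc (d) * (X 0 * (A - B) ^ (?m - 1)) + X 1 * (A - B) ^ ?m"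
  proof (cases "?m = 0")
    case True
    have *: "{\<theta>'. (\<theta>' = 0 \<or> \<theta>' = Suc 0) \<and> Suc 0 \<le> \<theta>'} = {Suc 0}" by auto
    have d: "d = 0" using True by (simp add: d_def)
    show ?thesis using j(2) True d unfolding branch_sum_step[OF j(2) order_refl]
      by (simp add: * twist_mult X_def branch_def)
  next
    case False
    hence *: "{\<theta>'\<in>{0, 1}. 1 \<le> ?m + \<theta>'} = {0, 1}" by auto
    show ?thesis using j(2) unfolding branch_sum_step[OF j(2) order_refl] *
      by (simp add: twist_mult twist_add twist_power tw1 X_def branch_def d_def mult.commute)
  qed
  have branch_0: "twist z (\<lambda>y. 1 - z / y) (branch_sum \<mu> h z 0 j) = X 0 * (A - B) ^ ?m + sc c * (X 1 * (A - B) ^ Suc ?m)"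
  proof -
    have *: "{\<theta>'\<in>{0, 1}. (0::nat) \<le> ?m + \<theta>'} = {0, 1}" by auto
    show ?thesis using j(2) unfolding branch_sum_step[OF j(2) zero_le_one] *
      by (simp add: twist_mult twist_add twist_power tw1 X_def branch_def c_def mult.commute)
  qed
  \<comment> \<open>The scalars were normalized so that this product is the coefficient in
    \<open>qpow_tA\<close> and \<open>qpow_tB\<close>.\<close>
  have c: "c * (d) = 1 - T ^ ?m"
    using z by (simp add: c_def d_def power_int_minus field_simps)
  have "skew_deriv z (ordered_prod (upper \<mu> j)) = X 1 * (sc T * A - B) ^ ?m
      + (X 0 + sc c * (X 1 * A)) * (sc (d) * (A - B) ^ (?m - 1))"
    unfolding ordered_prod_upper[of j] L_def[symmetric] skew_deriv_mult IH1 IH2 twist_power tw2 skew_deriv_power(2)[OF z] A_def B_def d_def by simp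
  also have "\<dots> = X 1 * ((sc T * A - B) ^ ?m + sc (1 - T ^ ?m) * (A * (A - B) ^ (?m - 1)))
      + sc (d) * (X 0 * (A - B) ^ (?m - 1))"
    unfolding c[symmetric] sc_mult[of c]
    by (simp add: distrib_left distrib_right mult.assoc sc_left_commute[of "X 0"] sc_left_commute[of "X (Suc 0)"]
        sc_left_commute[of A])
  also have "\<dots> = twist z (\<lambda>y. 1 - z / y) (branch_sum \<mu> h z 1 j)"
    unfolding qpow_tA[OF comm] branch_1 by (simp add: add.commute)
  finally have 1: "skew_deriv z (ordered_prod (upper \<mu> j)) = twist z (\<lambda>y. 1 - z / y) (branch_sum \<mu> h z 1 j)" .
  have "twist z (\<lambda>y. 1 - T * z / y) (ordered_prod (upper \<mu> j)) = (X 0 + sc c * (X 1 * A)) * (A - sc T * B) ^ ?m"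
    unfolding ordered_prod_upper[of j] L_def[symmetric] twist_mult IH2 twist_power tw3 by simp
  also have "\<dots> = X 0 * (A - sc T * B) ^ ?m + sc c * (X 1 * (A * (A - sc T * B) ^ ?m))"
    by (simp add: distrib_right mult.assoc)
  also have "\<dots> = X 0 * ((A - B) ^ ?m + sc (c * (d)) * ((A - B) ^ (?m - 1) * B))
      + sc c * (X 1 * ((A - B) ^ ?m * (A - B) + (A - B) ^ ?m * B))"
    unfolding qpow_commute[OF comm] unfolding qpow_tB[OF comm] c by (simp add: algebra_simps)
  also have "\<dots> = twist z (\<lambda>y. 1 - z / y) (branch_sum \<mu> h z 0 j) + sc c * (twist z (\<lambda>y. 1 - z / y) (branch_sum \<mu> h z 1 j) * B)"
    unfolding branch_1 branch_0 sc_mult[of c] power_Suc2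
    by (simp add: distrib_left distrib_right mult.assoc sc_left_commute[of "X 0"])
  finally show ?case using 1 unfolding j_def[symmetric] c_def B_def by blast
qed

end

theorem branching:
  assumes h: "\<And>b. b \<in># \<mu> \<Longrightarrow> b < h" and l: "\<And>b. b \<in># \<mu> \<Longrightarrow> l \<le> b" and lh: "l \<le> h"
    and z: "z \<noteq> 0" "z \<notin> X" and X: "finite X" "0 \<notin> X"
  shows "val (ordered_prod \<mu>) (insert z X)
    = (\<Sum>\<kappa>\<in>strips \<mu> 1 l. branch_weight_upto \<mu> h l \<kappa> * z powi (sum_mset \<mu> - sum_mset \<kappa>) * val (ordered_prod \<kappa>) X)"
proof -
  have "filter_mset (\<lambda>b. l \<le> b) \<mu> = filter_mset (\<lambda>_. True) \<mu>"
    by (rule filter_mset_cong) (use l in auto)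
  hence up: "upper \<mu> l = \<mu>" by (simp add: upper_def)
  have "val (skew_deriv z (ordered_prod \<mu>)) X = val (twist z (\<lambda>y. 1 - z / y) (branch_sum \<mu> h z 1 l)) X"
    using branch_invariants[of \<mu> h z l] h z lh by (simp add: up)
  hence "(\<Prod>y\<in>X. 1 - z / y) * val (ordered_prod \<mu>) (insert z X) = (\<Prod>y\<in>X. 1 - z / y) * val (branch_sum \<mu> h z 1 l) X"
    using z by (simp add: val_skew_deriv val_twist)
  \<comment> \<open>Since z is not among the points, the clearing factor can be cancelled.\<close>
  moreover have "(\<Prod>y\<in>X. 1 - z / y) \<noteq> 0"
    using X z by (auto simp: field_simps)
  ultimately have "val (ordered_prod \<mu>) (insert z X) = val (branch_sum \<mu> h z 1 l) X" by simp
  thus ?thesis by (simp add: branch_sum_def val_sum up)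
qed

section \<open>Skew coefficients and the Pieri rule\<close>

text \<open>Both sides are the T-multinomial coefficient of a with parts a - m, m - c and c.\<close>

lemma tb_trinomial': "c \<le> m \<Longrightarrow> m \<le> a \<Longrightarrow> tb a m * tb m c = tb a (a - m + c) * tb (a - m + c) c"
proof -
  assume "c \<le> m" "m \<le> a"
  moreover from this have "a - m + c \<le> a" "a - (a - m + c) = m - c" by linarith+
  ultimately show ?thesis by (simp add: tb_def tbinom_def)
qed

lemma prod_support:
  assumes "finite W" "\<And>j. j \<notin> W \<Longrightarrow> F j = 1"
  shows "(\<Prod>j | F j \<noteq> 1. F j) = (\<Prod>j\<in>W. F j)"
  using assms by (intro prod.mono_neutral_left) blast+

text \<open>Products over all integers: only finitely many factors differ from \<open>1\<close>, and these are the ones that are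
  multiplied.\<close>

definition sk_mset :: "int multiset \<Rightarrow> int multiset \<Rightarrow> rat fls" where
  "sk_mset \<mu> \<nu> = (let F = \<lambda>j. T ^ ((column \<mu> j - column \<nu> j) choose 2) * tb (column \<mu> j - column \<nu> (j + 1)) (count \<nu> j)
     in \<Prod>j | F j \<noteq> 1. F j)"

definition branch_weight :: "int multiset \<Rightarrow> int multiset \<Rightarrow> rat fls" where
  "branch_weight \<mu> \<kappa> = (let F = \<lambda>j. branch (column \<mu> (j + 1) - column \<kappa> (j + 1)) (column \<mu> j - column \<kappa> j) (count \<mu> j)
     in \<Prod>j | F j \<noteq> 1. F j)"

text \<open>The multisets that interlace with \<mu>: a horizontal strip is removed and exactly one
  part is lost.\<close>

definition istrips :: "int multiset \<Rightarrow> int multiset set" where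
  "istrips \<mu> = {\<kappa>. size \<mu> = size \<kappa> + 1 \<and> (\<forall>i. column \<kappa> i \<le> column \<mu> i \<and> column \<mu> i \<le> Suc (column \<kappa> i))}"

text \<open>From h on all columns are empty; below l they are full and differ by exactly one, and 1
  choose 2 is 0. The product is therefore finite and insensitive to a common shift.\<close>

lemma sk_mset_window:
  assumes "size \<mu> = size \<nu> + 1"
    and "\<And>b. b \<in># \<mu> \<Longrightarrow> l \<le> b \<and> b < h" "\<And>b. b \<in># \<nu> \<Longrightarrow> l \<le> b \<and> b < h"
  shows "sk_mset \<mu> \<nu> = (\<Prod>j\<in>{l..<h}. T ^ ((column \<mu> j - column \<nu> j) choose 2) * tb (column \<mu> j - column \<nu> (j + 1)) (count \<nu> j))"
proof -
  let ?F = "\<lambda>j. T ^ ((column \<mu> j - column \<nu> j) choose 2) * tb (column \<mu> j - column \<nu> (j + 1)) (count \<nu> j)"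
  have "?F j = 1" if "j \<notin> {l..<h}" for j
  proof (cases "j \<ge> h")
    case True
    hence "column \<mu> j = 0" "column \<nu> j = 0" using assms by (intro column_eq_0; force)+
    moreover have "count \<nu> j = 0" using assms(3)[of j] True by (auto simp: not_in_iff[symmetric])
    ultimately show ?thesis by (simp add: numeral_2_eq_2)
  next
    case False
    hence "j < l" using that by auto
    hence "column \<mu> j = size \<mu>" "column \<nu> j = size \<nu>" using assms by (intro column_eq_size; force)+
    moreover have "count \<nu> j = 0" using assms(3)[of j] \<open>j < l\<close> by (auto simp: not_in_iff[symmetric])
    ultimately show ?thesis by (simp add: assms(1) numeral_2_eq_2)
  qed
  thus ?thesis unfolding sk_mset_def Let_def by (intro prod_support) simp_all
qed

lemma branch_weight_window:
  assumes "size \<mu> = size \<kappa> + 1"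
    and "\<And>b. b \<in># \<mu> \<Longrightarrow> l \<le> b \<and> b < h" "\<And>b. b \<in># \<kappa> \<Longrightarrow> l \<le> b \<and> b < h"
  shows "branch_weight \<mu> \<kappa> = branch_weight_upto \<mu> h l \<kappa>"
proof -
  let ?F = "\<lambda>j. branch (column \<mu> (j + 1) - column \<kappa> (j + 1)) (column \<mu> j - column \<kappa> j) (count \<mu> j)"
  have "?F j = 1" if "j \<notin> {l..<h}" for j
  proof (cases "j \<ge> h")
    case True
    hence "column \<mu> j = 0" "column \<mu> (j + 1) = 0" using assms by (intro column_eq_0; force)+
    thus ?thesis by (simp add: branch_def)
  next
    case False
    hence "j < l" using that by auto
    hence "column \<mu> j = size \<mu>" "column \<kappa> j = size \<kappa>" "column \<mu> (j + 1) = size \<mu>" "column \<kappa> (j + 1) = size \<kappa>"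
      using assms by (intro column_eq_size; force)+
    thus ?thesis by (simp add: assms(1) branch_def)
  qed
  thus ?thesis unfolding branch_weight_def branch_weight_upto_def Let_def by (intro prod_support) simp_all
qed

lemma mset_bounds: obtains l h :: int where "\<And>b. b \<in># \<mu> \<Longrightarrow> l \<le> b \<and> b < h" "l \<le> h"
proof -
  have "\<exists>l h. (\<forall>b\<in>#\<mu>. l \<le> b \<and> b < h) \<and> l \<le> (h::int)"
  proof (induction \<mu>)
    case (add a \<mu>)
    then obtain l h where "\<forall>b\<in>#\<mu>. l \<le> b \<and> b < h" "l \<le> h" by blast
    hence "(\<forall>b\<in>#add_mset a \<mu>. min l a \<le> b \<and> b < max h (a + 1)) \<and> min l a \<le> max h (a + 1)"
      by force
    thus ?case by blast
  qed auto
  thus ?thesis using that by blast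
qed

lemma istrips_bounds:
  assumes "\<kappa> \<in> istrips \<mu>" "\<And>b. b \<in># \<mu> \<Longrightarrow> l \<le> b \<and> b < h" "b \<in># \<kappa>"
  shows "l \<le> b \<and> b < h"
proof
  have "column \<mu> l = size \<mu>" using assms(2) by (intro column_eq_size) auto
  hence "column \<kappa> l = size \<kappa>"
    using assms(1) column_le_size[of \<kappa> l] by (auto simp: istrips_def) (metis Suc_eq_plus1 Suc_le_mono le_antisym)
  hence "filter_mset (\<lambda>b. l \<le> b) \<kappa> = \<kappa>"
    unfolding column_def by (metis multiset_filter_subset nat_less_le size_filter_mset_lesseq mset_subset_size subset_mset.le_less)
  thus "l \<le> b" using assms(3) by (metis mem_Collect_eq set_mset_filter)
  have "column \<mu> h = 0" using assms(2) by (intro column_eq_0) auto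
  hence "column \<kappa> h = 0" using assms(1) by (auto simp: istrips_def) (metis le_zero_eq)
  thus "b < h" using assms(3) by (force simp: column_def)
qed

text \<open>Below all parts a column counts every part, so state 1 at the bottom says exactly that
  one part has been lost.\<close>

lemma istrips_eq_strips:
  assumes "\<And>b. b \<in># \<mu> \<Longrightarrow> l \<le> b"
  shows "istrips \<mu> = strips \<mu> 1 l"
proof (intro equalityI subsetI)
  have clm: "column \<mu> i = size \<mu>" if "i \<le> l" for i
    using assms that by (intro column_eq_size) force
  fix \<kappa>
  show "\<kappa> \<in> strips \<mu> 1 l" if "\<kappa> \<in> istrips \<mu>"
  proof -
    obtain h where "\<And>b. b \<in># \<mu> \<Longrightarrow> b < h" using mset_bounds[of \<mu>] by metis
    hence "\<forall>b\<in>#\<kappa>. l \<le> b" using istrips_bounds[OF that, of l h] assms by blast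
    thus ?thesis using that clm[of l] column_eq_size[of \<kappa> l] by (auto simp: istrips_def strips_def)
  qed
  show "\<kappa> \<in> istrips \<mu>" if "\<kappa> \<in> strips \<mu> 1 l"
  proof -
    have "column \<kappa> i = size \<kappa>" if "i \<le> l" for i
      using \<open>\<kappa> \<in> strips \<mu> 1 l\<close> that by (intro column_eq_size) (force simp: strips_def)
    thus ?thesis using that clm unfolding istrips_def strips_def
      by (smt (verit) One_nat_def Suc_eq_plus1 le_add1 mem_Collect_eq order_refl plus_1_eq_Suc)
  qed
qed

lemma finite_istrips [simp]: "finite (istrips \<mu>)"
proof -
  obtain l h where "\<And>b. b \<in># \<mu> \<Longrightarrow> l \<le> b \<and> b < h" "l \<le> h" using mset_bounds[of \<mu>] by metis
  thus ?thesis using finite_strips[of \<mu> h l 1] istrips_eq_strips[of \<mu> l] by auto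
qed

theorem branching_rule:
  assumes z: "z \<noteq> 0" "z \<notin> X" and X: "finite X" "0 \<notin> X"
  shows "val (ordered_prod \<mu>) (insert z X)
    = (\<Sum>\<kappa>\<in>istrips \<mu>. branch_weight \<mu> \<kappa> * z powi (sum_mset \<mu> - sum_mset \<kappa>) * val (ordered_prod \<kappa>) X)"
proof -
  obtain l h where lh: "\<And>b. b \<in># \<mu> \<Longrightarrow> l \<le> b \<and> b < h" "l \<le> h" using mset_bounds[of \<mu>] by metis
  have "branch_weight \<mu> \<kappa> = branch_weight_upto \<mu> h l \<kappa>" if "\<kappa> \<in> istrips \<mu>" for \<kappa>
    using that lh istrips_bounds[OF that lh(1)] by (intro branch_weight_window) (auto simp: istrips_def)
  thus ?thesis using branching[of \<mu> h l z X] lh assms istrips_eq_strips[of \<mu> l] by auto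
qed

text \<open>A sub-multiset is an independent choice of multiplicities, so this is
  distributivity.\<close>

lemma sum_submultisets_prod:
  fixes F :: "'a \<Rightarrow> nat \<Rightarrow> 'b::comm_semiring_1"
  assumes fin: "finite J" and sub: "set_mset \<kappa> \<subseteq> J"
  shows "(\<Sum>R | R \<subseteq># \<kappa>. \<Prod>j\<in>J. F j (count R j)) = (\<Prod>j\<in>J. \<Sum>c\<le>count \<kappa> j. F j c)"
proof -
  define ms where "ms f = (\<Sum>j\<in>J. replicate_mset (f j) j)" for f :: "'a \<Rightarrow> nat"
  have count: "count (ms f) j = (if j \<in> J then f j else 0)" for f j
    unfolding ms_def count_sum using fin by (simp add: sum.delta' if_distrib cong: if_cong)
  have "(\<Prod>j\<in>J. \<Sum>c\<le>count \<kappa> j. F j c) = (\<Sum>f\<in>PiE J (\<lambda>j. {..count \<kappa> j}). \<Prod>j\<in>J. F j (f j))"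
    by (rule prod_sum_PiE) (use fin in auto)
  also have "\<dots> = (\<Sum>R | R \<subseteq># \<kappa>. \<Prod>j\<in>J. F j (count R j))"
  proof (rule sum.reindex_bij_witness[where i = "\<lambda>R. restrict (count R) J" and j = ms], goal_cases)
    case (1 f)
    thus ?case by (auto simp: fun_eq_iff count PiE_def extensional_def restrict_def)
  next
    case (2 f)
    hence "count (ms f) j \<le> count \<kappa> j" for j by (auto simp: count PiE_def Pi_def)
    thus ?case by (simp add: subseteq_mset_def)
  next
    case (3 R)
    have "count R j = 0" if "j \<notin> J" for j
      using 3 that sub by (metis mem_Collect_eq mset_subset_eqD not_in_iff subsetD)
    thus ?case by (intro multiset_eqI) (simp add: count)
  next
    case (4 R)
    thus ?case by (auto simp: subseteq_mset_def)
  next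
    case (5 f)
    thus ?case by (simp add: count)
  qed
  finally show ?thesis by simp
qed

section \<open>Raising parts, and the column-wise factorization of the skew coefficients\<close>

abbreviation inc :: "int multiset \<Rightarrow> int multiset" where
  "inc r \<equiv> image_mset (\<lambda>j. j + 1) r"

lemma count_inc: "count (inc R) j = count R (j - 1)"
  by (induction R) auto

lemma column_inc: "column (inc R) j = column R (j - 1)"
  by (induction R) auto

text \<open>The inverse of the lowering in the Pieri rule: if \<kappa> arises from \<nu> by lowering
  r, then \<nu> is \<kappa> with the parts R = \<open>dec r\<close> raised.\<close>

definition raise :: "int multiset \<Rightarrow> int multiset \<Rightarrow> int multiset" where
  "raise \<kappa> R = \<kappa> - R + inc R"

context
  fixes \<mu> \<kappa> :: "int multiset"
  assumes size: "size \<mu> = size \<kappa> + 1" and le: "\<And>j. column \<kappa> j \<le> column \<mu> j"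
begin

lemma column_raise: "R \<subseteq># \<kappa> \<Longrightarrow> column (raise \<kappa> R) j = column \<kappa> j + count R (j - 1)"
proof -
  assume "R \<subseteq># \<kappa>"
  then obtain S where "\<kappa> = R + S" by (auto simp: mset_subset_eq_exists_conv)
  moreover have "column R (j - 1) = column R j + count R (j - 1)" using column_count[of R "j - 1"] by simp
  ultimately show ?thesis by (simp add: raise_def column_inc)
qed

text \<open>\<open>branch_sum\<close> summed over the multiplicities that actually occur in
  \<kappa>, instead of up to A.\<close>

lemma branch_sum':
  assumes "column \<mu> j - column \<kappa> j \<le> 1"
  shows "(\<Sum>c\<le>count \<kappa> j. (- T) ^ c * T ^ ((column \<mu> (j + 1) - column \<kappa> (j + 1) - c) choose 2)
      * tb (column \<mu> (j + 1) - column \<kappa> (j + 1)) c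
      * tb (count \<mu> j + (column \<mu> (j + 1) - column \<kappa> (j + 1)) - c) (column \<mu> j - column \<kappa> j))
    = branch (column \<mu> (j + 1) - column \<kappa> (j + 1)) (column \<mu> j - column \<kappa> j) (count \<mu> j)"
proof -
  define A D m where "A = column \<mu> (j + 1) - column \<kappa> (j + 1)" and "D = column \<mu> j - column \<kappa> j" and "m = count \<mu> j"
  let ?F = "\<lambda>c. (- T) ^ c * T ^ ((A - c) choose 2) * tb A c * tb (m + A - c) D"
  have k: "count \<kappa> j + D = m + A"
    using column_count[of \<mu> j] column_count[of \<kappa> j] le[of j] le[of "j + 1"] by (simp add: A_def D_def m_def)
  have "sum ?F {..count \<kappa> j} = sum ?F {..max A (count \<kappa> j)}"
  proof (rule sum.mono_neutral_left)
    \<comment> \<open>Here count \<kappa> j = m + A - D. For D = 0, c exceeds A and the first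
      binomial vanishes; for D > 0 the top entry m + A - c of the second one falls below D.\<close>
    have "?F c = 0" if "count \<kappa> j < c" for c
      using k that by (cases "D = 0") (auto simp: tb_def)
    thus "\<forall>i\<in>{..max A (count \<kappa> j)} - {..count \<kappa> j}. ?F i = 0" by auto
  qed auto
  also have "\<dots> = sum ?F {..A}"
    by (rule sum.mono_neutral_right) auto
  also have "\<dots> = branch A D m" using assms by (intro branch_sum) (simp add: D_def)
  finally show ?thesis unfolding A_def D_def m_def .
qed

text \<open>The summand becomes a product over columns in which the factor of j involves R only
  through its multiplicity at j. Raising too far makes some \<open>tb (A j) (c j)\<close> vanish, so
  the case distinction disappears on the right.\<close>

lemma sk_mset_raise:
  assumes b: "\<And>b. b \<in># \<mu> \<Longrightarrow> l \<le> b \<and> b < h" "\<And>b. b \<in># \<kappa> \<Longrightarrow> l \<le> b \<and> b < h - 1" "l < h" and R: "R \<subseteq># \<kappa>"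
  shows "(if \<forall>j. column (raise \<kappa> R) j \<le> column \<mu> j
      then (- T) ^ size R * sk_mset \<mu> (raise \<kappa> R) * pcoef (raise \<kappa> R) (inc R) else 0)
    = (\<Prod>j\<in>{l..<h}. (- T) ^ count R j * T ^ ((column \<mu> (j + 1) - column \<kappa> (j + 1) - count R j) choose 2)
      * tb (column \<mu> (j + 1) - column \<kappa> (j + 1)) (count R j)
      * tb (count \<mu> j + (column \<mu> (j + 1) - column \<kappa> (j + 1)) - count R j) (column \<mu> j - column \<kappa> j))" (is "_ = ?rhs")
proof -
  define A where "A j = column \<mu> j - column \<kappa> j" for j
  define c where "c j = count R (j - 1)" for j
  define \<nu> where "\<nu> = raise \<kappa> R"
  have clj: "column \<nu> j = column \<kappa> j + c j" for j using column_raise[OF R] by (simp add: c_def \<nu>_def)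
  have A: "column \<mu> j = column \<kappa> j + A j" for j using le[of j] by (simp add: A_def)
  have cR: "count R j = 0" if "j \<notin> {l..<h - 1}" for j
  proof -
    have "j \<notin># R" using that b(2) mset_subset_eqD[OF R] by fastforce
    thus ?thesis by (simp add: not_in_iff)
  qed
  define g where "g j = (- T) ^ c j * T ^ ((A j - c j) choose 2) * tb (A j) (c j)" for j
  define k where "k j = tb (count \<mu> j + A (j + 1) - c (j + 1)) (A j)" for j
  have rhs: "?rhs = (\<Prod>j\<in>{l..<h}. g (j + 1) * k j)"
    by (simp add: g_def k_def c_def A_def)
  have AlAh: "A l = 1" "A h = 0" "c l = 0" "c h = 0"
  proof -
    have "column \<mu> l = size \<mu>" "column \<kappa> l = size \<kappa>" using b by (intro column_eq_size; force)+
    thus "A l = 1" by (simp add: A_def size)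
    have "column \<mu> h = 0" using b by (intro column_eq_0) force
    thus "A h = 0" by (simp add: A_def)
  qed (use cR in \<open>auto simp: c_def\<close>)
  have gl: "g l = 1" "g h = 1" by (simp_all add: g_def AlAh numeral_2_eq_2)
  \<comment> \<open>The factor k of column j involves c (j + 1) while g involves c j. Since g is 1
    at both ends of the window, its index may be shifted by one to line the two up.\<close>
  have shift: "(\<Prod>j\<in>{l..<h}. g (j + 1)) = (\<Prod>j\<in>{l..<h}. g j)"
  proof -
    have "(\<Prod>j\<in>{l..<h}. g (j + 1)) = (\<Prod>j\<in>{l + 1..<h + 1}. g j)"
      by (rule prod.reindex_bij_witness[where i = "\<lambda>j. j - 1" and j = "\<lambda>j. j + 1"]) auto
    also have "{l + 1..<h + 1} = insert h {l + 1..<h}" using b(3) by auto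
    also have "{l..<h} = insert l {l + 1..<h}" using b(3) by auto
    ultimately show ?thesis by (simp add: gl)
  qed
  have rhs': "?rhs = prod g {l..<h} * prod k {l..<h}"
    unfolding rhs shift[symmetric] by (rule prod.distrib)
  have c0: "c j = 0" if "j \<notin> {l..<h}" for j using cR[of "j - 1"] that by (auto simp: c_def)
  show ?thesis
  proof (cases "\<forall>j. c j \<le> A j")
    case False
    then obtain j where j: "A j < c j" by (auto simp: not_le)
    hence "j \<in> {l..<h}" using c0[of j] by auto
    hence "(\<Prod>j\<in>{l..<h}. g j) = 0" using j by (intro prod_zero) (auto simp: g_def intro!: bexI[of _ j])
    hence rhs0: "?rhs = 0" unfolding rhs' by simp
    have "\<not> (\<forall>j. column \<nu> j \<le> column \<mu> j)" using j unfolding clj A by (metis add_le_cancel_left leD)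
    hence "(\<forall>j. column (raise \<kappa> R) j \<le> column \<mu> j) = False" unfolding \<nu>_def by blast
    thus ?thesis unfolding rhs0 by (simp only: if_False)
  next
    case True
    hence le': "\<forall>j. column \<nu> j \<le> column \<mu> j" unfolding clj A by simp
    have \<nu>b: "l \<le> b \<and> b < h" if "b \<in># \<nu>" for b
    proof -
      consider "b \<in># \<kappa>" | "b - 1 \<in># R" using \<open>b \<in># \<nu>\<close> by (auto simp: \<nu>_def raise_def dest: in_diffD)
      thus ?thesis using b(2)[of b] b(2)[of "b - 1"] mset_subset_eqD[OF R] by cases force+
    qed
    have size\<nu>: "size \<nu> = size \<kappa>" using R by (auto simp: \<nu>_def raise_def mset_subset_eq_exists_conv)
    have m: "count \<nu> j + c (j + 1) = count \<kappa> j + c j" for j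
      using clj[of j] clj[of "j + 1"] column_count[of \<nu> j] column_count[of \<kappa> j] by simp
    have R1: "(- T) ^ size R = (\<Prod>j\<in>{l..<h}. (- T) ^ c j)"
    proof -
      have "size R = (\<Sum>j\<in>{l..<h - 1}. count R j)"
        unfolding size_multiset_overloaded_eq
      proof (rule sum.mono_neutral_left)
        show "set_mset R \<subseteq> {l..<h - 1}"
        proof
          fix x assume "x \<in># R"
          hence "count R x \<noteq> 0" by simp
          thus "x \<in> {l..<h - 1}" using cR[of x] by argo
        qed
      qed (auto simp: not_in_iff)
      also have "\<dots> = (\<Sum>j\<in>{l + 1..<h}. c j)"
        by (rule sum.reindex_bij_witness[where i = "\<lambda>j. j - 1" and j = "\<lambda>j. j + 1"]) (auto simp: c_def)
      also have "\<dots> = (\<Sum>j\<in>{l..<h}. c j)"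
      proof (rule sum.mono_neutral_left)
        show "\<forall>i\<in>{l..<h} - {l + 1..<h}. c i = 0"
        proof
          fix i assume "i \<in> {l..<h} - {l + 1..<h}"
          hence "i = l" by auto
          thus "c i = 0" by (simp add: AlAh)
        qed
      qed auto
      finally show ?thesis by (simp add: power_sum)
    qed
    have R2: "pcoef \<nu> (inc R) = (\<Prod>j\<in>{l..<h}. tb (count \<nu> j) (c j))"
      unfolding pcoef_def
    proof (rule prod.mono_neutral_cong_left)
      show "\<forall>i\<in>{l..<h} - set_mset \<nu>. tb (count \<nu> i) (c i) = 1"
      proof
        fix i assume "i \<in> {l..<h} - set_mset \<nu>"
        hence z: "count \<nu> i = 0" by (simp add: not_in_iff)
        have "c i \<le> count \<nu> i" by (simp add: \<nu>_def raise_def count_inc c_def)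
        thus "tb (count \<nu> i) (c i) = 1" using z by simp
      qed
    qed (use \<nu>b in \<open>auto simp: count_inc c_def\<close>)
    have R3: "sk_mset \<mu> \<nu> = (\<Prod>j\<in>{l..<h}. T ^ ((column \<mu> j - column \<nu> j) choose 2) * tb (column \<mu> j - column \<nu> (j + 1)) (count \<nu> j))"
      by (rule sk_mset_window) (use b \<nu>b size size\<nu> in auto)
    have "(- T) ^ size R * sk_mset \<mu> \<nu> * pcoef \<nu> (inc R) = (\<Prod>j\<in>{l..<h}. g j * k j)"
      unfolding R1 R2 R3 prod.distrib[symmetric]
    proof (rule prod.cong[OF refl], goal_cases)
      case (1 j)
      define a where "a = column \<mu> j - column \<nu> (j + 1)"
      have a: "a = count \<mu> j + A (j + 1) - c (j + 1)"
        using column_count[of \<mu> j] A[of "j + 1"] by (simp add: a_def clj)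
      have cm: "c j \<le> count \<nu> j" by (simp add: \<nu>_def raise_def count_inc c_def)
      have ma: "count \<nu> j \<le> a" using le' column_count[of \<nu> j] by (simp add: a_def) (metis add.commute add_le_imp_le_diff)
      have aA: "a - count \<nu> j + c j = A j"
        using column_count[of \<nu> j] clj[of j] A[of j] True[rule_format, of j] ma by (simp add: a_def)
      \<comment> \<open>The multiplicity in \<nu> mixes the choices at two neighbouring columns; the
        multinomial identity trades it for A j, which does not depend on R.\<close>
      have "tb a (count \<nu> j) * tb (count \<nu> j) (c j) = tb a (A j) * tb (A j) (c j)"
        using tb_trinomial'[OF cm ma] unfolding aA .
      moreover have "column \<mu> j - column \<nu> j = A j - c j" by (simp add: clj A)
      ultimately show ?case unfolding g_def k_def a[symmetric] a_def[symmetric] by (simp add: mult_ac)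
    qed
    also have "\<dots> = ?rhs" unfolding rhs' by (rule prod.distrib)
    finally show ?thesis using le' by (simp only: \<nu>_def simp_thms if_True)
  qed
qed

text \<open>The cancellation behind the whole proof: although \<mu> need not interlace with the
  raised multisets, the signed sum is a product over columns of the sums of
  \<open>branch_sum'\<close>, and it vanishes unless \<kappa> interlaces with \<mu>.\<close>

theorem sum_raise:
  "(\<Sum>R | R \<subseteq># \<kappa>. if \<forall>j. column (raise \<kappa> R) j \<le> column \<mu> j
      then (- T) ^ size R * sk_mset \<mu> (raise \<kappa> R) * pcoef (raise \<kappa> R) (inc R) else 0)
    = (if \<kappa> \<in> istrips \<mu> then branch_weight \<mu> \<kappa> else 0)"
proof -
  obtain l1 h1 where 1: "\<And>b. b \<in># \<mu> \<Longrightarrow> l1 \<le> b \<and> b < h1" using mset_bounds[of \<mu>] by metis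
  obtain l2 h2 where 2: "\<And>b. b \<in># \<kappa> \<Longrightarrow> l2 \<le> b \<and> b < h2" using mset_bounds[of \<kappa>] by metis
  define l h where "l = min l1 l2" and "h = max (max h1 (h2 + 1)) (l + 1)"
  have b: "\<And>b. b \<in># \<mu> \<Longrightarrow> l \<le> b \<and> b < h" "\<And>b. b \<in># \<kappa> \<Longrightarrow> l \<le> b \<and> b < h - 1" "l < h"
    using 1 2 by (force simp: l_def h_def)+
  define A where "A j = column \<mu> j - column \<kappa> j" for j
  define S where "S j = (\<Sum>c\<le>count \<kappa> j. (- T) ^ c * T ^ ((A (j + 1) - c) choose 2) * tb (A (j + 1)) c
      * tb (count \<mu> j + A (j + 1) - c) (A j))" for j
  have S: "S j = branch (A (j + 1)) (A j) (count \<mu> j)" if "A j \<le> 1" for j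
    using branch_sum'[of j] that by (simp add: S_def A_def)
  have "(\<Sum>R | R \<subseteq># \<kappa>. if \<forall>j. column (raise \<kappa> R) j \<le> column \<mu> j
      then (- T) ^ size R * sk_mset \<mu> (raise \<kappa> R) * pcoef (raise \<kappa> R) (inc R) else 0)
    = (\<Sum>R | R \<subseteq># \<kappa>. \<Prod>j\<in>{l..<h}. (- T) ^ count R j * T ^ ((A (j + 1) - count R j) choose 2)
      * tb (A (j + 1)) (count R j) * tb (count \<mu> j + A (j + 1) - count R j) (A j))"
    unfolding A_def using sk_mset_raise[of l h] b by (intro sum.cong) auto
  also have "\<dots> = (\<Prod>j\<in>{l..<h}. S j)"
    unfolding S_def by (rule sum_submultisets_prod) (use b in force)+
  also have "\<dots> = (if \<kappa> \<in> istrips \<mu> then branch_weight \<mu> \<kappa> else 0)"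
  proof (cases "\<forall>j. A j \<le> 1")
    case True
    hence "\<kappa> \<in> istrips \<mu>" using size le by (auto simp: istrips_def A_def le_diff_conv)
    moreover have "branch_weight \<mu> \<kappa> = branch_weight_upto \<mu> h l \<kappa>" by (rule branch_weight_window) (use b size in force)+
    moreover have "(\<Prod>j\<in>{l..<h}. S j) = branch_weight_upto \<mu> h l \<kappa>"
      using True S by (simp add: branch_weight_upto_def A_def)
    ultimately show ?thesis by simp
  next
    case False
    hence not: "\<kappa> \<notin> istrips \<mu>" by (auto simp: istrips_def A_def le_diff_conv)
    have Al: "A j \<le> 1" if "j \<le> l" for j
    proof -
      have "column \<mu> j = size \<mu>" "column \<kappa> j = size \<kappa>" using b that by (intro column_eq_size; force)+
      thus ?thesis by (simp add: A_def size)
    qed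
    have Ah: "A j = 0" if "j \<ge> h" for j
    proof -
      have "column \<mu> j = 0" using b that by (intro column_eq_0) force
      thus ?thesis by (simp add: A_def)
    qed
    \<comment> \<open>A is at most 1 up to l, so if it exceeds 1 somewhere there is a first jump
      from \<le> 1 to \<ge> 2. At that jump \<open>branch\<close> is zero.\<close>
    have "\<exists>j\<in>{l..<h}. A j \<le> 1 \<and> A (j + 1) \<ge> 2"
    proof (rule ccontr)
      assume no: "\<not> ?thesis"
      have "A j \<le> 1" if "l \<le> j" for j
        using that
      proof (induction j rule: int_ge_induct)
        case (step i)
        show ?case
        proof (cases "i < h")
          case True
          thus ?thesis using no step by force
        qed (use Ah in auto)
      qed (use Al in auto)
      hence "A j \<le> 1" for j using Al[of j] by (cases "l \<le> j") auto
      thus False using False by blast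
    qed
    then obtain j where j: "j \<in> {l..<h}" "A j \<le> 1" "A (j + 1) \<ge> 2" by blast
    hence "S j = 0" by (subst S) (auto simp: branch_def)
    hence "(\<Prod>j\<in>{l..<h}. S j) = 0" using j by (intro prod_zero) auto
    thus ?thesis using not by simp
  qed
  finally show ?thesis .
qed

end

text \<open>The relation between consecutive members of a chain. In contrast to
  \<open>istrips\<close> it is in general an infinite set, as the lowest part is not bounded from
  below.\<close>

definition below :: "int multiset \<Rightarrow> int multiset set" where
  "below \<mu> = {\<nu>. size \<mu> = size \<nu> + 1 \<and> (\<forall>j. column \<nu> j \<le> column \<mu> j)}"

lemma dec_inc [simp]: "dec (inc R) = R" and inc_dec [simp]: "inc (dec R) = R"
  by (simp_all add: multiset.map_comp comp_def)

lemma size_raise: "R \<subseteq># \<kappa> \<Longrightarrow> size (raise \<kappa> R) = size \<kappa>"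
  by (auto simp: raise_def mset_subset_eq_exists_conv)

lemma lower_raise: "R \<subseteq># \<kappa> \<Longrightarrow> raise \<kappa> R - inc R + dec (inc R) = \<kappa>"
  by (auto simp: raise_def mset_subset_eq_exists_conv)

lemma raise_lower: "r \<subseteq># \<nu> \<Longrightarrow> raise (\<nu> - r + dec r) (dec r) = \<nu>"
  by (auto simp: raise_def mset_subset_eq_exists_conv)

lemma column_lower_le: "r \<subseteq># \<nu> \<Longrightarrow> column (\<nu> - r + dec r) j \<le> column \<nu> j"
proof -
  assume "r \<subseteq># \<nu>"
  then obtain s where "\<nu> = r + s" by (auto simp: mset_subset_eq_exists_conv)
  moreover have "column (dec r) j \<le> column r j" by (induction r) auto
  ultimately show ?thesis by simp
qed

lemma istrips_subset_below: "istrips \<mu> \<subseteq> below \<mu>"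
  by (auto simp: istrips_def below_def)

text \<open>The skew coefficients intertwine the Pieri and the branching expansion. G stands for the
  coefficients of the polynomials being expanded; it is nonzero only in a range that lets the finite
  set F replace the infinite \<open>below \<mu>\<close>.\<close>

theorem sk_pieri_sum:
  fixes G :: "int multiset \<Rightarrow> rat fls"
  assumes F: "finite F" "F \<subseteq> below \<mu>"
    and closed: "\<And>\<nu> r. \<nu> \<in> below \<mu> \<Longrightarrow> r \<subseteq># \<nu> \<Longrightarrow> G (\<nu> - r + dec r) \<noteq> 0 \<Longrightarrow> \<nu> \<in> F"
  shows "(\<Sum>\<nu>\<in>F. sk_mset \<mu> \<nu> * (\<Sum>r | r \<subseteq># \<nu>. (- T) ^ size r * pcoef \<nu> r * G (\<nu> - r + dec r)))
    = (\<Sum>\<kappa>\<in>istrips \<mu>. branch_weight \<mu> \<kappa> * G \<kappa>)"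
proof -
  define P where "P = (SIGMA \<nu>:F. {r. r \<subseteq># \<nu>})"
  define kp where "kp = (\<lambda>(\<nu>, r). \<nu> - r + dec r)"
  define t where "t = (\<lambda>(\<nu>, r). (- T) ^ size r * sk_mset \<mu> \<nu> * pcoef \<nu> r)"
  define K where "K = kp ` P \<union> istrips \<mu>"
  have fin: "finite P" "finite K" using F by (simp_all add: P_def K_def)
  have "(\<Sum>\<nu>\<in>F. sk_mset \<mu> \<nu> * (\<Sum>r | r \<subseteq># \<nu>. (- T) ^ size r * pcoef \<nu> r * G (\<nu> - r + dec r)))
      = (\<Sum>p\<in>P. t p * G (kp p))"
    unfolding P_def sum_distrib_left
    by (subst sum.Sigma) (use F in \<open>auto simp: t_def kp_def mult_ac intro!: sum.cong\<close>)
  \<comment> \<open>The pairs (\<nu>, r) are grouped by the lowered multiset \<kappa>. Where G does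
    not vanish, a fibre consists of all admissible raisings of \<kappa>, so \<open>sum_raise\<close>
    evaluates it.\<close>
  also have "\<dots> = (\<Sum>\<kappa>\<in>K. \<Sum>p\<in>{p \<in> P. kp p = \<kappa>}. t p * G (kp p))"
    by (rule sum.group[symmetric]) (use fin in \<open>auto simp: K_def\<close>)
  also have "\<dots> = (\<Sum>\<kappa>\<in>K. (if \<kappa> \<in> istrips \<mu> then branch_weight \<mu> \<kappa> else 0) * G \<kappa>)"
  proof (rule sum.cong[OF refl])
    fix \<kappa> assume K: "\<kappa> \<in> K"
    show "(\<Sum>p\<in>{p \<in> P. kp p = \<kappa>}. t p * G (kp p)) = (if \<kappa> \<in> istrips \<mu> then branch_weight \<mu> \<kappa> else 0) * G \<kappa>"
    proof (cases "G \<kappa> = 0")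
      case True
      thus ?thesis by (auto intro!: sum.neutral)
    next
      case G: False
      have \<kappa>: "size \<mu> = size \<kappa> + 1" "\<And>j. column \<kappa> j \<le> column \<mu> j"
      proof -
        have "\<kappa> \<in> below \<mu>"
        proof (cases "\<kappa> \<in> istrips \<mu>")
          case False
          then obtain \<nu> r where p: "\<nu> \<in> F" "r \<subseteq># \<nu>" "\<kappa> = \<nu> - r + dec r"
            using K by (auto simp: K_def P_def kp_def)
          have "\<nu> \<in> below \<mu>" using p F by auto
          moreover have "size \<kappa> = size \<nu>" using p(2,3) by (auto simp: mset_subset_eq_exists_conv)
          ultimately show ?thesis using column_lower_le[OF p(2)] unfolding below_def p(3)
            by (auto intro: le_trans)
        qed (use istrips_subset_below in auto)
        thus "size \<mu> = size \<kappa> + 1" "\<And>j. column \<kappa> j \<le> column \<mu> j" by (auto simp: below_def)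
      qed
      have "(\<Sum>p\<in>{p \<in> P. kp p = \<kappa>}. t p) = (\<Sum>R\<in>{R. R \<subseteq># \<kappa> \<and> (\<forall>j. column (raise \<kappa> R) j \<le> column \<mu> j)}.
          (- T) ^ size R * sk_mset \<mu> (raise \<kappa> R) * pcoef (raise \<kappa> R) (inc R))"
      proof (rule sum.reindex_bij_witness[where i = "\<lambda>R. (raise \<kappa> R, inc R)" and j = "\<lambda>(\<nu>, r). dec r"], goal_cases)
        case (1 p)
        then obtain \<nu> r where p: "p = (\<nu>, r)" "\<nu> \<in> F" "r \<subseteq># \<nu>" "\<kappa> = \<nu> - r + dec r"
          by (auto simp: P_def kp_def)
        show ?case using raise_lower[OF p(3)] by (simp add: p)
      next
        case (2 p)
        then obtain \<nu> r where p: "p = (\<nu>, r)" "\<nu> \<in> F" "r \<subseteq># \<nu>" "\<kappa> = \<nu> - r + dec r"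
          by (auto simp: P_def kp_def)
        have "\<nu> \<in> below \<mu>" using p F by auto
        moreover have "dec r \<subseteq># \<nu> - r + dec r" by (rule mset_subset_eq_add_right)
        ultimately show ?case using raise_lower[OF p(3)] by (simp add: p below_def)
      next
        case (3 R)
        thus ?case by simp
      next
        case (4 R)
        hence R: "R \<subseteq># \<kappa>" "\<forall>j. column (raise \<kappa> R) j \<le> column \<mu> j" by auto
        have b: "raise \<kappa> R \<in> below \<mu>" using R \<kappa> size_raise[OF R(1)] by (simp add: below_def)
        have i: "inc R \<subseteq># raise \<kappa> R" by (simp add: raise_def)
        have "G (raise \<kappa> R - inc R + dec (inc R)) \<noteq> 0" unfolding lower_raise[OF R(1)] by (rule G)
        with b i have "raise \<kappa> R \<in> F" by (rule closed)
        thus ?case using i lower_raise[OF R(1)] by (simp add: P_def kp_def)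
      next
        case (5 p)
        then obtain \<nu> r where p: "p = (\<nu>, r)" "r \<subseteq># \<nu>" "\<kappa> = \<nu> - r + dec r"
          by (auto simp: P_def kp_def)
        show ?case using raise_lower[OF p(2)] by (simp add: p t_def)
      qed
      also have "\<dots> = (\<Sum>R | R \<subseteq># \<kappa>. if \<forall>j. column (raise \<kappa> R) j \<le> column \<mu> j
          then (- T) ^ size R * sk_mset \<mu> (raise \<kappa> R) * pcoef (raise \<kappa> R) (inc R) else 0)"
        using sum.inter_filter[OF finite_submultisets[of \<kappa>]] by (simp only: mem_Collect_eq)
      also have "\<dots> = (if \<kappa> \<in> istrips \<mu> then branch_weight \<mu> \<kappa> else 0)"
        using \<kappa> by (rule sum_raise)
      finally have "(\<Sum>p\<in>{p \<in> P. kp p = \<kappa>}. t p) = (if \<kappa> \<in> istrips \<mu> then branch_weight \<mu> \<kappa> else 0)" .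
      thus ?thesis by (simp add: sum_distrib_right[symmetric])
    qed
  qed
  also have "\<dots> = (\<Sum>\<kappa>\<in>istrips \<mu>. branch_weight \<mu> \<kappa> * G \<kappa>)"
    by (rule sum.mono_neutral_cong_right) (use fin in \<open>auto simp: K_def\<close>)
  finally show ?thesis .
qed

section \<open>Laurent polynomials with complex exponents\<close>

type_synonym expo = "nat \<Rightarrow>\<^sub>0 complex"

abbreviation cm :: "expo \<Rightarrow> 'a::zero \<Rightarrow> 'a cpoly" where "cm \<equiv> Poly_Mapping.single"
abbreviation xx :: "nat \<Rightarrow> complex \<Rightarrow> expo" where "xx \<equiv> Poly_Mapping.single"
abbreviation lk :: "'a::zero cpoly \<Rightarrow> expo \<Rightarrow> 'a" where "lk \<equiv> Poly_Mapping.lookup"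
abbreviation kys :: "'a::zero cpoly \<Rightarrow> expo set" where "kys \<equiv> Poly_Mapping.keys"

lemma poly_mapping_sum_singles: "(\<Sum>v\<in>Poly_Mapping.keys P. Poly_Mapping.single v (Poly_Mapping.lookup P v)) = P"
proof (rule poly_mapping_eqI)
  fix w
  have "Poly_Mapping.lookup (\<Sum>v\<in>Poly_Mapping.keys P. Poly_Mapping.single v (Poly_Mapping.lookup P v)) w
      = (\<Sum>v\<in>Poly_Mapping.keys P. if v = w then Poly_Mapping.lookup P v else 0)"
    unfolding lookup_sum lookup_single by (rule sum.cong) (auto simp: when_def)
  also have "\<dots> = Poly_Mapping.lookup P w" by (simp add: in_keys_iff)
  finally show "Poly_Mapping.lookup (\<Sum>v\<in>Poly_Mapping.keys P. Poly_Mapping.single v (Poly_Mapping.lookup P v)) w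
      = Poly_Mapping.lookup P w" .
qed

section \<open>Polynomials acting on coefficient functions\<close>

text \<open>Multiplication of an arbitrary, possibly two-sided infinite series by a Laurent
  polynomial: such series are a module, not a ring.\<close>

definition act :: "'a::comm_ring_1 cpoly \<Rightarrow> (expo \<Rightarrow> 'a) \<Rightarrow> expo \<Rightarrow> 'a" where
  "act P \<phi> w = (\<Sum>v\<in>kys P. lk P v * \<phi> (w - v))"

lemma act_superset: "finite S \<Longrightarrow> kys P \<subseteq> S \<Longrightarrow> act P \<phi> w = (\<Sum>v\<in>S. lk P v * \<phi> (w - v))"
  unfolding act_def by (rule sum.mono_neutral_left) (auto simp: in_keys_iff)

lemma act_add: "act (P + Q) \<phi> w = act P \<phi> w + act Q \<phi> w"
proof -
  have "kys (P + Q) \<subseteq> kys P \<union> kys Q" by (rule Poly_Mapping.keys_add)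
  thus ?thesis
    by (subst (1 2 3) act_superset[of "kys P \<union> kys Q"])
       (auto simp: lookup_add sum.distrib algebra_simps)
qed

lemma act_0 [simp]: "act 0 \<phi> w = 0"
  by (simp add: act_def)

lemma act_single [simp]: "act (cm v c) \<phi> w = c * \<phi> (w - v)"
  by (cases "c = 0") (simp_all add: act_def)

lemma act_1 [simp]: "act 1 \<phi> = \<phi>"
  using act_single[of 0 1 \<phi>] by (intro ext) (metis single_one diff_zero mult_1)

lemma act_sum: "act (\<Sum>i\<in>I. P i) \<phi> w = (\<Sum>i\<in>I. act (P i) \<phi> w)"
  by (induction I rule: infinite_finite_induct) (simp_all add: act_add)

lemma act_minus: "act (- P) \<phi> w = - act P \<phi> w"
  using act_add[of P "- P" \<phi> w] by (simp add: add_eq_0_iff)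

lemma act_diff: "act (P - Q) \<phi> w = act P \<phi> w - act Q \<phi> w"
  using act_add[of P "- Q" \<phi> w] by (simp add: act_minus)

lemma act_mult: "act (P * Q) \<phi> = act P (act Q \<phi>)"
proof
  fix w
  have *: "act (cm v c * Q) \<phi> w = act (cm v c) (act Q \<phi>) w" for v c
  proof -
    have "act (cm v c * Q) \<phi> w = (\<Sum>u\<in>kys Q. act (cm v c * cm u (lk Q u)) \<phi> w)"
      by (subst (1) poly_mapping_sum_singles[of Q, symmetric]) (simp only: sum_distrib_left act_sum)
    also have "\<dots> = act (cm v c) (act Q \<phi>) w"
      by (simp add: mult_single act_def[of Q] sum_distrib_left mult.assoc diff_diff_eq)
    finally show ?thesis .
  qed
  have "act (P * Q) \<phi> w = (\<Sum>v\<in>kys P. act (cm v (lk P v) * Q) \<phi> w)"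
    by (subst (1) poly_mapping_sum_singles[of P, symmetric]) (simp only: sum_distrib_right act_sum)
  also have "\<dots> = act P (act Q \<phi>) w"
    unfolding * by (simp add: act_def[of P])
  finally show "act (P * Q) \<phi> w = act P (act Q \<phi>) w" .
qed

lemma act_delta: "act P (\<lambda>w. if w = 0 then 1 else 0) = lk P"
proof
  fix w
  have "act P (\<lambda>w. if w = 0 then 1 else 0) w = (\<Sum>v\<in>kys P. if v = w then lk P v else 0)"
    unfolding act_def by (rule sum.cong) auto
  thus "act P (\<lambda>w. if w = 0 then 1 else 0) w = lk P w" by (simp add: in_keys_iff)
qed

lemma lookup_mult_act: "lk (P * Q) = act P (lk Q)"
  by (simp add: act_delta[symmetric] act_mult)

lemma act_linear: "act P (\<lambda>w. \<Sum>i\<in>I. c i * \<phi> i w) w = (\<Sum>i\<in>I. c i * act P (\<phi> i) w)"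
  unfolding act_def sum_distrib_left by (subst sum.swap) (simp add: mult_ac)

section \<open>Evaluation at points\<close>

definition int_expos :: "nat \<Rightarrow> expo set" where
  "int_expos n = {v. (\<forall>i. Poly_Mapping.lookup v i \<in> \<int>) \<and> (\<forall>i\<ge>n. Poly_Mapping.lookup v i = 0)}"

text \<open>Exponents are complex in type; on \<open>int_expos\<close> the floor of the real part
  recovers the integer.\<close>

definition ipart :: "expo \<Rightarrow> nat \<Rightarrow> int" where
  "ipart v i = \<lfloor>Re (Poly_Mapping.lookup v i)\<rfloor>"

definition mev :: "nat \<Rightarrow> (nat \<Rightarrow> rat fls) \<Rightarrow> expo \<Rightarrow> rat fls" where
  "mev n x v = (\<Prod>i<n. x i powi ipart v i)"

definition int_laurent :: "nat \<Rightarrow> rat fls cpoly set" where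
  "int_laurent n = {P. kys P \<subseteq> int_expos n}"

definition ev :: "nat \<Rightarrow> (nat \<Rightarrow> rat fls) \<Rightarrow> rat fls cpoly \<Rightarrow> rat fls" where
  "ev n x P = (\<Sum>v\<in>kys P. lk P v * mev n x v)"

definition good :: "nat \<Rightarrow> (nat \<Rightarrow> rat fls) \<Rightarrow> bool" where
  "good n x \<longleftrightarrow> inj_on x {..<n} \<and> (\<forall>i<n. x i \<noteq> 0)"

lemma int_expos_ipart: "v \<in> int_expos n \<Longrightarrow> Poly_Mapping.lookup v i = of_int (ipart v i)"
  unfolding int_expos_def ipart_def by (auto elim!: Ints_cases dest!: spec[of _ i])

lemma int_expos_0 [simp]: "0 \<in> int_expos n" and ZE_add: "u \<in> int_expos n \<Longrightarrow> v \<in> int_expos n \<Longrightarrow> u + v \<in> int_expos n"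
  and int_expos_diff: "u \<in> int_expos n \<Longrightarrow> v \<in> int_expos n \<Longrightarrow> u - v \<in> int_expos n"
  by (auto simp: int_expos_def lookup_add lookup_minus)

lemma int_expos_single: "i < n \<Longrightarrow> c \<in> \<int> \<Longrightarrow> xx i c \<in> int_expos n"
  by (auto simp: int_expos_def lookup_single when_def)

lemma int_expos_mono: "v \<in> int_expos m \<Longrightarrow> m \<le> n \<Longrightarrow> v \<in> int_expos n"
  by (auto simp: int_expos_def)

lemma ipart_0 [simp]: "ipart 0 i = 0"
  by (simp add: ipart_def)

lemma ipart_single: "ipart (xx i (of_int k)) j = (if i = j then k else 0)"
  by (simp add: ipart_def lookup_single when_def)

lemma ipart_add: "u \<in> int_expos n \<Longrightarrow> v \<in> int_expos n \<Longrightarrow> ipart (u + v) i = ipart u i + ipart v i"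
  and ipart_diff: "u \<in> int_expos n \<Longrightarrow> v \<in> int_expos n \<Longrightarrow> ipart (u - v) i = ipart u i - ipart v i"
proof -
  assume "u \<in> int_expos n" "v \<in> int_expos n"
  then obtain a b where "Poly_Mapping.lookup u i = of_int a" "Poly_Mapping.lookup v i = of_int b"
    using int_expos_ipart by blast
  thus "ipart (u + v) i = ipart u i + ipart v i" "ipart (u - v) i = ipart u i - ipart v i"
    by (simp_all add: ipart_def lookup_add lookup_minus)
qed

lemma mev_add: "good n x \<Longrightarrow> u \<in> int_expos m \<Longrightarrow> v \<in> int_expos m \<Longrightarrow> mev n x (u + v) = mev n x u * mev n x v"
  unfolding mev_def prod.distrib[symmetric]
  by (rule prod.cong) (auto simp: ipart_add good_def power_int_add)

lemma mev_0 [simp]: "mev n x 0 = 1"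
  by (simp add: mev_def)

lemma mev_single: "i < n \<Longrightarrow> mev n x (xx i (of_int k)) = x i powi k"
  unfolding mev_def ipart_single by (subst prod.remove[of _ i]) auto

lemma int_laurent_1 [simp]: "1 \<in> int_laurent n" and IP_0 [simp]: "0 \<in> int_laurent n"
  by (simp_all add: int_laurent_def)

lemma int_laurent_cm: "v \<in> int_expos n \<Longrightarrow> cm v c \<in> int_laurent n"
  by (simp add: int_laurent_def)

lemma int_laurent_add: "P \<in> int_laurent n \<Longrightarrow> Q \<in> int_laurent n \<Longrightarrow> P + Q \<in> int_laurent n"
  using Poly_Mapping.keys_add[of P Q] by (auto simp: int_laurent_def)

lemma int_laurent_uminus: "P \<in> int_laurent n \<Longrightarrow> - P \<in> int_laurent n"
  by (simp add: int_laurent_def in_keys_iff subset_iff)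

lemma int_laurent_diff: "P \<in> int_laurent n \<Longrightarrow> Q \<in> int_laurent n \<Longrightarrow> P - Q \<in> int_laurent n"
  using int_laurent_add[of P n "- Q"] int_laurent_uminus[of Q n] by simp

lemma int_laurent_mult: "P \<in> int_laurent n \<Longrightarrow> Q \<in> int_laurent n \<Longrightarrow> P * Q \<in> int_laurent n"
  unfolding int_laurent_def using keys_mult[of P Q] by (blast intro: ZE_add)

lemma int_laurent_sum: "(\<And>i. i \<in> I \<Longrightarrow> P i \<in> int_laurent n) \<Longrightarrow> (\<Sum>i\<in>I. P i) \<in> int_laurent n"
  by (induction I rule: infinite_finite_induct) (auto intro: int_laurent_add)

lemma int_laurent_prod: "(\<And>i. i \<in> I \<Longrightarrow> P i \<in> int_laurent n) \<Longrightarrow> (\<Prod>i\<in>I. P i) \<in> int_laurent n"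
  by (induction I rule: infinite_finite_induct) (auto intro: int_laurent_mult)

lemma int_laurent_mono: "P \<in> int_laurent m \<Longrightarrow> m \<le> n \<Longrightarrow> P \<in> int_laurent n"
  by (auto simp: int_laurent_def intro: int_expos_mono)

lemma ev_superset: "finite S \<Longrightarrow> kys P \<subseteq> S \<Longrightarrow> ev n x P = (\<Sum>v\<in>S. lk P v * mev n x v)"
  unfolding ev_def by (rule sum.mono_neutral_left) (auto simp: in_keys_iff)

lemma ev_add: "ev n x (P + Q) = ev n x P + ev n x Q"
proof -
  have "kys (P + Q) \<subseteq> kys P \<union> kys Q" by (rule Poly_Mapping.keys_add)
  thus ?thesis
    by (subst (1 2 3) ev_superset[of "kys P \<union> kys Q"])
       (auto simp: lookup_add sum.distrib algebra_simps)
qed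

lemma ev_0 [simp]: "ev n x 0 = 0"
  by (simp add: ev_def)

lemma ev_cm [simp]: "ev n x (cm v c) = c * mev n x v"
  by (cases "c = 0") (simp_all add: ev_def)

lemma ev_1 [simp]: "ev n x 1 = 1"
  using ev_cm[of n x 0 1] by simp

lemma ev_sum: "ev n x (\<Sum>i\<in>I. P i) = (\<Sum>i\<in>I. ev n x (P i))"
  by (induction I rule: infinite_finite_induct) (simp_all add: ev_add)

lemma ev_diff: "ev n x (P - Q) = ev n x P - ev n x Q"
  using ev_add[of n x "P - Q" Q] by simp

lemma ev_mult:
  assumes "good n x" "P \<in> int_laurent m" "Q \<in> int_laurent m"
  shows "ev n x (P * Q) = ev n x P * ev n x Q"
proof -
  have "P * Q = (\<Sum>u\<in>kys P. \<Sum>v\<in>kys Q. cm u (lk P u) * cm v (lk Q v))"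
    by (subst (1) poly_mapping_sum_singles[of P, symmetric], subst (1) poly_mapping_sum_singles[of Q, symmetric])
       (simp only: sum_product)
  hence "ev n x (P * Q) = (\<Sum>u\<in>kys P. \<Sum>v\<in>kys Q. lk P u * lk Q v * mev n x (u + v))"
    by (simp add: ev_sum mult_single)
  also have "\<dots> = (\<Sum>u\<in>kys P. \<Sum>v\<in>kys Q. lk P u * mev n x u * (lk Q v * mev n x v))"
    using assms by (intro sum.cong refl) (auto simp: mev_add int_laurent_def subset_iff)
  finally show ?thesis by (simp add: ev_def sum_product)
qed

lemma ev_prod:
  assumes "good n x" "\<And>i. i \<in> I \<Longrightarrow> P i \<in> int_laurent m"
  shows "ev n x (\<Prod>i\<in>I. P i) = (\<Prod>i\<in>I. ev n x (P i))"
  using assms(2)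
proof (induction I rule: infinite_finite_induct)
  case (insert i I)
  hence "ev n x (P i * (\<Prod>i\<in>I. P i)) = ev n x (P i) * ev n x (\<Prod>i\<in>I. P i)"
    using assms(1) by (intro ev_mult[of n x _ m] int_laurent_prod) auto
  thus ?case using insert by simp
qed auto

text \<open>With the first n points fixed, the last one may take all but finitely many values of an
  infinite field. So the coefficient of each power of the last variable vanishes separately, and
  induction applies to it.\<close>

lemma monomials_independent:
  assumes "finite S" "S \<subseteq> int_expos n" "\<And>x. good n x \<Longrightarrow> (\<Sum>v\<in>S. c v * mev n x v) = 0" "v \<in> S"
  shows "c v = 0"
  using assms
proof (induction n arbitrary: S c v)
  case 0
  have "int_expos 0 = {0}"
    by (auto simp: int_expos_def intro!: poly_mapping_eqI)
  hence "S = {0}" "v = 0" using 0 by auto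
  thus ?case using "0.prems"(3)[of "\<lambda>_. 0"] by (simp add: good_def)
next
  case (Suc n)
  define k where "k = ipart v n"
  define Sk where "Sk = {u \<in> S. ipart u n = k}"
  define pr where "pr u = u - xx n (of_int k)" for u :: expo
  have fin: "finite Sk" using Suc.prems by (simp add: Sk_def)
  have zero: "(\<Sum>u\<in>Sk. c u * mev n x u) = 0" if x: "good n x" for x
  proof -
    have "\<exists>N. \<forall>u\<in>S. 0 \<le> ipart u n + int N"
    proof -
      have "\<exists>M. \<forall>u\<in>S. \<bar>ipart u n\<bar> \<le> M"
        using Suc.prems(1) by (intro exI[of _ "\<Sum>u\<in>S. \<bar>ipart u n\<bar>"]) (auto intro: member_le_sum)
      then obtain M where "\<forall>u\<in>S. \<bar>ipart u n\<bar> \<le> M" by blast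
      thus ?thesis by (intro exI[of _ "nat M"]) force
    qed
    then obtain N where N: "\<And>u. u \<in> S \<Longrightarrow> 0 \<le> ipart u n + int N" by blast
    \<comment> \<open>The shift by N clears negative exponents, so that a polynomial with infinitely
      many roots results.\<close>
    define p where "p = (\<Sum>u\<in>S. monom (c u * mev n x u) (nat (ipart u n + int N)))"
    have "poly p z = 0" if z: "z \<notin> insert 0 (x ` {..<n})" for z
    proof -
      have g: "good (Suc n) (x(n := z))"
        using x z by (auto simp: good_def inj_on_def less_Suc_eq)
      have "poly p z = (\<Sum>u\<in>S. z ^ N * (c u * mev (Suc n) (x(n := z)) u))"
        unfolding p_def poly_sum poly_monom
      proof (rule sum.cong[OF refl], goal_cases)
        case (1 u)
        have "z ^ nat (ipart u n + int N) = z powi (ipart u n + int N)"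
          using N[OF 1] by (simp add: power_int_def)
        also have "\<dots> = z powi ipart u n * z ^ N" using z by (simp add: power_int_add)
        finally show ?case by (simp add: mev_def mult_ac)
      qed
      thus ?thesis using Suc.prems(3)[OF g] by (simp add: sum_distrib_left[symmetric])
    qed
    hence "- insert 0 (x ` {..<n}) \<subseteq> {z. poly p z = 0}" by auto
    moreover have "infinite (- insert 0 (x ` {..<n}))"
      using infinite_UNIV_char_0 by (intro Diff_infinite_finite[of _ UNIV, folded Compl_eq_Diff_UNIV]) auto
    ultimately have "p = 0" using poly_roots_finite[of p] infinite_super by blast
    hence "0 = coeff p (nat (k + int N))" by simp
    also have "\<dots> = (\<Sum>u\<in>S. if ipart u n = k then c u * mev n x u else 0)"
      unfolding p_def coeff_sum using N N[OF Suc.prems(4)]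
      by (intro sum.cong refl) (auto simp: k_def eq_nat_nat_iff)
    also have "\<dots> = (\<Sum>u\<in>Sk. c u * mev n x u)"
      unfolding Sk_def by (rule sum.inter_filter[symmetric]) (rule Suc.prems(1))
    finally show ?thesis by simp
  qed
  have xxn: "xx n (of_int k) \<in> int_expos (Suc n)" by (rule int_expos_single) auto
  have prZ: "pr u \<in> int_expos n" if "u \<in> Sk" for u
  proof -
    have u: "u \<in> int_expos (Suc n)" "ipart u n = k" using that Suc.prems(2) by (auto simp: Sk_def)
    hence "pr u \<in> int_expos (Suc n)" unfolding pr_def by (intro int_expos_diff xxn) auto
    moreover have "Poly_Mapping.lookup (pr u) n = 0"
      using int_expos_ipart[OF u(1), of n] u(2) by (simp add: pr_def lookup_minus)
    ultimately show ?thesis by (auto simp: int_expos_def) (metis Suc_leI le_neq_implies_less)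
  qed
  have mevpr: "mev n x (pr u) = mev n x u" if "u \<in> Sk" for u x
  proof -
    have "u \<in> int_expos (Suc n)" using that Suc.prems(2) by (auto simp: Sk_def)
    thus ?thesis unfolding mev_def pr_def
      by (intro prod.cong refl) (simp add: ipart_diff[OF _ xxn] ipart_single)
  qed
  have inj: "inj_on pr Sk" by (auto simp: inj_on_def pr_def)
  have "(\<lambda>u. c (u + xx n (of_int k))) (pr v) = 0"
  proof (rule Suc.IH[of "pr ` Sk" "\<lambda>u. c (u + xx n (of_int k))" "pr v"])
    show "(\<Sum>u\<in>pr ` Sk. c (u + xx n (of_int k)) * mev n x u) = 0" if "good n x" for x
      using zero[OF that] by (simp add: sum.reindex[OF inj] mevpr) (simp add: pr_def)
  qed (use fin prZ Suc.prems in \<open>auto simp: Sk_def k_def\<close>)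
  thus ?case by (simp add: pr_def)
qed

text \<open>The bridge from identities in the shuffle algebra, which hold at sets of points, to
  identities of Laurent polynomials.\<close>

lemma int_laurent_eqI:
  assumes "P \<in> int_laurent n" "Q \<in> int_laurent n" "\<And>x. good n x \<Longrightarrow> ev n x P = ev n x Q"
  shows "P = Q"
proof -
  have "lk (P - Q) v = 0" for v
  proof (cases "v \<in> kys (P - Q)")
    case True
    have "kys (P - Q) \<subseteq> int_expos n" using int_laurent_diff[OF assms(1,2)] by (simp add: int_laurent_def)
    thus ?thesis using True assms(3)
      by (intro monomials_independent[of "kys (P - Q)" n "lk (P - Q)"]) (auto simp: ev_def[symmetric] ev_diff)
  qed (simp add: in_keys_iff)
  hence "P - Q = 0" by (intro poly_mapping_eqI) simp
  thus ?thesis by simp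
qed

section \<open>Hall--Littlewood polynomials\<close>

text \<open>\<open>hlr n \<mu>\<close> is \<open>hl_lead \<mu>\<close> times the monic Hall--Littlewood polynomial, for integer parts of any sign.\<close>

fun hlr :: "nat \<Rightarrow> int multiset \<Rightarrow> rat fls cpoly" where
  "hlr 0 \<mu> = 1"
| "hlr (Suc n) \<mu> = (\<Sum>\<kappa>\<in>istrips \<mu>. cm (xx n (of_int (sum_mset \<mu> - sum_mset \<kappa>))) (branch_weight \<mu> \<kappa>) * hlr n \<kappa>)"

lemma hlr_int_laurent: "hlr n \<mu> \<in> int_laurent n"
proof (induction n arbitrary: \<mu>)
  case (Suc n)
  have "cm (xx n (of_int (sum_mset \<mu> - sum_mset \<kappa>))) (branch_weight \<mu> \<kappa>) * hlr n \<kappa> \<in> int_laurent (Suc n)" for \<kappa>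
    using Suc[of \<kappa>] Ints_of_int[of "sum_mset \<mu> - sum_mset \<kappa>", where 'a = complex]
    by (intro int_laurent_mult int_laurent_cm int_expos_single) (auto intro: int_laurent_mono)
  thus ?case by (auto intro: int_laurent_sum)
qed simp

lemma ev_Suc: "P \<in> int_laurent n \<Longrightarrow> ev (Suc n) x P = ev n x P"
  unfolding ev_def mev_def
proof (rule sum.cong[OF refl], goal_cases)
  case (1 v)
  hence "ipart v n = 0" by (auto simp: int_laurent_def int_expos_def ipart_def subset_iff)
  thus ?case by simp
qed

lemma good_Suc:
  assumes "good (Suc n) x"
  shows "good n x" "x n \<noteq> 0" "x n \<notin> x ` {..<n}" "x ` {..<Suc n} = insert (x n) (x ` {..<n})"
    "finite (x ` {..<n})" "0 \<notin> x ` {..<n}"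
  using assms by (force simp: good_def inj_on_def lessThan_Suc)+

text \<open>The recursion of \<open>hlr\<close> is the branching rule with z the last point.\<close>

lemma ev_hlr:
  "good n x \<Longrightarrow> size \<mu> = n \<Longrightarrow> ev n x (hlr n \<mu>) = val (ordered_prod \<mu>) (x ` {..<n})"
proof (induction n arbitrary: \<mu>)
  case 0
  thus ?case by (simp add: one_shuf.rep_eq)
next
  case (Suc n)
  note g = good_Suc[OF Suc.prems(1)]
  have "ev (Suc n) x (cm (xx n (of_int (sum_mset \<mu> - sum_mset \<kappa>))) (branch_weight \<mu> \<kappa>) * hlr n \<kappa>)
      = branch_weight \<mu> \<kappa> * x n powi (sum_mset \<mu> - sum_mset \<kappa>) * val (ordered_prod \<kappa>) (x ` {..<n})" if "\<kappa> \<in> istrips \<mu>" for \<kappa>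
  proof -
    have "size \<kappa> = n" using that Suc.prems by (simp add: istrips_def)
    moreover have "hlr n \<kappa> \<in> int_laurent (Suc n)" by (rule int_laurent_mono[OF hlr_int_laurent]) simp
    ultimately show ?thesis
      using Suc.prems(1) Suc.IH[OF g(1), of \<kappa>]
      by (subst ev_mult[of _ _ _ "Suc n"]) (auto intro!: int_laurent_cm int_expos_single simp: ev_Suc[OF hlr_int_laurent] mev_single simp del: of_int_diff)
  qed
  thus ?case using branching_rule[OF g(2,3,5,6), of \<mu>] by (simp add: ev_sum g(4))
qed

definition last_factor :: "nat \<Rightarrow> rat fls cpoly" where
  "last_factor n = (\<Prod>m<n. 1 - cm (xx n 1 - xx m 1) T)"

text \<open>At a tuple of points this is \<open>pieri\<close> with s equal to T times the last
  point.\<close>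

lemma hlr_pieri:
  assumes "size \<mu> = n"
  shows "last_factor n * hlr n \<mu> = (\<Sum>r | r \<subseteq># \<mu>.
     cm (xx n (of_int (int (size r)))) ((- T) ^ size r * pcoef \<mu> r) * hlr n (\<mu> - r + dec r))"
proof (rule int_laurent_eqI[of _ "Suc n"])
  have M1: "1 - cm (xx n 1 - xx m 1) T \<in> int_laurent (Suc n)" if "m < n" for m
    using that by (intro int_laurent_diff int_laurent_cm int_expos_diff int_expos_single) auto
  have M: "last_factor n \<in> int_laurent (Suc n)" unfolding last_factor_def using M1 by (intro int_laurent_prod) auto
  have H: "hlr n \<kappa> \<in> int_laurent (Suc n)" for \<kappa> by (rule int_laurent_mono[OF hlr_int_laurent]) simp
  have X: "cm (xx n (of_int k)) c \<in> int_laurent (Suc n)" for k c by (intro int_laurent_cm int_expos_single) auto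
  show "last_factor n * hlr n \<mu> \<in> int_laurent (Suc n)" using M H by (rule int_laurent_mult)
  show "(\<Sum>r | r \<subseteq># \<mu>. cm (xx n (of_int (int (size r)))) ((- T) ^ size r * pcoef \<mu> r) * hlr n (\<mu> - r + dec r)) \<in> int_laurent (Suc n)"
    using X H by (intro int_laurent_sum int_laurent_mult)
  fix x assume x: "good (Suc n) x"
  note g = good_Suc[OF x]
  let ?X = "x ` {..<n}"
  have "ev (Suc n) x (1 - cm (xx n 1 - xx m 1) T) = 1 - T * x n / x m" if "m < n" for m
  proof -
    have "mev (Suc n) x (xx n (of_int 1)) = x n" "mev (Suc n) x (xx m (of_int (-1))) = inverse (x m)"
      using that by (subst mev_single; simp)+
    moreover have "xx n 1 - xx m 1 = xx n (of_int 1) + xx m (of_int (-1))"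
      by (simp add: single_uminus)
    moreover have "mev (Suc n) x (xx n (of_int 1) + xx m (of_int (-1)))
        = mev (Suc n) x (xx n (of_int 1)) * mev (Suc n) x (xx m (of_int (-1)))"
      using that by (intro mev_add[OF x, of _ "Suc n"] int_expos_single) auto
    ultimately have "mev (Suc n) x (xx n 1 - xx m 1) = x n * inverse (x m)" by (simp only:)
    thus ?thesis by (simp add: ev_diff field_simps)
  qed
  hence "ev (Suc n) x (last_factor n) = (\<Prod>m<n. 1 - T * x n / x m)"
    unfolding last_factor_def using M1 by (subst ev_prod[OF x, of _ _ "Suc n"]) auto
  also have "\<dots> = (\<Prod>y\<in>?X. 1 - T * x n / y)"
    using g(1) by (subst prod.reindex) (auto simp: good_def)
  finally have "ev (Suc n) x (last_factor n * hlr n \<mu>) = (\<Prod>y\<in>?X. 1 - T * x n / y) * val (ordered_prod \<mu>) ?X"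
    using ev_mult[OF x M H] ev_hlr[OF g(1) assms] by (simp add: ev_Suc[OF hlr_int_laurent])
  also have "\<dots> = val (twist 0 (\<lambda>y. 1 - T * x n / y) (ordered_prod \<mu>)) ?X"
    using g(6) by (simp add: val_twist)
  also have "\<dots> = (\<Sum>r | r \<subseteq># \<mu>. (- (T * x n)) ^ size r * pcoef \<mu> r * val (ordered_prod (\<mu> - r + dec r)) ?X)"
    unfolding pieri val_sum val_sc_mult ..
  also have "\<dots> = (\<Sum>r | r \<subseteq># \<mu>. ev (Suc n) x
      (cm (xx n (of_int (int (size r)))) ((- T) ^ size r * pcoef \<mu> r) * hlr n (\<mu> - r + dec r)))"
  proof (rule sum.cong[OF refl], goal_cases)
    case (1 r)
    have "size (\<mu> - r + dec r) = n" using 1 assms by (auto simp: mset_subset_eq_exists_conv)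
    hence "ev (Suc n) x (hlr n (\<mu> - r + dec r)) = val (ordered_prod (\<mu> - r + dec r)) ?X"
      using ev_hlr[OF g(1)] by (simp add: ev_Suc[OF hlr_int_laurent])
    moreover have "mev (Suc n) x (xx n (of_int (int (size r)))) = x n ^ size r"
      by (subst mev_single) auto
    moreover have "(- (T * x n)) ^ size r = (- T) ^ size r * x n ^ size r"
      by (simp add: power_mult_distrib[symmetric])
    ultimately show ?case unfolding ev_mult[OF x X H] ev_cm by simp
  qed
  finally show "ev (Suc n) x (last_factor n * hlr n \<mu>) = ev (Suc n) x (\<Sum>r | r \<subseteq># \<mu>.
     cm (xx n (of_int (int (size r)))) ((- T) ^ size r * pcoef \<mu> r) * hlr n (\<mu> - r + dec r))"
    by (simp add: ev_sum)
qed

section \<open>Permuting variables\<close>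

abbreviation pm :: "(nat \<Rightarrow> nat) \<Rightarrow> expo \<Rightarrow> expo" where "pm \<equiv> Poly_Mapping.map_key"

lemma lookup_pm: "\<sigma> permutes A \<Longrightarrow> Poly_Mapping.lookup (pm \<sigma> w) i = Poly_Mapping.lookup w (\<sigma> i)"
  using permutes_inj[of \<sigma> A] by (simp add: map_key.rep_eq)

lemma pm_inverse:
  assumes "\<sigma> permutes A"
  shows "pm \<sigma> (pm (inv_into UNIV \<sigma>) w) = w" "pm (inv_into UNIV \<sigma>) (pm \<sigma> w) = w"
  using assms permutes_inv[OF assms]
  by (auto intro!: poly_mapping_eqI simp: lookup_pm permutes_inverses)

lemma inj_pm: "\<sigma> permutes A \<Longrightarrow> inj (pm \<sigma>)"
  by (metis injI pm_inverse(2))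

lemma pm_diff: "\<sigma> permutes A \<Longrightarrow> pm \<sigma> (u - v) = pm \<sigma> u - pm \<sigma> v"
  by (intro poly_mapping_eqI) (simp add: lookup_pm lookup_minus)

lemma ipart_pm: "\<sigma> permutes A \<Longrightarrow> ipart (pm \<sigma> w) i = ipart w (\<sigma> i)"
  by (simp add: ipart_def lookup_pm)

lemma permutes_less: "\<sigma> permutes {..<n} \<Longrightarrow> \<sigma> i < n \<longleftrightarrow> i < (n::nat)"
  using permutes_in_image[of \<sigma> "{..<n}" i] by simp

lemma permutes_image_comp: "\<sigma> permutes A \<Longrightarrow> (x \<circ> \<sigma>) ` A = x ` A"
  by (simp only: image_comp[symmetric] permutes_image)

lemma int_expos_pm: "\<sigma> permutes {..<n} \<Longrightarrow> pm \<sigma> w \<in> int_expos n \<longleftrightarrow> w \<in> int_expos n"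
proof -
  have *: "pm \<sigma> w \<in> int_expos n" if "\<sigma> permutes {..<n}" "w \<in> int_expos n" for \<sigma> w
    using that by (auto simp: int_expos_def lookup_pm permutes_not_in)
  assume \<sigma>: "\<sigma> permutes {..<n}"
  thus ?thesis using *[OF \<sigma>, of w] *[OF permutes_inv[OF \<sigma>], of "pm \<sigma> w"] by (auto simp: pm_inverse[OF \<sigma>])
qed

definition permute_vars :: "(nat \<Rightarrow> nat) \<Rightarrow> rat fls cpoly \<Rightarrow> rat fls cpoly" where
  "permute_vars \<sigma> P = Poly_Mapping.map_key (pm \<sigma>) P"

lemma lookup_permute_vars: "\<sigma> permutes A \<Longrightarrow> lk (permute_vars \<sigma> P) w = lk P (pm \<sigma> w)"
  unfolding permute_vars_def using inj_pm[of \<sigma> A] by (simp add: map_key.rep_eq)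

lemma permute_vars_int_laurent: "\<sigma> permutes {..<n} \<Longrightarrow> P \<in> int_laurent n \<Longrightarrow> permute_vars \<sigma> P \<in> int_laurent n"
  by (auto simp: int_laurent_def in_keys_iff lookup_permute_vars subset_iff) (metis int_expos_pm)

lemma ev_permute_vars:
  assumes \<sigma>: "\<sigma> permutes {..<n}"
  shows "ev n x (permute_vars \<sigma> P) = ev n (x \<circ> \<sigma>) P"
proof -
  have "ev n x (permute_vars \<sigma> P) = (\<Sum>u\<in>kys P. lk P u * mev n x (pm (inv_into UNIV \<sigma>) u))"
    unfolding ev_def
    by (rule sum.reindex_bij_witness[where i = "pm (inv_into UNIV \<sigma>)" and j = "pm \<sigma>"])
       (auto simp: pm_inverse[OF \<sigma>] in_keys_iff lookup_permute_vars[OF \<sigma>])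
  moreover have "mev n x (pm (inv_into UNIV \<sigma>) u) = mev n (x \<circ> \<sigma>) u" for u
    unfolding mev_def
    by (rule prod.reindex_bij_witness[where i = \<sigma> and j = "inv_into UNIV \<sigma>"])
       (use \<sigma> permutes_inv[OF \<sigma>] in \<open>auto simp: permutes_inverses[OF \<sigma>] ipart_pm permutes_less\<close>)
  ultimately show ?thesis by (simp add: ev_def)
qed

lemma good_permute: "\<sigma> permutes {..<n} \<Longrightarrow> good n x \<Longrightarrow> good n (x \<circ> \<sigma>)"
  unfolding good_def using permutes_image[of \<sigma> "{..<n}"]
  by (auto intro!: comp_inj_on dest: permutes_inj_on simp: permutes_less)

lemma symmetric_lookup:
  assumes \<sigma>: "\<sigma> permutes {..<n}" and P: "P \<in> int_laurent n"
    and ev: "\<And>x. good n x \<Longrightarrow> ev n (x \<circ> \<sigma>) P = ev n x P"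
  shows "lk P (pm \<sigma> w) = lk P w"
proof -
  have "permute_vars \<sigma> P = P"
    by (rule int_laurent_eqI[OF permute_vars_int_laurent[OF \<sigma> P] P]) (simp add: ev_permute_vars[OF \<sigma>] ev)
  thus ?thesis by (metis lookup_permute_vars[OF \<sigma>])
qed

text \<open>The recursion singles out the last variable, but the value at a tuple of points depends
  only on their set.\<close>

lemma hlr_symmetric:
  assumes \<sigma>: "\<sigma> permutes {..<n}" and "size \<mu> = n"
  shows "lk (hlr n \<mu>) (pm \<sigma> w) = lk (hlr n \<mu>) w"
proof (rule symmetric_lookup[OF \<sigma> hlr_int_laurent])
  fix x assume "good n x"
  moreover have "(x \<circ> \<sigma>) ` {..<n} = x ` {..<n}"
    by (rule permutes_image_comp[OF \<sigma>])
  ultimately show "ev n (x \<circ> \<sigma>) (hlr n \<mu>) = ev n x (hlr n \<mu>)"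
    using assms by (simp add: ev_hlr good_permute)
qed

section \<open>The symmetrization formula\<close>

definition kr :: "rat fls \<Rightarrow> rat fls \<Rightarrow> rat fls" where
  "kr a b = (a - T * b) / (a - b)"

lemma kr_cancel: "a \<noteq> 0 \<Longrightarrow> a \<noteq> b \<Longrightarrow> kr a b * (1 - b / a) = 1 - T * b / a"
proof -
  assume "a \<noteq> 0" "a \<noteq> b"
  moreover from this have "1 - b / a = (a - b) / a" "1 - T * b / a = (a - T * b) / a"
    by (simp_all add: diff_divide_distrib)
  ultimately show ?thesis by (simp add: kr_def)
qed

text \<open>An iterated shuffle product of one-variable functions is a sum over all orderings of the
  points, each ordered pair contributing one kernel factor.\<close>

lemma val_prod_list_ee:
  assumes "finite X" "0 \<notin> X" "length as = card X"
  shows "val (prod_list (map ee as)) X = (\<Sum>ys\<in>permutations_of_set X.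
    (\<Prod>i<length as. (ys ! i) powi (as ! i)) * (\<Prod>i<length as. \<Prod>j<length as. if i < j then kr (ys ! i) (ys ! j) else 1))"
  using assms
proof (induction as arbitrary: X)
  case Nil
  thus ?case by (simp add: one_shuf.rep_eq)
next
  case (Cons a as)
  let ?w = "\<lambda>as ys. (\<Prod>i<length as. (ys ! i) powi (as ! i)) * (\<Prod>i<length as. \<Prod>j<length as. if i < j then kr (ys ! i) (ys ! j) else 1)"
  have ne: "X \<noteq> {}" using Cons.prems by auto
  have w: "?w (a # as) (y # ys) = y powi a * ?w as ys * kern {y} (X - {y})"
    if "y \<in> X" "ys \<in> permutations_of_set (X - {y})" for y ys
  proof -
    have ys: "set ys = X - {y}" "distinct ys" using that by (auto simp: permutations_of_set_def)
    hence len: "length ys = length as" using Cons.prems \<open>y \<in> X\<close> distinct_card[of ys] by simp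
    have "kern {y} (X - {y}) = (\<Prod>b\<in>set ys. kr y b)" by (simp add: kern_def kr_def ys)
    also have "\<dots> = (\<Prod>j<length as. kr y (ys ! j))"
      using bij_betw_nth[OF ys(2) refl refl] by (intro prod.reindex_bij_betw[symmetric]) (simp add: len)
    finally show ?thesis by (simp add: prod.lessThan_Suc_shift del: prod.lessThan_Suc cong: if_cong)
  qed
  have "val (prod_list (map ee (a # as))) X
      = (\<Sum>y\<in>X. y powi a * val (prod_list (map ee as)) (X - {y}) * kern {y} (X - {y}))"
    using Cons.prems by (simp add: val_ee_mult)
  also have "\<dots> = (\<Sum>y\<in>X. \<Sum>ys\<in>permutations_of_set (X - {y}). ?w (a # as) (y # ys))"
  proof (rule sum.cong[OF refl], goal_cases)
    case (1 y)
    hence e: "val (prod_list (map ee as)) (X - {y}) = sum (?w as) (permutations_of_set (X - {y}))"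
      using Cons.prems by (intro Cons.IH) auto
    show ?case unfolding e sum_distrib_left sum_distrib_right
      by (intro sum.cong refl w[OF 1, symmetric])
  qed
  also have "\<dots> = (\<Sum>y\<in>X. \<Sum>ys\<in>(#) y ` permutations_of_set (X - {y}). ?w (a # as) ys)"
    by (simp add: sum.reindex)
  also have "\<dots> = sum (?w (a # as)) (permutations_of_set X)"
    unfolding permutations_of_set_nonempty[OF ne]
    by (rule sum.UNION_disjoint[symmetric]) (use Cons.prems in auto)
  finally show ?case .
qed

definition desc_list :: "int multiset \<Rightarrow> int list" where
  "desc_list \<mu> = rev (sorted_list_of_multiset \<mu>)"

lemma length_desc_list [simp]: "length (desc_list \<mu>) = size \<mu>"
  unfolding desc_list_def by (metis length_rev mset_sorted_list_of_multiset size_mset)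

lemma val_ordered_prod_permutations:
  assumes x: "good n x" and "size \<mu> = n"
  shows "val (ordered_prod \<mu>) (x ` {..<n}) = (\<Sum>\<sigma> | \<sigma> permutes {..<n}.
    (\<Prod>i<n. x (\<sigma> i) powi (desc_list \<mu> ! i)) * (\<Prod>i<n. \<Prod>j<n. if i < j then kr (x (\<sigma> i)) (x (\<sigma> j)) else 1))"
proof -
  let ?X = "x ` {..<n}"
  have inj: "inj_on x {..<n}" using x by (simp add: good_def)
  have X: "finite ?X" "0 \<notin> ?X" "card ?X = n" using x inj by (auto simp: good_def card_image)
  define f where "f \<sigma> = map (x \<circ> \<sigma>) [0..<n]" for \<sigma> :: "nat \<Rightarrow> nat"
  have inj_f: "inj_on f {\<sigma>. \<sigma> permutes {..<n}}"
  proof (rule inj_onI, rule ext)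
    fix \<sigma> \<tau> i assume *: "\<sigma> \<in> {\<sigma>. \<sigma> permutes {..<n}}" "\<tau> \<in> {\<sigma>. \<sigma> permutes {..<n}}" "f \<sigma> = f \<tau>"
    show "\<sigma> i = \<tau> i"
    proof (cases "i < n")
      case True
      hence "x (\<sigma> i) = x (\<tau> i)" using *(3) by (auto simp: f_def)
      moreover have "\<sigma> i < n" "\<tau> i < n" using True * by (auto simp: permutes_less)
      ultimately show ?thesis using inj by (auto simp: inj_on_def)
    next
      case False
      thus ?thesis using * by (auto simp: permutes_not_in)
    qed
  qed
  have "f ` {\<sigma>. \<sigma> permutes {..<n}} = permutations_of_set ?X"
  proof (rule card_subset_eq)
    show "f ` {\<sigma>. \<sigma> permutes {..<n}} \<subseteq> permutations_of_set ?X"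
    proof safe
      fix \<sigma> assume \<sigma>: "\<sigma> permutes {..<n}"
      have "set (f \<sigma>) = ?X" using permutes_image_comp[OF \<sigma>, of x] by (simp add: f_def atLeast0LessThan)
      moreover have "distinct (f \<sigma>)"
        using inj permutes_inj_on[OF \<sigma>] permutes_image[OF \<sigma>]
        by (auto simp: f_def distinct_map atLeast0LessThan intro!: comp_inj_on)
      ultimately show "f \<sigma> \<in> permutations_of_set ?X" by (simp add: permutations_of_set_def)
    qed
    show "card (f ` {\<sigma>. \<sigma> permutes {..<n}}) = card (permutations_of_set ?X)"
      using X inj_f by (simp add: card_image card_permutations[of _ n])
  qed (use X in simp)
  hence bij: "bij_betw f {\<sigma>. \<sigma> permutes {..<n}} (permutations_of_set ?X)"
    using inj_f by (simp add: bij_betw_def)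
  have "val (ordered_prod \<mu>) ?X = (\<Sum>ys\<in>permutations_of_set ?X.
    (\<Prod>i<n. (ys ! i) powi (desc_list \<mu> ! i)) * (\<Prod>i<n. \<Prod>j<n. if i < j then kr (ys ! i) (ys ! j) else 1))"
    using val_prod_list_ee[OF X(1,2), of "desc_list \<mu>"] assms X by (simp add: ordered_prod_def desc_list_def[symmetric])
  also have "\<dots> = (\<Sum>\<sigma> | \<sigma> permutes {..<n}.
    (\<Prod>i<n. (f \<sigma> ! i) powi (desc_list \<mu> ! i)) * (\<Prod>i<n. \<Prod>j<n. if i < j then kr (f \<sigma> ! i) (f \<sigma> ! j) else 1))"
    by (rule sum.reindex_bij_betw[OF bij, symmetric])
  also have "\<dots> = (\<Sum>\<sigma> | \<sigma> permutes {..<n}.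
    (\<Prod>i<n. x (\<sigma> i) powi (desc_list \<mu> ! i)) * (\<Prod>i<n. \<Prod>j<n. if i < j then kr (x (\<sigma> i)) (x (\<sigma> j)) else 1))"
    by (intro sum.cong arg_cong2[where f = "(*)"] prod.cong refl) (auto simp: f_def)
  finally show ?thesis .
qed

abbreviation posr :: "nat \<Rightarrow> (nat \<times> nat) set" where "posr n \<equiv> {(i, j). i < j \<and> j < n}"
abbreviation allr :: "nat \<Rightarrow> (nat \<times> nat) set" where "allr n \<equiv> {(i, j). i < n \<and> j < n \<and> i \<noteq> j}"
abbreviation al :: "nat \<Rightarrow> nat \<Rightarrow> expo" where "al i j \<equiv> xx i 1 - xx j 1"

lemma finite_roots [simp]: "finite (posr n)" "finite (allr n)"
  by (rule finite_subset[of _ "{..<n} \<times> {..<n}"]; auto)+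

lemma allr_split: "(\<Prod>(i, j)\<in>allr n. f i j) = (\<Prod>(i, j)\<in>posr n. f i j * f j (i::nat))"
proof -
  have "allr n = posr n \<union> prod.swap ` posr n"
    by (auto simp: image_iff)
  hence "(\<Prod>(i, j)\<in>allr n. f i j) = (\<Prod>(i, j)\<in>posr n. f i j) * (\<Prod>(i, j)\<in>prod.swap ` posr n. f i j)"
    by (auto intro!: prod.union_disjoint)
  also have "(\<Prod>(i, j)\<in>prod.swap ` posr n. f i j) = (\<Prod>(i, j)\<in>posr n. f j i)"
    by (subst prod.reindex) (auto simp: case_prod_beta)
  also have "(\<Prod>(i, j)\<in>posr n. f i j) * \<dots> = (\<Prod>(i, j)\<in>posr n. f i j * f j i)"
    unfolding prod.distrib[symmetric] by (rule prod.cong) auto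
  finally show ?thesis .
qed

lemma posr_prod: "(\<Prod>(i, j)\<in>posr n. f i j) = (\<Prod>i<n. \<Prod>j<n. if i < j then f i j else 1)"
proof -
  have "(\<Prod>i<n. \<Prod>j<n. if i < j then f i j else 1) = (\<Prod>(i, j)\<in>{..<n} \<times> {..<n}. if i < j then f i j else 1)"
    by (rule prod.cartesian_product)
  also have "\<dots> = (\<Prod>(i, j)\<in>posr n. f i j)"
    by (rule prod.mono_neutral_cong_right) (auto split: if_splits)
  finally show ?thesis by simp
qed

lemma allr_permute: "\<sigma> permutes {..<n} \<Longrightarrow> (\<Prod>(i, j)\<in>allr n. f (\<sigma> i) (\<sigma> j)) = (\<Prod>(i, j)\<in>allr n. f i j)"
proof (rule prod.reindex_bij_witness[where i = "map_prod (inv_into UNIV \<sigma>) (inv_into UNIV \<sigma>)" and j = "map_prod \<sigma> \<sigma>"], goal_cases)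
  case (4 p)
  note in_img = permutes_less[OF permutes_inv[OF 4(1)]]
  have "inv_into UNIV \<sigma> i \<noteq> inv_into UNIV \<sigma> j" if "i \<noteq> j" for i j using that 4(1) by (metis permutes_inverses(1))
  thus ?case using 4(2) in_img by auto
next
  case (2 p)
  note in_img = permutes_less[OF 2(1)]
  have "\<sigma> i \<noteq> \<sigma> j" if "i \<noteq> j" for i j using that 2(1) by (metis permutes_inverses(2))
  thus ?case using 2(2) in_img by auto
qed (auto simp: permutes_inverses)

definition xl :: "int list \<Rightarrow> expo" where
  "xl as = (\<Sum>i<length as. xx i (of_int (as ! i)))"

lemma lookup_xl: "Poly_Mapping.lookup (xl as) i = (if i < length as then of_int (as ! i) else 0)"
  unfolding xl_def lookup_sum lookup_single by (simp add: when_def)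

lemma ipart_xl: "ipart (xl as) i = (if i < length as then as ! i else 0)"
  by (simp add: ipart_def lookup_xl)

lemma xl_int_expos: "xl as \<in> int_expos (length as)"
  by (simp add: int_expos_def lookup_xl)

lemma mev_xl: "mev (length as) x (xl as) = (\<Prod>i<length as. x i powi (as ! i))"
  unfolding mev_def by (rule prod.cong) (simp_all add: ipart_xl)

lemma root_int_laurent: "i < n \<Longrightarrow> j < n \<Longrightarrow> 1 - cm (al i j) c \<in> int_laurent n"
  by (intro int_laurent_diff int_laurent_cm int_expos_diff int_expos_single) auto

lemma ev_root:
  assumes "good n x" "i < n" "j < n"
  shows "ev n x (1 - cm (al i j) c) = 1 - c * x i / x j"
proof -
  have "al i j = xx i (of_int 1) + xx j (of_int (-1))"
    by (simp add: single_uminus)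
  hence "mev n x (al i j) = mev n x (xx i (of_int 1)) * mev n x (xx j (of_int (-1)))"
    using assms by (simp only:) (intro mev_add[OF assms(1), of _ n] int_expos_single, auto)
  also have "\<dots> = x i * inverse (x j)"
    using assms by (simp only: mev_single) simp
  finally show ?thesis by (simp add: ev_diff field_simps)
qed

text \<open>The summand of the identity permutation in the symmetrization formula, after the
  denominators x_i - x_j have been cleared.\<close>

definition N_poly :: "int list \<Rightarrow> rat fls cpoly" where
  "N_poly as = cm (xl as) 1 * (\<Prod>(i, j)\<in>posr (length as). (1 - cm (al i j) 1) * (1 - cm (al j i) T))"

text \<open>The multiplier over all ordered pairs is invariant under permutations, so it may be
  taken into each summand, where \<open>kr_cancel\<close> removes the denominators pair by
  pair.\<close>

theorem hlr_times_weyl: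
  assumes \<mu>: "size \<mu> = n"
  shows "hlr n \<mu> * (\<Prod>(i, j)\<in>allr n. 1 - cm (al i j) 1) = (\<Sum>\<sigma> | \<sigma> permutes {..<n}. permute_vars \<sigma> (N_poly (desc_list \<mu>)))"
proof (rule int_laurent_eqI[of _ n])
  have D: "(\<Prod>(i, j)\<in>allr n. 1 - cm (al i j) 1) \<in> int_laurent n"
    by (rule int_laurent_prod) (auto intro: root_int_laurent)
  have N': "(\<Prod>(i, j)\<in>posr n. (1 - cm (al i j) 1) * (1 - cm (al j i) T)) \<in> int_laurent n"
    by (rule int_laurent_prod) (auto intro!: int_laurent_mult root_int_laurent)
  have X: "cm (xl (desc_list \<mu>)) 1 \<in> int_laurent n"
    using xl_int_expos[of "desc_list \<mu>"] \<mu> by (intro int_laurent_cm) simp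
  have N: "N_poly (desc_list \<mu>) \<in> int_laurent n" using X N' \<mu> unfolding N_poly_def by (intro int_laurent_mult) auto
  show "hlr n \<mu> * (\<Prod>(i, j)\<in>allr n. 1 - cm (al i j) 1) \<in> int_laurent n"
    using hlr_int_laurent D by (rule int_laurent_mult)
  show "(\<Sum>\<sigma> | \<sigma> permutes {..<n}. permute_vars \<sigma> (N_poly (desc_list \<mu>))) \<in> int_laurent n"
    using N by (intro int_laurent_sum permute_vars_int_laurent) auto
  fix x assume x: "good n x"
  have "ev n x (\<Prod>(i, j)\<in>allr n. 1 - cm (al i j) 1) = (\<Prod>(i, j)\<in>allr n. 1 - x i / x j)"
    by (subst ev_prod[OF x, of _ _ n]) (auto intro!: root_int_laurent prod.cong simp: ev_root[OF x])
  hence "ev n x (hlr n \<mu> * (\<Prod>(i, j)\<in>allr n. 1 - cm (al i j) 1))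
      = val (ordered_prod \<mu>) (x ` {..<n}) * (\<Prod>(i, j)\<in>allr n. 1 - x i / x j)"
    using ev_mult[OF x hlr_int_laurent D] ev_hlr[OF x \<mu>] by simp
  also have "\<dots> = (\<Sum>\<sigma> | \<sigma> permutes {..<n}.
      (\<Prod>i<n. x (\<sigma> i) powi (desc_list \<mu> ! i)) * (\<Prod>(i, j)\<in>posr n. (1 - x (\<sigma> i) / x (\<sigma> j)) * (1 - T * x (\<sigma> j) / x (\<sigma> i))))"
    unfolding val_ordered_prod_permutations[OF x \<mu>] sum_distrib_right
  proof (rule sum.cong[OF refl], goal_cases)
    case (1 \<sigma>)
    hence \<sigma>: "\<sigma> permutes {..<n}" by simp
    have "(\<Prod>(i, j)\<in>allr n. 1 - x i / x j) = (\<Prod>(i, j)\<in>allr n. 1 - x (\<sigma> i) / x (\<sigma> j))"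
      using allr_permute[OF \<sigma>, of "\<lambda>i j. 1 - x i / x j"] by simp
    also have "\<dots> = (\<Prod>(i, j)\<in>posr n. (1 - x (\<sigma> i) / x (\<sigma> j)) * (1 - x (\<sigma> j) / x (\<sigma> i)))"
      by (rule allr_split)
    finally have "(\<Prod>(i, j)\<in>posr n. kr (x (\<sigma> i)) (x (\<sigma> j))) * (\<Prod>(i, j)\<in>allr n. 1 - x i / x j)
        = (\<Prod>(i, j)\<in>posr n. kr (x (\<sigma> i)) (x (\<sigma> j)) * ((1 - x (\<sigma> i) / x (\<sigma> j)) * (1 - x (\<sigma> j) / x (\<sigma> i))))"
      by (simp add: prod.distrib case_prod_beta)
    also have "\<dots> = (\<Prod>(i, j)\<in>posr n. (1 - x (\<sigma> i) / x (\<sigma> j)) * (1 - T * x (\<sigma> j) / x (\<sigma> i)))"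
    proof (rule prod.cong[OF refl], goal_cases)
      case (1 p)
      obtain i j where p: "p = (i, j)" by (cases p)
      have "good n (x \<circ> \<sigma>)" using x \<sigma> by (rule good_permute[rotated])
      hence "x (\<sigma> i) \<noteq> 0" "x (\<sigma> i) \<noteq> x (\<sigma> j)"
        using 1 p by (auto simp: good_def inj_on_def)
      hence e: "kr (x (\<sigma> i)) (x (\<sigma> j)) * (1 - x (\<sigma> j) / x (\<sigma> i)) = 1 - T * x (\<sigma> j) / x (\<sigma> i)"
        by (rule kr_cancel)
      show ?case unfolding p prod.case mult.left_commute[of "kr _ _"] e ..
    qed
    finally show ?case by (simp add: posr_prod[symmetric] mult.assoc)
  qed
  also have "\<dots> = (\<Sum>\<sigma> | \<sigma> permutes {..<n}. ev n x (permute_vars \<sigma> (N_poly (desc_list \<mu>))))"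
  proof (rule sum.cong[OF refl], goal_cases)
    case (1 \<sigma>)
    hence \<sigma>: "\<sigma> permutes {..<n}" by simp
    note g = good_permute[OF \<sigma> x]
    have r: "ev n (x \<circ> \<sigma>) ((1 - cm (al i j) 1) * (1 - cm (al j i) T))
      = (1 - x (\<sigma> i) / x (\<sigma> j)) * (1 - T * x (\<sigma> j) / x (\<sigma> i))" if "i < j" "j < n" for i j
      using that by (subst ev_mult[OF g, of _ n]) (auto intro!: root_int_laurent simp: ev_root[OF g])
    have "ev n (x \<circ> \<sigma>) (\<Prod>(i, j)\<in>posr n. (1 - cm (al i j) 1) * (1 - cm (al j i) T))
      = (\<Prod>(i, j)\<in>posr n. (1 - x (\<sigma> i) / x (\<sigma> j)) * (1 - T * x (\<sigma> j) / x (\<sigma> i)))"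
      by (subst ev_prod[OF g, of _ _ n])
         (auto intro!: root_int_laurent int_laurent_mult prod.cong simp: r)
    moreover have "mev n (x \<circ> \<sigma>) (xl (desc_list \<mu>)) = (\<Prod>i<n. x (\<sigma> i) powi (desc_list \<mu> ! i))"
      using mev_xl[of "desc_list \<mu>" "x \<circ> \<sigma>"] \<mu> by simp
    ultimately show ?case
      unfolding ev_permute_vars[OF \<sigma>] N_poly_def using \<mu> by (simp add: ev_mult[OF g X N'])
  qed
  finally show "ev n x (hlr n \<mu> * (\<Prod>(i, j)\<in>allr n. 1 - cm (al i j) 1))
      = ev n x (\<Sum>\<sigma> | \<sigma> permutes {..<n}. permute_vars \<sigma> (N_poly (desc_list \<mu>)))"
    by (simp add: ev_sum)
qed

section \<open>Support and leading coefficient of the Hall-Littlewood polynomials\<close>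

lemma desc_nth_column:
  "sorted_wrt (\<ge>) xs \<Longrightarrow> i < length xs \<Longrightarrow> j \<le> xs ! i \<longleftrightarrow> i < column (mset xs) j"
proof (induction xs arbitrary: i)
  case (Cons a xs)
  show ?case
  proof (cases "j \<le> a")
    case True
    thus ?thesis using Cons by (cases i) auto
  next
    case False
    hence "column (mset (a # xs)) j = 0" using Cons.prems by (intro column_eq_0) auto
    moreover have "(a # xs) ! i \<le> a" using Cons.prems by (cases i) auto
    hence "\<not> j \<le> (a # xs) ! i" using False by simp
    ultimately show ?thesis by simp
  qed
qed simp

lemma mset_desc_list [simp]: "mset (desc_list \<mu>) = \<mu>"
  by (simp add: desc_list_def)

lemma sorted_desc_list: "sorted_wrt (\<ge>) (desc_list \<mu>)"
  by (simp add: desc_list_def sorted_wrt_rev)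

lemma desc_list_unique: "sorted_wrt (\<ge>) xs \<Longrightarrow> desc_list (mset xs) = xs"
proof -
  assume "sorted_wrt (\<ge>) xs"
  hence "sorted (rev xs)" by (simp add: sorted_wrt_rev)
  hence "sorted_list_of_multiset (mset (rev xs)) = rev xs"
    by (metis properties_for_sort sorted_list_of_multiset_mset)
  thus ?thesis by (simp add: desc_list_def)
qed

lemma desc_list_nth_mono:
  assumes "i < j" "j < size \<mu>" shows "desc_list \<mu> ! j \<le> desc_list \<mu> ! i"
  using sorted_wrt_nth_less[OF sorted_desc_list assms(1)] assms by simp

lemma column_le_iff_nth:
  assumes "size \<kappa> \<le> size \<mu>"
  shows "(\<forall>j. column \<kappa> j \<le> column \<mu> j) \<longleftrightarrow> (\<forall>i<size \<kappa>. desc_list \<kappa> ! i \<le> desc_list \<mu> ! i)"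
proof safe
  fix i assume "\<forall>j. column \<kappa> j \<le> column \<mu> j" "i < size \<kappa>"
  thus "desc_list \<kappa> ! i \<le> desc_list \<mu> ! i"
    using desc_nth_column[OF sorted_desc_list, of i \<mu> "desc_list \<kappa> ! i"] desc_nth_column[OF sorted_desc_list, of i \<kappa> "desc_list \<kappa> ! i"] assms
    by (auto intro: less_le_trans)
next
  fix j assume *: "\<forall>i<size \<kappa>. desc_list \<kappa> ! i \<le> desc_list \<mu> ! i"
  show "column \<kappa> j \<le> column \<mu> j"
  proof (rule ccontr)
    assume "\<not> ?thesis"
    define i where "i = column \<mu> j"
    have i: "i < column \<kappa> j" "i < size \<kappa>" using \<open>\<not> _\<close> column_le_size[of \<kappa> j] by (auto simp: i_def)
    hence "j \<le> desc_list \<kappa> ! i" using desc_nth_column[OF sorted_desc_list, of i \<kappa> j] by simp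
    hence "j \<le> desc_list \<mu> ! i" using * i by force
    hence "i < column \<mu> j" using desc_nth_column[OF sorted_desc_list, of i \<mu> j] i assms by simp
    thus False by (simp add: i_def)
  qed
qed

lemma below_nth: "\<kappa> \<in> below \<mu> \<Longrightarrow> i < size \<kappa> \<Longrightarrow> desc_list \<kappa> ! i \<le> desc_list \<mu> ! i"
  using column_le_iff_nth[of \<kappa> \<mu>] by (auto simp: below_def)

lemma sum_desc_list: "(\<Sum>i<size \<mu>. desc_list \<mu> ! i) = sum_mset \<mu>"
proof -
  have "sum_mset \<mu> = sum_list (desc_list \<mu>)" by (metis mset_desc_list sum_mset_sum_list)
  thus ?thesis by (simp add: sum_list_sum_nth atLeast0LessThan)
qed

lemma lookup_hlr_Suc:
  "lk (hlr (Suc n) \<mu>) w = (\<Sum>\<kappa>\<in>istrips \<mu>. branch_weight \<mu> \<kappa> * lk (hlr n \<kappa>) (w - xx n (of_int (sum_mset \<mu> - sum_mset \<kappa>))))"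
  by (simp add: lookup_sum lookup_mult_act)

text \<open>All bounds follow from the branching recursion: each \<kappa> lies below \<mu> entry by
  entry, and the last exponent is the difference of the sizes of the partitions.\<close>

lemma hlr_keys:
  assumes "size \<mu> = n" "lk (hlr n \<mu>) w \<noteq> 0"
  shows "w \<in> int_expos n" "k \<le> n \<Longrightarrow> (\<Sum>i<k. ipart w i) \<le> (\<Sum>i<k. desc_list \<mu> ! i)"
    "(\<Sum>i<n. ipart w i) = sum_mset \<mu>"
    "\<forall>b\<in>#\<mu>. l \<le> b \<Longrightarrow> i < n \<Longrightarrow> l \<le> ipart w i"
proof -
  show w: "w \<in> int_expos n" using hlr_int_laurent[of n \<mu>] assms(2) by (auto simp: int_laurent_def in_keys_iff)
  have "(\<forall>k\<le>n. (\<Sum>i<k. ipart w i) \<le> (\<Sum>i<k. desc_list \<mu> ! i)) \<and> (\<Sum>i<n. ipart w i) = sum_mset \<mu>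
     \<and> (\<forall>i<n. \<forall>l. (\<forall>b\<in>#\<mu>. l \<le> b) \<longrightarrow> l \<le> ipart w i)"
    using assms
  proof (induction n arbitrary: \<mu> w)
    case (Suc n)
    from Suc.prems(2) obtain \<kappa> where \<kappa>: "\<kappa> \<in> istrips \<mu>"
      and nz: "lk (hlr n \<kappa>) (w - xx n (of_int (sum_mset \<mu> - sum_mset \<kappa>))) \<noteq> 0"
      unfolding lookup_hlr_Suc by (metis (no_types, lifting) mult_zero_right sum.neutral)
    define k where "k = sum_mset \<mu> - sum_mset \<kappa>"
    define u where "u = w - xx n (of_int k)"
    have size: "size \<kappa> = n" using \<kappa> Suc.prems by (simp add: istrips_def)
    have uZ: "u \<in> int_expos n" using nz hlr_int_laurent[of n \<kappa>] by (auto simp: int_laurent_def in_keys_iff u_def k_def)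
    note IH = Suc.IH[OF size nz, folded k_def, folded u_def]
    have kZ: "xx n (of_int k) \<in> int_expos (Suc n)" by (rule int_expos_single) auto
    have "w = u + xx n (of_int k)" by (simp add: u_def)
    hence ip: "ipart w i = ipart u i + (if i = n then k else 0)" for i
      using ipart_add[OF int_expos_mono[OF uZ, of "Suc n"] kZ] by (simp add: ipart_single)
    have un: "ipart u n = 0" using uZ by (simp add: int_expos_def ipart_def)
    have le: "desc_list \<kappa> ! i \<le> desc_list \<mu> ! i" if "i < n" for i
      using below_nth[of \<kappa> \<mu> i] \<kappa> istrips_subset_below size that by auto
    have lt: "(\<Sum>i<k'. ipart w i) = (\<Sum>i<k'. ipart u i)" if "k' \<le> n" for k'
      using that by (intro sum.cong) (auto simp: ip)
    have total: "(\<Sum>i<Suc n. ipart w i) = sum_mset \<mu>"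
      using IH lt[of n] by (simp add: ip un k_def)
    moreover have "(\<Sum>i<k'. ipart w i) \<le> (\<Sum>i<k'. desc_list \<mu> ! i)" if "k' \<le> Suc n" for k'
    proof (cases "k' = Suc n")
      case True
      thus ?thesis using total sum_desc_list[of \<mu>] Suc.prems by simp
    next
      case False
      hence k': "k' \<le> n" using that by simp
      have "(\<Sum>i<k'. ipart u i) \<le> (\<Sum>i<k'. desc_list \<kappa> ! i)" using IH k' by blast
      also have "\<dots> \<le> (\<Sum>i<k'. desc_list \<mu> ! i)" using k' le by (intro sum_mono) auto
      finally show ?thesis using lt[OF k'] by simp
    qed
    moreover have "l \<le> ipart w i" if "i < Suc n" "\<forall>b\<in>#\<mu>. l \<le> b" for i l
    proof (cases "i = n")
      case True
      have "desc_list \<mu> ! n \<in># \<mu>" using Suc.prems nth_mem[of n "desc_list \<mu>"] by (metis length_desc_list lessI mset_desc_list set_mset_mset)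
      \<comment> \<open>The last exponent is the sum of \<mu> minus that of \<kappa>, hence at least
        the smallest part of \<mu>.\<close>
      moreover have "sum_mset \<kappa> \<le> (\<Sum>i<n. desc_list \<mu> ! i)"
        unfolding sum_desc_list[symmetric] size using le by (intro sum_mono) auto
      ultimately have "l \<le> k" using that sum_desc_list[of \<mu>] Suc.prems by (fastforce simp: k_def)
      thus ?thesis using True by (simp add: ip un)
    next
      case False
      obtain l' h where h: "\<And>b. b \<in># \<mu> \<Longrightarrow> b < h" using mset_bounds[of \<mu>] by metis
      have "\<forall>b\<in>#\<kappa>. l \<le> b" using istrips_bounds[OF \<kappa>, of l h] h that by blast
      thus ?thesis using IH that False by (simp add: ip)
    qed
    ultimately show ?case by blast
  qed simp
  thus "k \<le> n \<Longrightarrow> (\<Sum>i<k. ipart w i) \<le> (\<Sum>i<k. desc_list \<mu> ! i)" "(\<Sum>i<n. ipart w i) = sum_mset \<mu>"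
    "\<forall>b\<in>#\<mu>. l \<le> b \<Longrightarrow> i < n \<Longrightarrow> l \<le> ipart w i" by blast+
qed

text \<open>The product of the T-factorials of the multiplicities, that is, the Poincare polynomial
  of the stabilizer of \<mu>, and the reciprocal of the prefactor in the theorem.\<close>

definition hl_lead :: "int multiset \<Rightarrow> rat fls" where
  "hl_lead \<mu> = (\<Prod>j\<in>set_mset \<mu>. tphi T (count \<mu> j)) / (1 - T) ^ size \<mu>"

lemma hl_lead_nonzero [simp]: "hl_lead \<mu> \<noteq> 0"
  by (simp add: hl_lead_def)

lemma hl_lead_add: "hl_lead (add_mset m \<kappa>) = tnum (Suc (count \<kappa> m)) * hl_lead \<kappa>"
proof -
  define P where "P = (\<Prod>j\<in>set_mset \<kappa> - {m}. tphi T (count \<kappa> j))"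
  have 1: "(\<Prod>j\<in>set_mset (add_mset m \<kappa>). tphi T (count (add_mset m \<kappa>) j)) = tphi T (Suc (count \<kappa> m)) * P"
  proof -
    have "(\<Prod>j\<in>set_mset \<kappa> - {m}. tphi T (count (add_mset m \<kappa>) j)) = P"
      unfolding P_def by (intro prod.cong) auto
    thus ?thesis by (subst prod.remove[of _ m]) auto
  qed
  have 2: "(\<Prod>j\<in>set_mset \<kappa>. tphi T (count \<kappa> j)) = tphi T (count \<kappa> m) * P"
  proof (cases "m \<in># \<kappa>")
    case True
    thus ?thesis unfolding P_def by (subst prod.remove[of _ m]) auto
  next
    case False
    thus ?thesis by (simp add: P_def not_in_iff)
  qed
  show ?thesis unfolding hl_lead_def 1 2 by (simp add: tphi_Suc)
qed

lemma branch_weight_remove_min: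
  assumes "\<mu> = add_mset m \<kappa>" "\<And>b. b \<in># \<kappa> \<Longrightarrow> m \<le> b"
  shows "branch_weight \<mu> \<kappa> = tnum (count \<mu> m)"
proof -
  have "branch_weight \<mu> \<kappa> = (\<Prod>i\<in>{m}. branch (column \<mu> (i + 1) - column \<kappa> (i + 1)) (column \<mu> i - column \<kappa> i) (count \<mu> i))"
    unfolding branch_weight_def Let_def by (rule prod_support) (auto simp: assms(1) branch_def)
  thus ?thesis by (simp add: assms(1) branch_def)
qed

text \<open>Only the strip that removes the smallest part contributes: the last exponent fixes the
  sum of \<kappa>, and together with the entrywise bound this forces \<kappa> to consist of the
  first n parts.\<close>

lemma hlr_leading: "size \<mu> = n \<Longrightarrow> lk (hlr n \<mu>) (xl (desc_list \<mu>)) = hl_lead \<mu>"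
proof (induction n arbitrary: \<mu>)
  case 0
  thus ?case by (simp add: xl_def hl_lead_def)
next
  case (Suc n)
  define as where "as = desc_list \<mu>"
  define m where "m = as ! n"
  define \<kappa>0 where "\<kappa>0 = mset (take n as)"
  have len: "length as = Suc n" using Suc.prems by (simp add: as_def)
  have as: "as = take n as @ [m]" using len by (simp add: m_def take_Suc_conv_app_nth[symmetric])
  have sorted: "sorted_wrt (\<ge>) (take n as)" unfolding as_def by (rule sorted_wrt_take[OF sorted_desc_list])
  have dl0: "desc_list \<kappa>0 = take n as" unfolding \<kappa>0_def by (rule desc_list_unique[OF sorted])
  have \<mu>: "\<mu> = add_mset m \<kappa>0"
  proof -
    have "\<mu> = mset (take n as @ [m])" using as by (metis as_def mset_desc_list)
    thus ?thesis by (simp add: \<kappa>0_def)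
  qed
  have min: "m \<le> b" if "b \<in># \<kappa>0" for b
  proof -
    have "sorted_wrt (\<ge>) (take n as @ [m])" using sorted_desc_list[of \<mu>] as by (metis as_def)
    thus ?thesis using that by (auto simp: sorted_wrt_append \<kappa>0_def)
  qed
  have \<kappa>0: "\<kappa>0 \<in> istrips \<mu>" by (auto simp: istrips_def \<mu>)
  have other: "lk (hlr n \<kappa>) (xl as - xx n (of_int (sum_mset \<mu> - sum_mset \<kappa>))) = 0"
    if \<kappa>: "\<kappa> \<in> istrips \<mu>" "\<kappa> \<noteq> \<kappa>0" for \<kappa>
  proof (rule ccontr)
    define k where "k = sum_mset \<mu> - sum_mset \<kappa>"
    assume "\<not> ?thesis"
    hence "xl as - xx n (of_int k) \<in> int_expos n" using hlr_int_laurent[of n \<kappa>] by (auto simp: int_laurent_def in_keys_iff k_def)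
    hence "Poly_Mapping.lookup (xl as - xx n (of_int k)) n = 0" by (simp add: int_expos_def)
    hence k: "k = m" using len by (simp add: lookup_minus lookup_xl m_def)
    have size: "size \<kappa> = n" using \<kappa> Suc.prems by (simp add: istrips_def)
    have le: "desc_list \<kappa> ! i \<le> as ! i" if "i < n" for i
      using below_nth[of \<kappa> \<mu> i] \<kappa> istrips_subset_below size that by (auto simp: as_def)
    have "(\<Sum>i<n. as ! i - desc_list \<kappa> ! i) = 0"
      using sum_desc_list[of \<mu>] sum_desc_list[of \<kappa>] Suc.prems size k by (simp add: sum_subtractf k_def as_def m_def)
    hence "as ! i - desc_list \<kappa> ! i = 0" if "i < n" for i
      using sum_nonneg_eq_0_iff[of "{..<n}" "\<lambda>i. as ! i - desc_list \<kappa> ! i"] le that by auto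
    hence "desc_list \<kappa> = take n as" using size len by (intro nth_equalityI) auto
    hence "\<kappa> = \<kappa>0" by (metis \<kappa>0_def mset_desc_list)
    thus False using \<kappa> by simp
  qed
  have "lk (hlr (Suc n) \<mu>) (xl as) = (\<Sum>\<kappa>\<in>{\<kappa>0}. branch_weight \<mu> \<kappa> * lk (hlr n \<kappa>) (xl as - xx n (of_int (sum_mset \<mu> - sum_mset \<kappa>))))"
    unfolding lookup_hlr_Suc by (rule sum.mono_neutral_right) (use \<kappa>0 other in auto)
  moreover have "xl as - xx n (of_int (sum_mset \<mu> - sum_mset \<kappa>0)) = xl (desc_list \<kappa>0)"
    unfolding dl0 using len by (intro poly_mapping_eqI) (auto simp: lookup_minus lookup_xl lookup_single when_def \<mu> m_def)
  ultimately have "lk (hlr (Suc n) \<mu>) (xl as) = branch_weight \<mu> \<kappa>0 * lk (hlr n \<kappa>0) (xl (desc_list \<kappa>0))"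
    by simp
  also have "\<dots> = hl_lead \<mu>"
    using Suc.IH[of \<kappa>0] Suc.prems branch_weight_remove_min[OF \<mu> min] by (simp add: \<mu> hl_lead_add)
  finally show ?case by (simp add: as_def)
qed

section \<open>Coefficient functions of bounded valuation\<close>

text \<open>The lower bound is uniform in the exponent; this is what excludes nontrivial kernels of
  the factors 1 - T x^a.\<close>

definition bdd :: "(expo \<Rightarrow> rat fls) \<Rightarrow> bool" where
  "bdd \<phi> \<longleftrightarrow> (\<exists>N. \<forall>w. \<phi> w \<noteq> 0 \<longrightarrow> N \<le> fls_subdegree (\<phi> w))"

lemma bdd_diff: "bdd \<phi> \<Longrightarrow> bdd \<psi> \<Longrightarrow> bdd (\<lambda>w. \<phi> w - \<psi> w)"
proof -
  assume "bdd \<phi>" "bdd \<psi>"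
  then obtain M N where *: "\<And>w. \<phi> w \<noteq> 0 \<Longrightarrow> M \<le> fls_subdegree (\<phi> w)" "\<And>w. \<psi> w \<noteq> 0 \<Longrightarrow> N \<le> fls_subdegree (\<psi> w)"
    by (auto simp: bdd_def)
  have "min M N \<le> fls_subdegree (\<phi> w - \<psi> w)" if "\<phi> w - \<psi> w \<noteq> 0" for w
  proof (cases "\<phi> w = 0 \<or> \<psi> w = 0")
    case True
    thus ?thesis using *[of w] that by (auto simp: fls_uminus_subdegree min_le_iff_disj)
  next
    case False
    have "min (fls_subdegree (\<phi> w)) (fls_subdegree (\<psi> w)) \<le> fls_subdegree (\<phi> w - \<psi> w)"
      by (rule fls_subdegree_minus) (use that in simp)
    thus ?thesis using *[of w] False by linarith
  qed
  thus ?thesis by (auto simp: bdd_def)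
qed

lemma bdd_scale: "bdd \<phi> \<Longrightarrow> bdd (\<lambda>w. c * \<phi> (f w))"
proof -
  assume "bdd \<phi>"
  then obtain N where N: "\<And>w. \<phi> w \<noteq> 0 \<Longrightarrow> N \<le> fls_subdegree (\<phi> w)" by (auto simp: bdd_def)
  have "fls_subdegree c + N \<le> fls_subdegree (c * \<phi> (f w))" if "c * \<phi> (f w) \<noteq> 0" for w
    using that N[of "f w"] by simp
  thus ?thesis unfolding bdd_def by blast
qed

lemma bdd_0 [simp]: "bdd (\<lambda>_. 0)"
  by (simp add: bdd_def)

lemma bdd_add: "bdd \<phi> \<Longrightarrow> bdd \<psi> \<Longrightarrow> bdd (\<lambda>w. \<phi> w + \<psi> w)"
  using bdd_diff[of \<phi> "\<lambda>w. - 1 * \<psi> w"] bdd_scale[of \<psi> "- 1" "\<lambda>w. w"] by simp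

lemma bdd_sum: "(\<And>i. i \<in> I \<Longrightarrow> bdd (\<phi> i)) \<Longrightarrow> bdd (\<lambda>w. \<Sum>i\<in>I. \<phi> i w)"
  by (induction I rule: infinite_finite_induct) (auto intro: bdd_add)

lemma bdd_act: "bdd \<phi> \<Longrightarrow> bdd (act P \<phi>)"
  unfolding act_def by (intro bdd_sum bdd_scale)

lemma T_subdegree: "fls_subdegree (T ^ k) = 2 * int k"
proof (induction k)
  case (Suc k)
  have "fls_subdegree T = 2"
    unfolding T_def tK_def power2_eq_square by (subst fls_subdegree_mult) simp_all
  thus ?case using Suc by simp
qed simp

text \<open>A kernel element satisfies \<phi> w = T \<phi> (w - a), so \<phi> w is divisible by
  every power of T up to a value of bounded valuation. Without the bound, T^k at k a for all
  integers k would be a counterexample when a \<noteq> 0.\<close>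

lemma act_root_inj:
  assumes "bdd \<phi>" "\<And>w. act (1 - cm a T) \<phi> w = 0"
  shows "\<phi> w = 0"
proof (rule ccontr)
  assume nz: "\<phi> w \<noteq> 0"
  from assms(1) obtain N where N: "\<And>w. \<phi> w \<noteq> 0 \<Longrightarrow> N \<le> fls_subdegree (\<phi> w)" by (auto simp: bdd_def)
  have step: "\<phi> w = T * \<phi> (w - a)" for w using assms(2)[of w] by (simp add: act_diff)
  have "\<exists>w'. \<phi> w = T ^ k * \<phi> w'" for k
  proof (induction k)
    case (Suc k)
    then obtain w' where "\<phi> w = T ^ k * \<phi> w'" by blast
    hence "\<phi> w = T ^ Suc k * \<phi> (w' - a)" using step[of w'] by simp
    thus ?case by blast
  qed (auto intro: exI[of _ w])
  then obtain w' where w': "\<phi> w = T ^ nat (fls_subdegree (\<phi> w) - N + 1) * \<phi> w'" by blast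
  hence "\<phi> w' \<noteq> 0" using nz by auto
  hence "fls_subdegree (\<phi> w) = 2 * int (nat (fls_subdegree (\<phi> w) - N + 1)) + fls_subdegree (\<phi> w')"
    by (subst w', subst fls_subdegree_mult) (simp_all add: T_subdegree)
  thus False using N[OF nz] N[OF \<open>\<phi> w' \<noteq> 0\<close>] by simp
qed

lemma act_fun_diff: "act P (\<lambda>w. \<phi> w - \<psi> w) w = act P \<phi> w - act P \<psi> w"
  by (simp add: act_def right_diff_distrib sum_subtractf)

lemma act_roots_inj:
  assumes "finite I" "bdd \<phi>" "bdd \<psi>" "act (\<Prod>i\<in>I. 1 - cm (a i) T) \<phi> = act (\<Prod>i\<in>I. 1 - cm (a i) T) \<psi>"
  shows "\<phi> = \<psi>"
  using assms
proof (induction I arbitrary: \<phi> \<psi> rule: finite_induct)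
  case (insert i I)
  let ?D = "\<Prod>i\<in>I. 1 - cm (a i) T"
  have eq: "act (1 - cm (a i) T) (act ?D \<phi>) = act (1 - cm (a i) T) (act ?D \<psi>)"
    using insert by (simp add: act_mult[symmetric])
  have bd: "bdd (\<lambda>w. act ?D \<phi> w - act ?D \<psi> w)"
    by (intro bdd_diff bdd_act insert.prems)
  have "act ?D \<phi> w - act ?D \<psi> w = 0" for w
  proof (rule act_root_inj[of "\<lambda>w. act ?D \<phi> w - act ?D \<psi> w" "a i"])
    fix w
    have "act (1 - cm (a i) T) (act ?D \<phi>) w = act (1 - cm (a i) T) (act ?D \<psi>) w" using eq by simp
    thus "act (1 - cm (a i) T) (\<lambda>w. act ?D \<phi> w - act ?D \<psi> w) w = 0"
      unfolding act_fun_diff by (simp only: diff_self)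
  qed (rule bd)
  hence "act ?D \<phi> = act ?D \<psi>" by (intro ext) simp
  thus ?case by (rule insert.IH[OF insert.prems(1,2)])
qed simp

section \<open>Orthogonality of Hall--Littlewood polynomials\<close>

text \<open>Dominance of exponents is comparison of all these partial sums.\<close>

definition psum :: "nat \<Rightarrow> expo \<Rightarrow> real" where
  "psum k w = (\<Sum>i<k. Re (Poly_Mapping.lookup w i))"

lemma psum_add: "psum k (u + v) = psum k u + psum k v"
  and psum_diff: "psum k (u - v) = psum k u - psum k v"
  by (simp_all add: psum_def lookup_add lookup_minus sum.distrib sum_subtractf)

lemma psum_0 [simp]: "psum k 0 = 0"
  by (simp add: psum_def)

lemma psum_xx: "psum k (xx i 1) = (if i < k then 1 else 0)"
  by (simp add: psum_def lookup_single when_def if_distrib[of Re] cong: if_cong)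

lemma psum_root: "i < j \<Longrightarrow> 0 \<le> psum k (al i j)"
  by (simp add: psum_diff psum_xx)

definition cone_poly :: "'a::comm_ring_1 cpoly \<Rightarrow> bool" where
  "cone_poly P \<longleftrightarrow> (\<forall>v\<in>kys P. \<forall>k. 0 \<le> psum k v)"

lemma cone_poly_1 [simp]: "cone_poly 1"
  by (cases "(0::'a) = 1") (auto simp: cone_poly_def in_keys_iff lookup_one when_def)

lemma cone_poly_mult: "cone_poly P \<Longrightarrow> cone_poly Q \<Longrightarrow> cone_poly (P * Q)"
  unfolding cone_poly_def using keys_mult[of P Q] by (fastforce simp: psum_add)

lemma cone_poly_add: "cone_poly P \<Longrightarrow> cone_poly Q \<Longrightarrow> cone_poly (P + Q)"
  unfolding cone_poly_def using Poly_Mapping.keys_add[of P Q] by blast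

lemma cone_poly_sum: "(\<And>i. i \<in> I \<Longrightarrow> cone_poly (P i)) \<Longrightarrow> cone_poly (\<Sum>i\<in>I. P i)"
  by (induction I rule: infinite_finite_induct) (auto intro: cone_poly_add simp: cone_poly_def[of 0])

lemma cone_poly_prod: "(\<And>i. i \<in> I \<Longrightarrow> cone_poly (P i)) \<Longrightarrow> cone_poly (\<Prod>i\<in>I. P i)"
  by (induction I rule: infinite_finite_induct) (auto intro: cone_poly_mult)

lemma cone_poly_cm: "(\<And>k. 0 \<le> psum k v) \<Longrightarrow> cone_poly (cm v c)"
  by (simp add: cone_poly_def)

lemma cone_poly_root: "i < j \<Longrightarrow> cone_poly (1 - cm (al i j) c)"
  using cone_poly_add[of 1 "cm (al i j) (- c)"] cone_poly_cm[of "al i j" "- c"] psum_root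
  by (simp add: single_uminus)

lemma act_cone:
  assumes "cone_poly P" "\<And>w k. \<psi> w \<noteq> 0 \<Longrightarrow> 0 \<le> psum k w" "act P \<psi> w \<noteq> 0"
  shows "0 \<le> psum k w"
proof -
  from assms(3) obtain v where v: "v \<in> kys P" "\<psi> (w - v) \<noteq> 0"
    unfolding act_def by (metis (no_types, lifting) mult_zero_right sum.neutral)
  hence "0 \<le> psum k v" "0 \<le> psum k (w - v)" using assms by (auto simp: cone_poly_def)
  thus ?thesis by (simp add: psum_diff)
qed

lemma act_permute:
  assumes \<sigma>: "\<sigma> permutes A" and U: "\<And>v. lk U (pm \<sigma> v) = lk U v"
  shows "act U (\<lambda>w. \<eta> (pm \<sigma> w)) w = act U \<eta> (pm \<sigma> w)"
  unfolding act_def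
  by (rule sum.reindex_bij_witness[where i = "pm (inv_into UNIV \<sigma>)" and j = "pm \<sigma>"])
     (use U[of "pm (inv_into UNIV \<sigma>) _"] in \<open>auto simp: pm_inverse[OF \<sigma>] in_keys_iff U pm_diff[OF \<sigma>]\<close>)

lemma roots_symmetric:
  assumes \<sigma>: "\<sigma> permutes {..<n}"
  shows "lk (\<Prod>(i, j)\<in>allr n. 1 - cm (al i j) (c :: rat fls)) (pm \<sigma> v) = lk (\<Prod>(i, j)\<in>allr n. 1 - cm (al i j) c) v"
proof (rule symmetric_lookup[OF \<sigma>])
  show "(\<Prod>(i, j)\<in>allr n. 1 - cm (al i j) c) \<in> int_laurent n"
    by (rule int_laurent_prod) (auto intro: root_int_laurent)
  fix x assume x: "good n x"
  have ev: "ev n x (\<Prod>(i, j)\<in>allr n. 1 - cm (al i j) c) = (\<Prod>(i, j)\<in>allr n. 1 - c * x i / x j)" if "good n x" for x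
    by (subst ev_prod[OF that, of _ _ n]) (auto intro!: root_int_laurent prod.cong simp: ev_root[OF that])
  show "ev n (x \<circ> \<sigma>) (\<Prod>(i, j)\<in>allr n. 1 - cm (al i j) c) = ev n x (\<Prod>(i, j)\<in>allr n. 1 - cm (al i j) c)"
    unfolding ev[OF x] ev[OF good_permute[OF \<sigma> x]] comp_apply
    by (rule allr_permute[OF \<sigma>, of "\<lambda>i j. 1 - c * x i / x j"])
qed

text \<open>After multiplication by the weight function the symmetrization sum becomes a sum over
  permutations of series that start at \<open>x\<^sup>\<mu>\<close> and go up in the dominance order.\<close>

theorem hlr_weight_support:
  assumes \<mu>: "size \<mu> = n"
    and \<Delta>: "bdd \<Delta>" "act (\<Prod>(i, j)\<in>allr n. 1 - cm (al i j) T) \<Delta> = lk (\<Prod>(i, j)\<in>allr n. 1 - cm (al i j) 1)"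
    and \<psi>: "bdd \<psi>" "act (\<Prod>(i, j)\<in>posr n. 1 - cm (al i j) T) \<psi> = (\<lambda>w. if w = 0 then 1 else 0)"
      "\<And>w k. \<psi> w \<noteq> 0 \<Longrightarrow> 0 \<le> psum k w"
    and nz: "act (hlr n \<mu>) \<Delta> w \<noteq> 0"
  obtains \<sigma> where "\<sigma> permutes {..<n}" "\<And>k. psum k (xl (desc_list \<mu>)) \<le> psum k (pm \<sigma> w)"
proof -
  define U where "U = (\<Prod>(i, j)\<in>allr n. 1 - cm (al i j) T)"
  define W where "W = (\<Prod>(i, j)\<in>posr n. 1 - cm (al i j) (1 :: rat fls))"
  define D where "D = (\<Prod>(i, j)\<in>posr n. 1 - cm (al j i) T)"
  \<comment> \<open>One summand of the symmetrization divided by U: the factors of U with i > j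
    cancel against \<open>N_poly\<close>, and those with i < j are inverted by \<psi>.\<close>
  define \<eta> where "\<eta> = act (cm (xl (desc_list \<mu>)) 1 * W) \<psi>"
  have U: "U = D * (\<Prod>(i, j)\<in>posr n. 1 - cm (al i j) T)"
    unfolding U_def D_def allr_split by (simp add: prod.distrib case_prod_beta mult.commute)
  have N: "N_poly (desc_list \<mu>) = cm (xl (desc_list \<mu>)) 1 * W * D"
    unfolding N_poly_def W_def D_def using \<mu> by (simp add: prod.distrib case_prod_beta mult.assoc)
  have "act U \<eta> = act (cm (xl (desc_list \<mu>)) 1 * W * D) (act (\<Prod>(i, j)\<in>posr n. 1 - cm (al i j) T) \<psi>)"
    unfolding \<eta>_def U by (simp only: act_mult[symmetric] mult_ac)
  hence U\<eta>: "act U \<eta> = lk (N_poly (desc_list \<mu>))" unfolding \<psi>(2) act_delta N .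
  have b\<eta>: "bdd \<eta>" unfolding \<eta>_def using \<psi>(1) by (rule bdd_act)
  have U': "U = (\<Prod>p\<in>allr n. 1 - cm (case p of (i, j) \<Rightarrow> al i j) T)"
    unfolding U_def by (rule prod.cong) auto
  \<comment> \<open>Both sides have bounded valuation, so it suffices to compare them after
    multiplication by U, where the left side becomes the Weyl-type sum.\<close>
  have "act (hlr n \<mu>) \<Delta> = (\<lambda>w. \<Sum>\<sigma> | \<sigma> permutes {..<n}. \<eta> (pm \<sigma> w))"
  proof (rule act_roots_inj[of "allr n" _ _ "\<lambda>(i, j). al i j", folded U'])
    show "bdd (act (hlr n \<mu>) \<Delta>)" using \<Delta>(1) by (rule bdd_act)
    show "bdd (\<lambda>w. \<Sum>\<sigma> | \<sigma> permutes {..<n}. \<eta> (pm \<sigma> w))"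
      using bdd_scale[OF b\<eta>, of 1] by (intro bdd_sum) simp
    have "act U (act (hlr n \<mu>) \<Delta>) = act (hlr n \<mu>) (act U \<Delta>)"
      by (simp only: act_mult[symmetric] mult.commute)
    also have "\<dots> = lk (\<Sum>\<sigma> | \<sigma> permutes {..<n}. permute_vars \<sigma> (N_poly (desc_list \<mu>)))"
      unfolding U_def \<Delta>(2) by (simp only: lookup_mult_act[symmetric] hlr_times_weyl[OF \<mu>])
    also have "\<dots> = act U (\<lambda>w. \<Sum>\<sigma> | \<sigma> permutes {..<n}. \<eta> (pm \<sigma> w))"
    proof
      fix w
      have "lk (permute_vars \<sigma> (N_poly (desc_list \<mu>))) w = act U (\<lambda>w. \<eta> (pm \<sigma> w)) w" if \<sigma>: "\<sigma> permutes {..<n}" for \<sigma>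
        unfolding lookup_permute_vars[OF \<sigma>] using act_permute[OF \<sigma>, of U \<eta> w] roots_symmetric[OF \<sigma>, of T] U\<eta>
        by (simp add: U_def)
      thus "lk (\<Sum>\<sigma> | \<sigma> permutes {..<n}. permute_vars \<sigma> (N_poly (desc_list \<mu>))) w = act U (\<lambda>w. \<Sum>\<sigma> | \<sigma> permutes {..<n}. \<eta> (pm \<sigma> w)) w"
        using act_linear[of U "\<lambda>_. 1" "\<lambda>\<sigma> w. \<eta> (pm \<sigma> w)" "{\<sigma>. \<sigma> permutes {..<n}}" w] by (simp add: lookup_sum)
    qed
    finally show "act U (act (hlr n \<mu>) \<Delta>) = act U (\<lambda>w. \<Sum>\<sigma> | \<sigma> permutes {..<n}. \<eta> (pm \<sigma> w))" .
  qed simp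
  hence "(\<Sum>\<sigma> | \<sigma> permutes {..<n}. \<eta> (pm \<sigma> w)) \<noteq> 0" using nz by simp
  then obtain \<sigma> where \<sigma>: "\<sigma> permutes {..<n}" "\<eta> (pm \<sigma> w) \<noteq> 0"
    by (rule sum.not_neutral_contains_not_neutral) simp
  have "psum k (xl (desc_list \<mu>)) \<le> psum k (pm \<sigma> w)" for k
  proof -
    have a: "act W \<psi> (pm \<sigma> w - xl (desc_list \<mu>)) \<noteq> 0"
      using \<sigma>(2) by (simp add: \<eta>_def act_mult)
    have c: "cone_poly W" unfolding W_def by (rule cone_poly_prod) (auto intro: cone_poly_root)
    have "0 \<le> psum k (pm \<sigma> w - xl (desc_list \<mu>))" by (rule act_cone[OF c _ a]) (rule \<psi>(3))
    thus ?thesis by (simp add: psum_diff)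
  qed
  thus ?thesis using that \<sigma> by blast
qed

section \<open>Chains\<close>

lemma chains_Suc:
  assumes n: "n \<ge> 1" and lam: "lam \<in> weights (Suc n)"
  shows "chains (Suc n) lam = (\<Union>mu\<in>{mu \<in> weights n. weight_subset mu lam}. (#) lam ` chains n mu)"
proof (intro equalityI subsetI)
  fix S assume S: "S \<in> chains (Suc n) lam"
  then obtain S' where S': "S = lam # S'" "length S' = n"
    by (cases S) (auto simp: chains_def)
  have w: "S' ! i \<in> weights (n - i)" if "i < n" for i
    using S that unfolding chains_def S' by (auto dest!: spec[of _ "Suc i"])
  have s: "weight_subset (S' ! Suc i) (S' ! i)" if "Suc i < n" for i
    using S that unfolding chains_def S' by (auto dest!: spec[of _ "Suc i"])
  have "weight_subset (S' ! 0) lam"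
    using S n unfolding chains_def S' by (auto dest!: spec[of _ 0])
  moreover have "S' \<in> chains n (S' ! 0)" using w s S' by (simp add: chains_def)
  moreover have "S' ! 0 \<in> weights n" using w[of 0] n by simp
  ultimately show "S \<in> (\<Union>mu\<in>{mu \<in> weights n. weight_subset mu lam}. (#) lam ` chains n mu)"
    using S' by blast
next
  fix S assume "S \<in> (\<Union>mu\<in>{mu \<in> weights n. weight_subset mu lam}. (#) lam ` chains n mu)"
  then obtain mu S' where *: "weight_subset mu lam" "S' \<in> chains n mu" "S = lam # S'" by auto
  show "S \<in> chains (Suc n) lam"
    unfolding chains_def using * lam by (auto simp: chains_def nth_Cons split: nat.splits)
qed

lemma sk_chain_Cons:
  assumes "S \<in> chains n mu" "n \<ge> 1"
  shows "sk_chain t (lam # S) = sk_weight t lam mu * sk_chain t S"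
proof -
  have S: "length S = n" "S ! 0 = mu" using assms by (auto simp: chains_def)
  have "sk_chain t (lam # S) = sk_weight t lam mu * (\<Prod>i=Suc 1..<Suc n. sk_weight t ((lam # S) ! (i - 1)) ((lam # S) ! i))"
    unfolding sk_chain_def using S assms by (simp add: prod.atLeast_Suc_lessThan)
  also have "(\<Prod>i=Suc 1..<Suc n. sk_weight t ((lam # S) ! (i - 1)) ((lam # S) ! i)) = sk_chain t S"
    unfolding sk_chain_def prod.shift_bounds_Suc_ivl S by (rule prod.cong) (auto simp: nth_Cons split: nat.splits)
  finally show ?thesis .
qed

lemma length_wt: "length (wt S) = length S"
  by (simp add: wt_def Let_def)

text \<open>The weight is read from the short end of the chain, so a new longest member adds the
  exponent of the last variable.\<close>

lemma wt_Cons: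
  assumes "S \<in> chains n mu" "n \<ge> 1"
  shows "wt (lam # S) = wt S @ [sum_list lam - sum_list mu]"
proof (rule nth_equalityI)
  have S: "length S = n" "S ! 0 = mu" using assms by (auto simp: chains_def)
  show "length (wt (lam # S)) = length (wt S @ [sum_list lam - sum_list mu])" by (simp add: length_wt)
  fix k assume "k < length (wt (lam # S))"
  hence k: "k \<le> n" by (simp add: length_wt S)
  consider "k = 0" | "k = n" | "0 < k" "k < n" using k by linarith
  thus "wt (lam # S) ! k = (wt S @ [sum_list lam - sum_list mu]) ! k"
  proof cases
    case 1
    thus ?thesis using S assms by (simp add: wt_def Let_def nth_append nth_Cons' del: upt_Suc)
  next
    case 2
    thus ?thesis using S assms by (simp add: wt_def Let_def nth_append del: upt_Suc)
  next
    case 3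
    hence "n - k = Suc (n - 1 - k)" "Suc n - k = Suc (n - k)" by linarith+
    thus ?thesis using S 3 by (simp add: wt_def Let_def nth_append del: upt_Suc)
  qed
qed

lemma nth_snoc: "Poly_Mapping.nth (xs @ [c]) = Poly_Mapping.nth xs + xx (length xs) c"
  by (intro poly_mapping_eqI) (auto simp: lookup_add lookup_single when_def nth_default_def nth_append)

text \<open>The complex offset stays the same along a chain; only the integer multiset
  changes.\<close>

definition lamw :: "complex \<Rightarrow> int multiset \<Rightarrow> complex list" where
  "lamw a \<mu> = shift a (map of_int (desc_list \<mu>))"

lemma lamw_nth: "i < size \<mu> \<Longrightarrow> lamw a \<mu> ! i = of_int (desc_list \<mu> ! i) + a"
  by (simp add: lamw_def shift_def)

lemma length_lamw [simp]: "length (lamw a \<mu>) = size \<mu>"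
  by (simp add: lamw_def shift_def)

lemma sum_lamw: "sum_list (lamw a \<mu>) = of_int (sum_mset \<mu>) + of_nat (size \<mu>) * a"
  by (simp add: sum_list_sum_nth atLeast0LessThan lamw_nth sum.distrib sum_desc_list[symmetric])

lemma Nats_of_int: "(of_int k :: complex) \<in> \<nat> \<longleftrightarrow> 0 \<le> k"
  by (metis Nats_cases nonneg_int_cases of_int_of_nat_eq of_nat_in_Nats of_int_eq_iff of_nat_0_le_iff)

lemma lamw_weights: "size \<mu> = n \<Longrightarrow> lamw a \<mu> \<in> weights n"
  using desc_list_nth_mono[of _ _ \<mu>]
  by (auto simp: weights_def lamw_nth of_int_diff[symmetric] Nats_of_int simp del: of_int_diff)

lemma lamw_inj: "lamw a \<mu> = lamw a \<nu> \<Longrightarrow> \<mu> = \<nu>"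
proof -
  assume "lamw a \<mu> = lamw a \<nu>"
  hence "desc_list \<mu> = desc_list \<nu>"
    unfolding lamw_def shift_def by (auto simp: inj_map_eq_map inj_def comp_def dest!: map_injective[rotated])
  thus ?thesis by (metis mset_desc_list)
qed

lemma weight_subset_lamw:
  assumes "size \<mu> = Suc (size \<nu>)"
  shows "weight_subset (lamw a \<nu>) (lamw a \<mu>) \<longleftrightarrow> \<nu> \<in> below \<mu>"
  using assms column_le_iff_nth[of \<nu> \<mu>]
  by (auto simp: weight_subset_def lamw_nth below_def of_int_diff[symmetric] Nats_of_int simp del: of_int_diff)

lemma weights_chain:
  assumes "w \<in> weights n" "i \<le> j" "j < n"
  shows "w ! i - w ! j \<in> \<nat>"
  using assms(2,3)
proof (induction j rule: dec_induct)
  case (step k)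
  have "w ! k - w ! Suc k \<in> \<nat>" using assms(1) step by (auto simp: weights_def)
  moreover have "w ! i - w ! k \<in> \<nat>" using step by auto
  ultimately have "(w ! i - w ! k) + (w ! k - w ! Suc k) \<in> \<nat>" by (rule Nats_add[rotated])
  thus ?case by simp
qed simp

lemma weights_lamw:
  assumes "w \<in> weights n" "n \<ge> 1" "\<exists>i<n. w ! i - a \<in> \<int>"
  obtains \<mu> where "w = lamw a \<mu>" "size \<mu> = n"
proof -
  obtain i where i: "i < n" "w ! i - a \<in> \<int>" using assms by blast
  have len: "length w = n" using assms by (simp add: weights_def)
  have "w ! j - a \<in> \<int>" if "j < n" for j
  proof -
    have "w ! j - w ! i \<in> \<int>"
    proof (cases "i \<le> j")
      case True
      hence "- (w ! i - w ! j) \<in> \<int>" using weights_chain[OF assms(1), of i j] that by (metis Ints_minus Nats_subset_Ints subsetD)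
      thus ?thesis by simp
    next
      case False
      thus ?thesis using weights_chain[OF assms(1), of j i] i Nats_subset_Ints by auto
    qed
    hence "(w ! j - w ! i) + (w ! i - a) \<in> \<int>" using i by (intro Ints_add)
    thus ?thesis by simp
  qed
  hence q: "of_int \<lfloor>Re (w ! j - a)\<rfloor> = w ! j - a" if "j < n" for j
    using that by (metis Ints_cases Re_complex_of_real floor_of_int of_real_of_int_eq)
  define xs where "xs = map (\<lambda>z. \<lfloor>Re (z - a)\<rfloor>) w"
  have "sorted_wrt (\<ge>) xs"
  proof (rule sorted_wrt_iff_nth_less[THEN iffD2], intro allI impI)
    fix i j assume ij: "i < j" "j < length xs"
    hence "(of_int (xs ! i) - of_int (xs ! j) :: complex) = w ! i - w ! j"
      using q[of i] q[of j] len by (simp add: xs_def)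
    hence "(of_int (xs ! i - xs ! j) :: complex) \<in> \<nat>"
      using weights_chain[OF assms(1), of i j] ij len by (simp add: xs_def)
    thus "xs ! j \<le> xs ! i" by (simp only: Nats_of_int)
  qed
  hence "desc_list (mset xs) = xs" by (rule desc_list_unique)
  hence "lamw a (mset xs) = w"
    unfolding lamw_def shift_def using q len by (intro nth_equalityI) (auto simp: xs_def)
  thus ?thesis using that[of "mset xs"] len by (simp add: xs_def)
qed

text \<open>For n \<ge> 1 the first entry of an included weight differs from that of the larger
  weight by an integer, and the remaining entries differ from it by integers too. So the whole
  weight lies in the same coset of the integers.\<close>

lemma weights_below:
  assumes "size \<mu> = Suc n" "n \<ge> 1"
  shows "{mu \<in> weights n. weight_subset mu (lamw a \<mu>)} = lamw a ` below \<mu>"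
proof (intro equalityI subsetI)
  fix mu assume mu: "mu \<in> {mu \<in> weights n. weight_subset mu (lamw a \<mu>)}"
  hence len: "length mu = n" by (simp add: weights_def)
  have "lamw a \<mu> ! 0 - mu ! 0 \<in> \<nat>" using mu len assms by (auto simp: weight_subset_def)
  hence "of_int (desc_list \<mu> ! 0) + a - mu ! 0 \<in> \<int>" using assms Nats_subset_Ints by (auto simp: lamw_nth)
  hence "of_int (desc_list \<mu> ! 0) - (of_int (desc_list \<mu> ! 0) + a - mu ! 0) \<in> \<int>"
    by (rule Ints_diff[OF Ints_of_int])
  moreover have "of_int (desc_list \<mu> ! 0) - (of_int (desc_list \<mu> ! 0) + a - mu ! 0) = mu ! 0 - a" by simp
  ultimately have "mu ! 0 - a \<in> \<int>" by (simp only:)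
  then obtain \<nu> where \<nu>: "mu = lamw a \<nu>" "size \<nu> = n"
    using weights_lamw[of mu n a] mu assms by (metis (no_types, lifting) less_eq_Suc_le One_nat_def mem_Collect_eq)
  thus "mu \<in> lamw a ` below \<mu>" using mu weight_subset_lamw[of \<mu> \<nu> a] assms by auto
next
  fix mu assume "mu \<in> lamw a ` below \<mu>"
  then obtain \<nu> where "mu = lamw a \<nu>" "\<nu> \<in> below \<mu>" by auto
  thus "mu \<in> {mu \<in> weights n. weight_subset mu (lamw a \<mu>)}"
    using weight_subset_lamw[of \<mu> \<nu> a] lamw_weights[of \<nu> n a] assms by (auto simp: below_def)
qed

section \<open>The coefficients of the statement in terms of columns\<close>

lemma positive_shift_lamw:
  assumes "positive_shift m (lamw a \<mu>) l" "size \<mu> \<ge> 1"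
  obtains s where "a + m = of_int s" "map int l = map (\<lambda>j. j + s) (desc_list \<mu>)"
proof -
  from assms have *: "map of_nat l = map (\<lambda>z. of_int z + (a + m)) (desc_list \<mu>)"
    by (simp add: positive_shift_def lamw_def shift_def comp_def add.assoc)
  hence len: "length l = size \<mu>" by (metis length_desc_list length_map)
  have nth: "of_nat (l ! i) = of_int (desc_list \<mu> ! i) + (a + m)" if "i < size \<mu>" for i
    using arg_cong[OF *, of "\<lambda>xs. xs ! i"] that len by simp
  define s where "s = int (l ! 0) - desc_list \<mu> ! 0"
  have "of_int s = (of_nat (l ! 0) - of_int (desc_list \<mu> ! 0) :: complex)" by (simp add: s_def)
  hence s: "a + m = of_int s" using nth[of 0] assms by simp
  have "int (l ! i) = desc_list \<mu> ! i + s" if "i < size \<mu>" for i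
  proof -
    have "(of_int (int (l ! i)) :: complex) = of_int (desc_list \<mu> ! i + s)" using nth[OF that] s by simp
    thus ?thesis by (simp only: of_int_eq_iff)
  qed
  hence "map int l = map (\<lambda>j. j + s) (desc_list \<mu>)" using len by (intro nth_equalityI) auto
  thus ?thesis using that s by blast
qed

lemma positive_shift_exists:
  assumes "\<And>b. b \<in># \<mu> \<Longrightarrow> 0 < b + s"
  shows "positive_shift (of_int s - a) (lamw a \<mu>) (map (\<lambda>j. nat (j + s)) (desc_list \<mu>))"
proof -
  have pos: "0 < b + s" if "b \<in> set (desc_list \<mu>)" for b using assms that by (metis mset_desc_list set_mset_mset)
  have "sorted_wrt (\<ge>) (map (\<lambda>j. nat (j + s)) (desc_list \<mu>))"
    unfolding sorted_wrt_map by (rule sorted_wrt_mono_rel[OF _ sorted_desc_list]) auto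
  moreover have "of_nat (nat (b + s)) = of_int b + (a + (of_int s - a))" if "b \<in> set (desc_list \<mu>)" for b
    using pos[OF that] by (simp add: of_nat_nat)
  moreover have "0 \<notin> set (map (\<lambda>j. nat (j + s)) (desc_list \<mu>))" using pos by fastforce
  ultimately show ?thesis by (simp add: positive_shift_def lamw_def shift_def comp_def)
qed

lemma count_list_shift:
  assumes "map int l = map (\<lambda>j. j + s) xs"
  shows "count_list l j = count (mset xs) (int j - s)"
proof -
  have "count_list l j = count (mset (map int l)) (int j)" 
    by (induction l) auto
  also have "\<dots> = count (mset xs) (int j - s)"
    unfolding assms by (induction xs) auto
  finally show ?thesis .
qed

lemma conj_part_shift:
  assumes "map int l = map (\<lambda>j. j + s) xs"
  shows "conj_part l j = column (mset xs) (int j - s)"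
proof -
  have "conj_part l j = length (filter (\<lambda>b. j \<le> b) l)"
    by (simp add: conj_part_def length_filter_conv_card)
  also have "\<dots> = length (filter (\<lambda>b. int j \<le> b) (map int l))"
    by (simp add: filter_map comp_def)
  also have "\<dots> = column (mset xs) (int j - s)"
    unfolding assms by (simp add: column_def filter_map comp_def mset_filter[symmetric] diff_le_eq del: mset_filter)
  finally show ?thesis .
qed

text \<open>Any pair that the choice operator can return comes from one common integer shift s,
  because both weights are shifted by the same m. Columns are merely renumbered by s, and
  \<open>sk_mset_window\<close> shows that the value does not depend on it.\<close>

lemma sk_weight_lamw:
  assumes \<nu>: "\<nu> \<in> below \<mu>" and "size \<nu> \<ge> 1"
  shows "sk_weight T (lamw a \<mu>) (lamw a \<nu>) = sk_mset \<mu> \<nu>"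
proof -
  have size: "size \<mu> = size \<nu> + 1" and column: "\<And>j. column \<nu> j \<le> column \<mu> j" using \<nu> by (auto simp: below_def)
  obtain c1 where c1: "\<And>b. b \<in># \<mu> \<Longrightarrow> c1 \<le> b" using mset_bounds[of \<mu>] by metis
  obtain c2 where c2: "\<And>b. b \<in># \<nu> \<Longrightarrow> c2 \<le> b" using mset_bounds[of \<nu>] by metis
  define s0 where "s0 = 1 - min c1 c2"
  define R where "R = (\<lambda>(l, k). \<exists>m. positive_shift m (lamw a \<mu>) l \<and> positive_shift m (lamw a \<nu>) k)"
  have "0 < b + s0" if "b \<in># \<mu>" for b using c1[OF that] by (simp add: s0_def)
  moreover have "0 < b + s0" if "b \<in># \<nu>" for b using c2[OF that] by (simp add: s0_def)
  ultimately have "\<exists>p. R p"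
    unfolding R_def using positive_shift_exists[of \<mu> s0 a] positive_shift_exists[of \<nu> s0 a] by blast
  hence "R (SOME p. R p)" by (rule someI_ex)
  moreover obtain l k where lk1: "(SOME p. R p) = (l, k)" by (cases "SOME p. R p")
  ultimately obtain m where lk: "(SOME p. R p) = (l, k)" "positive_shift m (lamw a \<mu>) l" "positive_shift m (lamw a \<nu>) k"
    by (auto simp: R_def)
  have sk: "sk_weight T (lamw a \<mu>) (lamw a \<nu>) = sk_part T l k"
    unfolding sk_weight_def R_def[symmetric] lk(1) by simp
  obtain s where s: "a + m = of_int s" "map int l = map (\<lambda>j. j + s) (desc_list \<mu>)"
    using positive_shift_lamw[OF lk(2)] size by auto
  obtain s' where s': "a + m = of_int s'" "map int k = map (\<lambda>j. j + s') (desc_list \<nu>)"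
    using positive_shift_lamw[OF lk(3) assms(2)] by auto
  have "s' = s" using s(1) s'(1) by simp
  note cols = conj_part_shift[OF s(2)] conj_part_shift[OF s'(2)[unfolded \<open>s' = s\<close>]]
    count_list_shift[OF s'(2)[unfolded \<open>s' = s\<close>]]
  define N where "N = sum_list l"
  have \<mu>b: "1 - s \<le> b \<and> b < int N + 1 - s" if "b \<in># \<mu>" for b
  proof -
    have "b \<in> set (desc_list \<mu>)" using that by (metis mset_desc_list set_mset_mset)
    hence "b + s \<in> set (map int l)" unfolding s(2) by auto
    then obtain x where x: "x \<in> set l" "b + s = int x" by auto
    have "x \<noteq> 0" using x(1) lk(2) unfolding positive_shift_def by metis
    moreover have "x \<le> N" unfolding N_def using x by (simp add: member_le_sum_list)
    ultimately show ?thesis using x by linarith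
  qed
  have \<nu>b: "1 - s \<le> b \<and> b < int N + 1 - s" if "b \<in># \<nu>" for b
  proof
    have "b \<in> set (desc_list \<nu>)" using that by (metis mset_desc_list set_mset_mset)
    hence "b + s \<in> set (map int k)" unfolding s'(2) \<open>s' = s\<close> by auto
    then obtain x where x: "x \<in> set k" "b + s = int x" by auto
    have "x \<noteq> 0" using x(1) lk(3) unfolding positive_shift_def by metis
    thus "1 - s \<le> b" using x by linarith
    have "column \<mu> (int N + 1 - s) = 0" using \<mu>b by (intro column_eq_0) auto
    hence "column \<nu> (int N + 1 - s) = 0" using column[of "int N + 1 - s"] by simp
    thus "b < int N + 1 - s" using that by (force simp: column_def)
  qed
  have "sk_part T l k = (\<Prod>j\<in>{1..N}. T ^ ((column \<mu> (int j - s) - column \<nu> (int j - s)) choose 2)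
      * tb (column \<mu> (int j - s) - column \<nu> (int j - s + 1)) (count \<nu> (int j - s)))"
  proof -
    have "tbinom T (conj_part l j - conj_part k (j + 1)) (count_list k j)
        = tb (column \<mu> (int j - s) - column \<nu> (int j - s + 1)) (count \<nu> (int j - s))" for j
    proof -
      have e: "int (j + 1) - s = int j - s + 1" by simp
      have "count \<nu> (int j - s) \<le> column \<mu> (int j - s) - column \<nu> (int j - s + 1)"
        using column_count[of \<nu> "int j - s"] column[of "int j - s"] by simp
      thus ?thesis unfolding cols e mset_desc_list by (simp add: tb_def)
    qed
    thus ?thesis unfolding sk_part_def N_def[symmetric] by (simp add: power_sum prod.distrib cols)
  qed
  also have "\<dots> = (\<Prod>j\<in>{1 - s..<int N + 1 - s}. T ^ ((column \<mu> j - column \<nu> j) choose 2)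
      * tb (column \<mu> j - column \<nu> (j + 1)) (count \<nu> j))"
    by (rule prod.reindex_bij_witness[where i = "\<lambda>j. nat (j + s)" and j = "\<lambda>j. int j - s"]) auto
  also have "\<dots> = sk_mset \<mu> \<nu>"
    by (rule sk_mset_window[symmetric]) (use size \<mu>b \<nu>b in auto)
  finally show ?thesis unfolding sk .
qed

lemma b_weight_lamw:
  assumes "size \<mu> \<ge> 1"
  shows "b_weight T (lamw a \<mu>) = (\<Prod>j\<in>set_mset \<mu>. tphi T (count \<mu> j))"
proof -
  obtain c where c: "\<And>b. b \<in># \<mu> \<Longrightarrow> c \<le> b" using mset_bounds[of \<mu>] by metis
  have "0 < b + (1 - c)" if "b \<in># \<mu>" for b using c[OF that] by simp
  hence "\<exists>p m. positive_shift m (lamw a \<mu>) p" using positive_shift_exists[of \<mu> "1 - c" a] by blast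
  hence "\<exists>m. positive_shift m (lamw a \<mu>) (SOME p. \<exists>m. positive_shift m (lamw a \<mu>) p)" by (rule someI_ex)
  then obtain m p where p: "p = (SOME p. \<exists>m. positive_shift m (lamw a \<mu>) p)" "positive_shift m (lamw a \<mu>) p" by blast
  obtain s where s: "map int p = map (\<lambda>j. j + s) (desc_list \<mu>)"
    using positive_shift_lamw[OF p(2) assms] by metis
  have "b_weight T (lamw a \<mu>) = (\<Prod>i\<in>{1..sum_list p}. tphi T (count \<mu> (int i - s)))"
    unfolding b_weight_def p(1)[symmetric] b_part_def count_list_shift[OF s] mset_desc_list ..
  also have "\<dots> = (\<Prod>i\<in>{1 - s..<int (sum_list p) + 1 - s}. tphi T (count \<mu> i))"
    by (rule prod.reindex_bij_witness[where i = "\<lambda>j. nat (j + s)" and j = "\<lambda>j. int j - s"]) auto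
  also have "\<dots> = (\<Prod>j\<in>set_mset \<mu>. tphi T (count \<mu> j))"
  proof (rule prod.mono_neutral_right)
    show "set_mset \<mu> \<subseteq> {1 - s..<int (sum_list p) + 1 - s}"
    proof
      fix b assume "b \<in># \<mu>"
      hence "b \<in> set (desc_list \<mu>)" by (metis mset_desc_list set_mset_mset)
      hence "b + s \<in> set (map int p)" unfolding s by auto
      then obtain x where x: "x \<in> set p" "b + s = int x" by auto
      have "x \<noteq> 0" using x(1) p(2) unfolding positive_shift_def by metis
      moreover have "x \<le> sum_list p" using x by (simp add: member_le_sum_list)
      ultimately show "b \<in> {1 - s..<int (sum_list p) + 1 - s}" using x by auto
    qed
  qed (auto simp: not_in_iff)
  finally show ?thesis .
qed

text \<open>The parts are bounded above by those of \<mu>; a bound on the loss in size bounds them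
  below as well.\<close>

lemma finite_below: "finite {\<kappa> \<in> below \<mu>. sum_mset \<mu> - sum_mset \<kappa> \<le> K}"
proof -
  obtain h0 where h0: "\<And>b. b \<in># \<mu> \<Longrightarrow> b < h0" using mset_bounds[of \<mu>] by metis
  \<comment> \<open>Nonnegative, so that the number of the other parts may be replaced by the larger
    number N in the estimate.\<close>
  define h where "h = max h0 0"
  have h: "\<And>b. b \<in># \<mu> \<Longrightarrow> b < h" "0 \<le> h" using h0 by (force simp: h_def)+
  define N where "N = size \<mu>"
  define L where "L = sum_mset \<mu> - K - int N * h"
  have "{\<kappa> \<in> below \<mu>. sum_mset \<mu> - sum_mset \<kappa> \<le> K} \<subseteq> mset ` {xs. set xs \<subseteq> {L..h} \<and> length xs \<le> N}"
  proof
    fix \<kappa> assume \<kappa>: "\<kappa> \<in> {\<kappa> \<in> below \<mu>. sum_mset \<mu> - sum_mset \<kappa> \<le> K}"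
    have size: "size \<mu> = size \<kappa> + 1" using \<kappa> by (simp add: below_def)
    have le: "desc_list \<kappa> ! i \<le> h" if "i < size \<kappa>" for i
    proof -
      have "desc_list \<mu> ! i \<in># \<mu>" using that size nth_mem[of i "desc_list \<mu>"] set_mset_mset[of "desc_list \<mu>"] by (simp add: mset_desc_list)
      thus ?thesis using below_nth[of \<kappa> \<mu> i] \<kappa> that h(1) by force
    qed
    have ge: "L \<le> desc_list \<kappa> ! i" if i: "i < size \<kappa>" for i
    proof -
      have "sum_mset \<kappa> = desc_list \<kappa> ! i + (\<Sum>k\<in>{..<size \<kappa>} - {i}. desc_list \<kappa> ! k)"
        unfolding sum_desc_list[symmetric] using i by (intro sum.remove) auto
      also have "(\<Sum>k\<in>{..<size \<kappa>} - {i}. desc_list \<kappa> ! k) \<le> (\<Sum>k\<in>{..<size \<kappa>} - {i}. h)"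
        using le by (intro sum_mono) auto
      also have "\<dots> = int (size \<kappa> - 1) * h" using i by simp
      also have "\<dots> \<le> int N * h" using h(2) size by (intro mult_right_mono) (auto simp: N_def)
      finally show ?thesis using \<kappa> by (simp add: L_def)
    qed
    have "set (desc_list \<kappa>) \<subseteq> {L..h}" using le ge by (auto simp: set_conv_nth)
    thus "\<kappa> \<in> mset ` {xs. set xs \<subseteq> {L..h} \<and> length xs \<le> N}"
      using size by (intro image_eqI[of _ _ "desc_list \<kappa>"]) (auto simp: N_def)
  qed
  thus ?thesis by (rule finite_subset) (intro finite_imageI finite_lists_length_le, simp)
qed

definition chain_sum :: "nat \<Rightarrow> complex \<Rightarrow> int multiset \<Rightarrow> expo \<Rightarrow> rat fls" where
  "chain_sum n a \<mu> w = (\<Sum>S\<in>{S \<in> chains n (lamw a \<mu>). Poly_Mapping.nth (wt S) = w}. sk_chain T S)"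

definition below_at :: "complex \<Rightarrow> int multiset \<Rightarrow> complex \<Rightarrow> int multiset set" where
  "below_at a \<mu> c = {\<kappa> \<in> below \<mu>. of_int (sum_mset \<mu> - sum_mset \<kappa>) + a = c}"

lemma finite_below_at: "finite (below_at a \<mu> c)"
proof (cases "below_at a \<mu> c = {}")
  case False
  then obtain \<kappa>0 where "\<kappa>0 \<in> below_at a \<mu> c" by blast
  have "below_at a \<mu> c \<subseteq> {\<kappa> \<in> below \<mu>. sum_mset \<mu> - sum_mset \<kappa> \<le> sum_mset \<mu> - sum_mset \<kappa>0}"
  proof
    fix \<kappa> assume "\<kappa> \<in> below_at a \<mu> c"
    hence "(of_int (sum_mset \<mu> - sum_mset \<kappa>) :: complex) = of_int (sum_mset \<mu> - sum_mset \<kappa>0)"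
      using \<open>\<kappa>0 \<in> _\<close> by (auto simp: below_at_def algebra_simps)
    thus "\<kappa> \<in> {\<kappa> \<in> below \<mu>. sum_mset \<mu> - sum_mset \<kappa> \<le> sum_mset \<mu> - sum_mset \<kappa>0}"
      using \<open>\<kappa> \<in> _\<close> by (simp only: of_int_eq_iff) (simp add: below_at_def)
  qed
  thus ?thesis by (rule finite_subset) (rule finite_below)
qed simp

lemma nth_wt_outside: "S \<in> chains n lam \<Longrightarrow> i \<ge> n \<Longrightarrow> Poly_Mapping.lookup (Poly_Mapping.nth (wt S)) i = 0"
  by (simp add: chains_def nth_default_def length_wt)

text \<open>The exponent of the last variable prescribes the sum of the next member, which leaves
  finitely many choices. The offset occurs once in it, since consecutive sizes differ by
  one.\<close>

lemma chains_wt_Suc: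
  assumes n: "n \<ge> 1" and \<mu>: "size \<mu> = Suc n"
  defines "c \<equiv> \<lambda>w::expo. Poly_Mapping.lookup w n"
  shows "{S \<in> chains (Suc n) (lamw a \<mu>). Poly_Mapping.nth (wt S) = w}
    = (\<Union>\<kappa>\<in>below_at a \<mu> (c w). (#) (lamw a \<mu>) ` {S \<in> chains n (lamw a \<kappa>). Poly_Mapping.nth (wt S) = w - xx n (c w)})"
proof -
  have step: "Poly_Mapping.nth (wt (lamw a \<mu> # S)) = w \<longleftrightarrow>
      of_int (sum_mset \<mu> - sum_mset \<kappa>) + a = c w \<and> Poly_Mapping.nth (wt S) = w - xx n (c w)"
    if S: "S \<in> chains n (lamw a \<kappa>)" and \<kappa>: "\<kappa> \<in> below \<mu>" for S \<kappa>
  proof -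
    have len: "length (wt S) = n" using S by (simp add: chains_def length_wt)
    have size: "size \<kappa> = n" using \<kappa> \<mu> by (simp add: below_def)
    have "sum_list (lamw a \<mu>) - sum_list (lamw a \<kappa>) = of_int (sum_mset \<mu> - sum_mset \<kappa>) + a"
      by (simp add: sum_lamw \<mu> size algebra_simps)
    hence *: "Poly_Mapping.nth (wt (lamw a \<mu> # S)) = Poly_Mapping.nth (wt S) + xx n (of_int (sum_mset \<mu> - sum_mset \<kappa>) + a)"
      unfolding wt_Cons[OF S n] nth_snoc len by simp
    show ?thesis
    proof
      assume eq: "Poly_Mapping.nth (wt (lamw a \<mu> # S)) = w"
      have "c w = of_int (sum_mset \<mu> - sum_mset \<kappa>) + a"
        unfolding eq[symmetric] * c_def using nth_wt_outside[OF S, of n] by (simp add: lookup_add)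
      moreover have "Poly_Mapping.nth (wt S) = w - xx n (of_int (sum_mset \<mu> - sum_mset \<kappa>) + a)"
        unfolding eq[symmetric] * by (rule add_diff_cancel_right'[symmetric])
      ultimately show "of_int (sum_mset \<mu> - sum_mset \<kappa>) + a = c w \<and> Poly_Mapping.nth (wt S) = w - xx n (c w)"
        by (simp only: simp_thms)
    qed (simp add: * del: of_int_diff)
  qed
  have ch: "chains (Suc n) (lamw a \<mu>) = (\<Union>\<kappa>\<in>below \<mu>. (#) (lamw a \<mu>) ` chains n (lamw a \<kappa>))"
    unfolding chains_Suc[OF n lamw_weights[OF \<mu>]] weights_below[OF \<mu> n] by simp
  show ?thesis unfolding ch below_at_def using step by blast
qed

lemma finite_chains_wt:
  "n \<ge> 1 \<Longrightarrow> size \<mu> = n \<Longrightarrow> finite {S \<in> chains n (lamw a \<mu>). Poly_Mapping.nth (wt S) = w}"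
proof (induction n arbitrary: \<mu> w rule: dec_induct)
  case base
  have "chains 1 (lamw a \<mu>) \<subseteq> {[lamw a \<mu>]}"
    by (auto simp: chains_def length_Suc_conv)
  thus ?case by (auto intro: finite_subset)
next
  case (step n)
  have "finite ((#) (lamw a \<mu>) ` {S \<in> chains n (lamw a \<kappa>). Poly_Mapping.nth (wt S) = w'})" if "\<kappa> \<in> below \<mu>" for \<kappa> w'
    using that step by (intro finite_imageI step.IH) (auto simp: below_def)
  thus ?case unfolding chains_wt_Suc[OF step.hyps(1) step.prems]
    by (intro finite_UN_I finite_below_at) (auto simp: below_at_def)
qed

lemma chain_sum_Suc:
  assumes n: "n \<ge> 1" and \<mu>: "size \<mu> = Suc n"
  shows "chain_sum (Suc n) a \<mu> w = (\<Sum>\<kappa>\<in>below_at a \<mu> (Poly_Mapping.lookup w n).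
    sk_mset \<mu> \<kappa> * chain_sum n a \<kappa> (w - xx n (Poly_Mapping.lookup w n)))"
proof -
  let ?c = "Poly_Mapping.lookup w n"
  let ?S = "\<lambda>\<kappa>. {S \<in> chains n (lamw a \<kappa>). Poly_Mapping.nth (wt S) = w - xx n ?c}"
  have \<kappa>: "\<kappa> \<in> below \<mu>" "size \<kappa> = n" if "\<kappa> \<in> below_at a \<mu> ?c" for \<kappa>
    using that \<mu> by (auto simp: below_at_def below_def)
  have "chain_sum (Suc n) a \<mu> w = (\<Sum>\<kappa>\<in>below_at a \<mu> ?c. \<Sum>S\<in>(#) (lamw a \<mu>) ` ?S \<kappa>. sk_chain T S)"
    unfolding chain_sum_def chains_wt_Suc[OF n \<mu>]
  proof (rule sum.UNION_disjoint)
    show "finite (below_at a \<mu> ?c)" by (rule finite_below_at)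
    show "\<forall>\<kappa>\<in>below_at a \<mu> ?c. finite ((#) (lamw a \<mu>) ` ?S \<kappa>)"
      using finite_chains_wt[OF n] \<kappa> by blast
    show "\<forall>\<kappa>\<in>below_at a \<mu> ?c. \<forall>\<kappa>'\<in>below_at a \<mu> ?c. \<kappa> \<noteq> \<kappa>' \<longrightarrow>
        (#) (lamw a \<mu>) ` ?S \<kappa> \<inter> (#) (lamw a \<mu>) ` ?S \<kappa>' = {}"
      using lamw_inj[of a] by (auto simp: chains_def)
  qed
  also have "\<dots> = (\<Sum>\<kappa>\<in>below_at a \<mu> ?c. sk_mset \<mu> \<kappa> * chain_sum n a \<kappa> (w - xx n ?c))"
  proof (rule sum.cong[OF refl], goal_cases)
    case (1 k)
    have "(\<Sum>S\<in>(#) (lamw a \<mu>) ` ?S k. sk_chain T S) = (\<Sum>S\<in>?S k. sk_chain T (lamw a \<mu> # S))"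
      by (subst sum.reindex) auto
    also have "\<dots> = (\<Sum>S\<in>?S k. sk_mset \<mu> k * sk_chain T S)"
      using sk_chain_Cons[OF _ n, of _ "lamw a k" T "lamw a \<mu>"] sk_weight_lamw[of k \<mu> a] \<kappa>[OF 1] n
      by (intro sum.cong refl) simp
    finally show ?case by (simp add: chain_sum_def sum_distrib_left)
  qed
  finally show ?thesis .
qed

lemma chain_sum_outside: "Poly_Mapping.lookup w n \<noteq> 0 \<Longrightarrow> chain_sum n a \<kappa> w = 0"
  unfolding chain_sum_def using nth_wt_outside[of _ n _ n] by (intro sum.neutral) auto

section \<open>Integrality in t of the chain sum\<close>

definition intf :: "rat fls \<Rightarrow> bool" where "intf x \<longleftrightarrow> x \<in> range fps_to_fls"

lemma intf_simps [simp]: "intf 0" "intf 1" "intf T"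
proof -
  show "intf 0" unfolding intf_def by (rule image_eqI[of _ _ 0]) auto
  show "intf 1" unfolding intf_def by (rule image_eqI[of _ _ 1]) auto
  show "intf T" unfolding intf_def
    by (rule image_eqI[of _ _ "fps_X ^ 2"]) (auto simp: T_def tK_def fps_to_fls_power)
qed

lemma intf_add: "intf x \<Longrightarrow> intf y \<Longrightarrow> intf (x + y)"
  and intf_mult: "intf x \<Longrightarrow> intf y \<Longrightarrow> intf (x * y)"
  unfolding intf_def by (auto simp: fps_to_fls_plus[symmetric] fls_times_fps_to_fls[symmetric] simp del: fps_to_fls_plus)

lemma intf_sum: "(\<And>i. i \<in> I \<Longrightarrow> intf (f i)) \<Longrightarrow> intf (\<Sum>i\<in>I. f i)"
  by (induction I rule: infinite_finite_induct) (auto intro: intf_add)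

lemma intf_prod: "(\<And>i. i \<in> I \<Longrightarrow> intf (f i)) \<Longrightarrow> intf (\<Prod>i\<in>I. f i)"
  by (induction I rule: infinite_finite_induct) (auto intro: intf_mult)

lemma intf_power: "intf x \<Longrightarrow> intf (x ^ k)"
  by (induction k) (auto intro: intf_mult)

text \<open>Integrality is not visible in the quotient defining the binomial; the Pascal rule builds
  it from sums and products.\<close>

lemma intf_tb: "intf (tb a b)"
proof (induction a arbitrary: b)
  case 0
  thus ?case by (cases b) auto
next
  case (Suc a)
  thus ?case by (cases b) (auto simp: tb_pascal intro!: intf_add intf_mult intf_power)
qed

lemma intf_sk_mset: "intf (sk_mset \<mu> \<nu>)"
  unfolding sk_mset_def Let_def by (intro intf_prod intf_mult intf_power intf_tb) simp

lemma bdd_intf: "(\<And>w. intf (\<phi> w)) \<Longrightarrow> bdd \<phi>"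
  unfolding bdd_def
proof (intro exI[of _ 0] allI impI)
  fix w assume "\<And>w. intf (\<phi> w)"
  then obtain f where "\<phi> w = fps_to_fls f" unfolding intf_def by blast
  thus "0 \<le> fls_subdegree (\<phi> w)" using fls_subdegree_fls_to_fps_gt0[of f] by simp
qed

lemma chains_1: "size \<mu> = 1 \<Longrightarrow> chains 1 (lamw a \<mu>) = {[lamw a \<mu>]}"
  using lamw_weights[of \<mu> 1 a] by (auto simp: chains_def length_Suc_conv)

lemma chain_sum_1: "size \<mu> = 1 \<Longrightarrow> chain_sum 1 a \<mu> w = (if w = xx 0 (of_int (sum_mset \<mu>) + a) then 1 else 0)"
proof -
  assume \<mu>: "size \<mu> = 1"
  have "wt [lamw a \<mu>] = [of_int (sum_mset \<mu>) + a]"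
    by (simp add: wt_def Let_def sum_lamw \<mu>[simplified])
  hence "Poly_Mapping.nth (wt [lamw a \<mu>]) = xx 0 (of_int (sum_mset \<mu>) + a)"
    by simp
  hence "{S \<in> chains 1 (lamw a \<mu>). Poly_Mapping.nth (wt S) = w}
      = (if w = xx 0 (of_int (sum_mset \<mu>) + a) then {[lamw a \<mu>]} else {})"
    unfolding chains_1[OF \<mu>] by auto
  thus ?thesis by (simp add: chain_sum_def sk_chain_def)
qed

lemma intf_chain_sum: "n \<ge> 1 \<Longrightarrow> size \<mu> = n \<Longrightarrow> intf (chain_sum n a \<mu> w)"
proof (induction n arbitrary: \<mu> w rule: dec_induct)
  case base
  thus ?case using chain_sum_1[of \<mu> a w] by simp
next
  case (step n)
  have "intf (sk_mset \<mu> \<kappa> * chain_sum n a \<kappa> v)" if "\<kappa> \<in> below_at a \<mu> c" for \<kappa> c v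
    using that step by (intro intf_mult intf_sk_mset step.IH) (auto simp: below_at_def below_def)
  thus ?case unfolding chain_sum_Suc[OF step.hyps(1) step.prems] by (intro intf_sum)
qed

section \<open>The chain sum multiplied by the lower factor\<close>

definition xall :: "nat \<Rightarrow> complex \<Rightarrow> expo" where "xall n a = (\<Sum>i<n. xx i a)"

lemma lookup_xall: "Poly_Mapping.lookup (xall n a) i = (if i < n then a else 0)"
  unfolding xall_def lookup_sum lookup_single by (simp add: when_def)

text \<open>The denominator of the trace factor at q = 0.\<close>

definition lower_factor :: "nat \<Rightarrow> rat fls cpoly" where
  "lower_factor n = (\<Prod>(i, j)\<in>posr n. 1 - cm (al j i) T)"

lemma lower_factor_Suc: "lower_factor (Suc n) = lower_factor n * last_factor n"
proof -
  have e: "posr (Suc n) = posr n \<union> (\<lambda>m. (m, n)) ` {..<n}" by (auto simp: less_Suc_eq)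
  have "lower_factor (Suc n) = lower_factor n * (\<Prod>(i, j)\<in>(\<lambda>m. (m, n)) ` {..<n}. 1 - cm (al j i) T)"
    unfolding lower_factor_def e by (rule prod.union_disjoint) auto
  also have "(\<Prod>(i, j)\<in>(\<lambda>m. (m, n)) ` {..<n}. 1 - cm (al j i) T) = last_factor n"
    unfolding last_factor_def by (subst prod.reindex) (auto simp: inj_on_def)
  finally show ?thesis .
qed

text \<open>Of \<open>lower_factor n * last_factor n\<close> the first factor is absorbed by the
  induction hypothesis and the second by \<open>hlr_pieri\<close>. The resulting double sum is the
  left side of \<open>sk_pieri_sum\<close>, whose right side is the recursion of
  \<open>hlr\<close>.\<close>

theorem act_lower_factor_chain_sum:
  "n \<ge> 1 \<Longrightarrow> size \<mu> = n \<Longrightarrow> act (lower_factor n) (chain_sum n a \<mu>) = lk (cm (xall n a) 1 * hlr n \<mu>)"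
proof (induction n arbitrary: \<mu> rule: dec_induct)
  case base
  then obtain q where q: "\<mu> = {#q#}" using size_1_singleton_mset by fastforce
  have "posr 1 = {}" by auto
  hence D: "lower_factor 1 = 1" by (simp only: lower_factor_def prod.empty)
  have "istrips {#q#} = {{#}}"
    using istrips_def by (auto simp: istrips_def)
  moreover have "branch_weight {#q#} {#} = 1" using branch_weight_remove_min[of "{#q#}" q "{#}"] by simp
  ultimately have "hlr 1 \<mu> = cm (xx 0 (of_int q)) 1" by (simp add: q)
  moreover have "xall 1 a = xx 0 a" by (simp add: xall_def)
  ultimately have "cm (xall 1 a) 1 * hlr 1 \<mu> = cm (xx 0 (of_int q + a)) 1"
    by (simp only: mult_single single_add mult_1 add.commute)
  thus ?case unfolding D using chain_sum_1[OF base, of a] by (intro ext) (auto simp: q lookup_single when_def)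
next
  case (step n)
  note n = step.hyps(1) and \<mu> = step.prems
  show ?case
  proof
    fix w
    let ?D = "lower_factor (Suc n)"
    \<comment> \<open>One finite set F has to serve all exponents w - v with v in the support of the
      multiplier. The element 0 is included so that K also bounds the exponent of w itself, as
      required for the closure condition of \<open>sk_pieri_sum\<close>.\<close>
    obtain K :: int where K: "\<And>v. v \<in> insert 0 (kys ?D) \<Longrightarrow> Re (Poly_Mapping.lookup (w - v) n - a) \<le> K"
    proof -
      have "finite ((\<lambda>v. Re (Poly_Mapping.lookup (w - v) n - a)) ` insert 0 (kys ?D))" by simp
      then obtain b where "\<forall>x\<in>(\<lambda>v. Re (Poly_Mapping.lookup (w - v) n - a)) ` insert 0 (kys ?D). x \<le> b"
        by (metis Max_ge)
      hence "Re (Poly_Mapping.lookup (w - v) n - a) \<le> \<lceil>b\<rceil>" if "v \<in> insert 0 (kys ?D)" for v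
        using that by (meson image_eqI le_of_int_ceiling order_trans)
      thus ?thesis using that by blast
    qed
    define F where "F = {\<kappa> \<in> below \<mu>. sum_mset \<mu> - sum_mset \<kappa> \<le> K}"
    have F: "finite F" "F \<subseteq> below \<mu>" unfolding F_def by (rule finite_below) auto
    have size: "size \<kappa> = n" if "\<kappa> \<in> below \<mu>" for \<kappa> using that \<mu> by (simp add: below_def)
    define e where "e \<kappa> = xx n (of_int (sum_mset \<mu> - sum_mset \<kappa>) + a)" for \<kappa>
    have chain_sum: "chain_sum (Suc n) a \<mu> (w - v) = (\<Sum>\<kappa>\<in>F. sk_mset \<mu> \<kappa> * chain_sum n a \<kappa> (w - v - e \<kappa>))" if v: "v \<in> kys ?D" for v
    proof -
      define c where "c = Poly_Mapping.lookup (w - v) n"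
      have "chain_sum (Suc n) a \<mu> (w - v) = (\<Sum>\<kappa>\<in>below_at a \<mu> c. sk_mset \<mu> \<kappa> * chain_sum n a \<kappa> (w - v - e \<kappa>))"
        unfolding chain_sum_Suc[OF n \<mu>] c_def by (rule sum.cong) (auto simp: below_at_def e_def)
      also have "\<dots> = (\<Sum>\<kappa>\<in>F. sk_mset \<mu> \<kappa> * chain_sum n a \<kappa> (w - v - e \<kappa>))"
      proof (rule sum.mono_neutral_left[OF F(1)])
        show "below_at a \<mu> c \<subseteq> F"
        proof
          fix \<kappa> assume \<kappa>: "\<kappa> \<in> below_at a \<mu> c"
          hence "of_int (sum_mset \<mu> - sum_mset \<kappa>) = c - a" by (auto simp: below_at_def)
          hence "real_of_int (sum_mset \<mu> - sum_mset \<kappa>) = Re (c - a)" by (metis Re_complex_of_real of_real_of_int_eq)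
          also have "\<dots> \<le> K" using K[of v] v by (simp add: c_def)
          finally show "\<kappa> \<in> F" using \<kappa> by (simp only: of_int_le_iff) (simp add: F_def below_at_def)
        qed
        \<comment> \<open>For the remaining \<kappa> the exponent still involves the last variable,
          which a chain sum in n variables cannot.\<close>
        show "\<forall>\<kappa>\<in>F - below_at a \<mu> c. sk_mset \<mu> \<kappa> * chain_sum n a \<kappa> (w - v - e \<kappa>) = 0"
        proof
          fix \<kappa> assume "\<kappa> \<in> F - below_at a \<mu> c"
          hence "of_int (sum_mset \<mu> - sum_mset \<kappa>) + a \<noteq> c" by (auto simp: below_at_def F_def)
          hence "Poly_Mapping.lookup (w - v - e \<kappa>) n \<noteq> 0"
            unfolding lookup_minus[of "w - v"] c_def[symmetric] by (simp add: e_def)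
          thus "sk_mset \<mu> \<kappa> * chain_sum n a \<kappa> (w - v - e \<kappa>) = 0" by (simp add: chain_sum_outside)
        qed
      qed
      finally show ?thesis .
    qed
    define G where "G \<rho> = lk (hlr n \<rho>) (w - xall (Suc n) a - xx n (of_int (sum_mset \<mu> - sum_mset \<rho>)))" for \<rho>
    have "act ?D (chain_sum (Suc n) a \<mu>) w = (\<Sum>v\<in>kys ?D. lk ?D v * (\<Sum>\<kappa>\<in>F. sk_mset \<mu> \<kappa> * chain_sum n a \<kappa> (w - v - e \<kappa>)))"
      unfolding act_def by (rule sum.cong) (simp_all add: chain_sum)
    also have "\<dots> = (\<Sum>\<kappa>\<in>F. sk_mset \<mu> \<kappa> * act ?D (act (cm (e \<kappa>) 1) (chain_sum n a \<kappa>)) w)"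
      unfolding act_def[of ?D] act_single sum_distrib_left by (subst sum.swap) (simp add: mult_ac)
    also have "\<dots> = (\<Sum>\<kappa>\<in>F. sk_mset \<mu> \<kappa> * (\<Sum>r | r \<subseteq># \<kappa>. (- T) ^ size r * pcoef \<kappa> r * G (\<kappa> - r + dec r)))"
    proof (rule sum.cong[OF refl], goal_cases)
      case (1 \<kappa>)
      hence \<kappa>: "size \<kappa> = n" using F size by blast
      have "act ?D (act (cm (e \<kappa>) 1) (chain_sum n a \<kappa>)) = act (cm (e \<kappa>) 1 * last_factor n) (act (lower_factor n) (chain_sum n a \<kappa>))"
        unfolding lower_factor_Suc by (simp only: act_mult[symmetric] mult_ac)
      also have "\<dots> = lk (cm (e \<kappa>) 1 * cm (xall n a) 1 * (last_factor n * hlr n \<kappa>))"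
        unfolding step.IH[OF \<kappa>] lookup_mult_act[symmetric] by (simp only: mult_ac)
      also have "\<dots> = lk (\<Sum>r | r \<subseteq># \<kappa>. cm (e \<kappa> + xall n a + xx n (of_int (int (size r)))) ((- T) ^ size r * pcoef \<kappa> r) * hlr n (\<kappa> - r + dec r))"
        unfolding hlr_pieri[OF \<kappa>] sum_distrib_left by (simp add: mult_single mult.assoc[symmetric])
      finally have act: "act ?D (act (cm (e \<kappa>) 1) (chain_sum n a \<kappa>)) w = (\<Sum>r | r \<subseteq># \<kappa>. (- T) ^ size r * pcoef \<kappa> r
          * lk (hlr n (\<kappa> - r + dec r)) (w - (e \<kappa> + xall n a + xx n (of_int (int (size r))))))"
        by (simp only: lookup_sum lookup_mult_act act_single)
      have "w - (e \<kappa> + xall n a + xx n (of_int (int (size r))))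
          = w - xall (Suc n) a - xx n (of_int (sum_mset \<mu> - sum_mset (\<kappa> - r + dec r)))" if "r \<subseteq># \<kappa>" for r
      proof -
        have "sum_mset (dec r) = sum_mset r - int (size r)" by (induction r) auto
        hence s: "sum_mset (\<kappa> - r + dec r) = sum_mset \<kappa> - int (size r)"
          using that by (auto simp: mset_subset_eq_exists_conv)
        have "e \<kappa> + xall n a + xx n (of_int (int (size r))) = xall (Suc n) a + xx n (of_int (sum_mset \<mu> - sum_mset (\<kappa> - r + dec r)))"
          unfolding s e_def by (intro poly_mapping_eqI) (auto simp: lookup_add lookup_single lookup_xall when_def)
        thus ?thesis by (simp only: diff_diff_eq)
      qed
      note ex = this
      show ?case unfolding act G_def
        by (intro arg_cong2[where f = "(*)", OF refl] sum.cong refl) (simp only: mem_Collect_eq ex)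
    qed
    \<comment> \<open>A nonzero coefficient of the lowered multiset prescribes its sum; lowering
      only decreases the sum, so \<kappa> itself already lies in F.\<close>
    also have "\<dots> = (\<Sum>\<rho>\<in>istrips \<mu>. branch_weight \<mu> \<rho> * G \<rho>)"
    proof (rule sk_pieri_sum[OF F])
      fix \<kappa> r assume \<kappa>: "\<kappa> \<in> below \<mu>" "r \<subseteq># \<kappa>" "G (\<kappa> - r + dec r) \<noteq> 0"
      let ?\<rho> = "\<kappa> - r + dec r"
      define d where "d = sum_mset \<mu> - sum_mset ?\<rho>"
      have "w - xall (Suc n) a - xx n (of_int d) \<in> int_expos n"
        using \<kappa>(3) hlr_int_laurent[of n ?\<rho>] by (auto simp: G_def d_def int_laurent_def in_keys_iff)
      hence "Poly_Mapping.lookup (w - xall (Suc n) a - xx n (of_int d)) n = 0"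
        by (simp add: int_expos_def)
      moreover have "Poly_Mapping.lookup (w - xall (Suc n) a - xx n (of_int d)) n = Poly_Mapping.lookup w n - a - of_int d"
        unfolding lookup_minus lookup_xall lookup_single by simp
      ultimately have "of_int d = Poly_Mapping.lookup w n - a" by simp
      hence "real_of_int (sum_mset \<mu> - sum_mset ?\<rho>) = Re (Poly_Mapping.lookup w n - a)"
        unfolding d_def by (metis Re_complex_of_real of_real_of_int_eq)
      also have "\<dots> \<le> K" using K[of 0] by simp
      finally have "sum_mset \<mu> - sum_mset ?\<rho> \<le> K" by (simp only: of_int_le_iff)
      moreover have "sum_mset (dec r) = sum_mset r - int (size r)" by (induction r) auto
      hence "sum_mset ?\<rho> = sum_mset \<kappa> - int (size r)"
        using \<kappa>(2) by (auto simp: mset_subset_eq_exists_conv)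
      ultimately show "\<kappa> \<in> F" using \<kappa>(1) by (simp add: F_def)
    qed
    also have "\<dots> = lk (hlr (Suc n) \<mu>) (w - xall (Suc n) a)"
      unfolding lookup_hlr_Suc G_def ..
    also have "\<dots> = lk (cm (xall (Suc n) a) 1 * hlr (Suc n) \<mu>) w"
      by (simp only: lookup_mult_act act_single) simp
    finally show "act ?D (chain_sum (Suc n) a \<mu>) w = lk (cm (xall (Suc n) a) 1 * hlr (Suc n) \<mu>) w" .
  qed
qed

text \<open>Functions with bounded \<open>t\<close>-valuation are determined by their product with \<open>lower_factor\<close>, so the chain sum
  is the only candidate for the quotient.\<close>

theorem chain_sum_eq_act_hlr:
  assumes n: "n \<ge> 1" "size \<mu> = n" and \<phi>: "bdd \<phi>" "act (lower_factor n) \<phi> = (\<lambda>w. if w = 0 then 1 else 0)"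
  shows "chain_sum n a \<mu> = act (cm (xall n a) 1 * hlr n \<mu>) \<phi>"
proof -
  have D: "lower_factor n = (\<Prod>p\<in>posr n. 1 - cm (case p of (i, j) \<Rightarrow> al j i) T)"
    unfolding lower_factor_def by (rule prod.cong) auto
  show ?thesis
  proof (rule act_roots_inj[of "posr n" _ _ "\<lambda>(i, j). al j i", folded D])
    show "bdd (chain_sum n a \<mu>)" using intf_chain_sum[OF n] by (intro bdd_intf)
    show "bdd (act (cm (xall n a) 1 * hlr n \<mu>) \<phi>)" using \<phi>(1) by (rule bdd_act)
    have "act (lower_factor n) (act (cm (xall n a) 1 * hlr n \<mu>) \<phi>) = act (cm (xall n a) 1 * hlr n \<mu>) (act (lower_factor n) \<phi>)"
      by (simp only: act_mult[symmetric] mult_ac)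
    thus "act (lower_factor n) (chain_sum n a \<mu>) = act (lower_factor n) (act (cm (xall n a) 1 * hlr n \<mu>) \<phi>)"
      unfolding act_lower_factor_chain_sum[OF n] \<phi>(2) act_delta by simp
  qed simp
qed

section \<open>The series rings\<close>

definition coeff_q0 :: "rat cpoly fps \<Rightarrow> expo \<Rightarrow> rat fls" where
  "coeff_q0 f w = fps_to_fls (Abs_fps (\<lambda>b. lk (fps_nth f b) w))"

lemma intf_coeff_q0: "intf (coeff_q0 f w)"
  by (simp add: intf_def coeff_q0_def)

lemma bdd_coeff_q0: "bdd (coeff_q0 f)"
  by (rule bdd_intf) (rule intf_coeff_q0)

lemma coeff_q0_diff: "coeff_q0 (f - g) w = coeff_q0 f w - coeff_q0 g w"
  unfolding coeff_q0_def fps_to_fls_minus[symmetric] by (rule arg_cong[of _ _ fps_to_fls], rule fps_ext) (simp add: lookup_minus)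

lemma coeff_q0_1: "coeff_q0 1 = (\<lambda>w. if w = 0 then 1 else 0)"
proof
  fix w
  have "Abs_fps (\<lambda>b. lk (fps_nth (1 :: rat cpoly fps) b) w) = (if w = 0 then 1 else 0)"
    by (rule fps_ext) (simp add: lookup_one when_def)
  thus "coeff_q0 1 w = (if w = 0 then 1 else 0)" by (simp add: coeff_q0_def)
qed

lemma coeff_q0_shift: "coeff_q0 (fps_const (cm a 1) * f) w = coeff_q0 f (w - a)"
  unfolding coeff_q0_def by (simp add: lookup_mult_act)

lemma coeff_q0_X: "coeff_q0 (fps_X * f) w = fls_X * coeff_q0 f w"
proof -
  have "Abs_fps (\<lambda>b. lk (fps_nth (fps_X * f) b) w) = fps_X * Abs_fps (\<lambda>b. lk (fps_nth f b) w)"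
    by (rule fps_ext) simp
  thus ?thesis by (simp add: coeff_q0_def fls_times_fps_to_fls)
qed

definition troot :: "expo \<Rightarrow> rat cpoly fps" where
  "troot a = 1 - fps_X ^ 2 * fps_const (cm a 1)"

lemma coeff_q0_troot: "coeff_q0 (troot a * f) = act (1 - cm a T) (coeff_q0 f)"
proof
  fix w
  have "coeff_q0 (fps_X ^ 2 * fps_const (cm a 1) * f) w = T * coeff_q0 f (w - a)"
    by (simp add: power2_eq_square mult.assoc coeff_q0_X coeff_q0_shift T_def tK_def)
  thus "coeff_q0 (troot a * f) w = act (1 - cm a T) (coeff_q0 f) w"
    by (simp add: troot_def left_diff_distrib coeff_q0_diff act_diff)
qed

lemma coeff_q0_root: "coeff_q0 ((1 - fps_const (cm a 1)) * f) = act (1 - cm a 1) (coeff_q0 f)"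
  by (rule ext) (simp add: left_diff_distrib coeff_q0_diff act_diff coeff_q0_shift)

lemma coeff_q0_troots: "finite I \<Longrightarrow> coeff_q0 ((\<Prod>i\<in>I. troot (a i)) * f) = act (\<Prod>i\<in>I. 1 - cm (a i) T) (coeff_q0 f)"
  by (induction I rule: finite_induct) (simp_all add: mult.assoc coeff_q0_troot act_mult)

lemma coeff_q0_roots: "finite I \<Longrightarrow> coeff_q0 ((\<Prod>i\<in>I. 1 - fps_const (cm (a i) 1)) * f) = act (\<Prod>i\<in>I. 1 - cm (a i) 1) (coeff_q0 f)"
  by (induction I rule: finite_induct) (simp_all add: mult.assoc coeff_q0_root act_mult)

lemma fps_unit_inverse:
  fixes b :: "'a::comm_ring_1 fps"
  assumes "fps_nth b 0 * y = 1"
  shows "\<exists>b'. b * b' = 1"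
  using fps_right_inverse[OF assms] by blast

lemma unit_quot_mult:
  assumes "b * b' = (1 :: 'a::comm_ring_1)"
  shows "unit_quot a b * b = a"
  unfolding unit_quot_def
proof (rule theI)
  show "a * b' * b = a" using assms by (simp add: mult.assoc mult.commute[of b'])
  fix d assume "d * b = a"
  hence "a * b' = d * (b * b')" by (simp add: mult.assoc[symmetric])
  thus "d = a * b'" using assms by simp
qed

lemma fps_power_nth_0: "fps_nth q 0 = 0 \<Longrightarrow> k < N \<Longrightarrow> fps_nth (q ^ N :: 'a::comm_ring_1 fps) k = 0"
  using startsby_zero_power_prefix[of q N] by auto

text \<open>Since q has no constant term, each coefficient of the partial products becomes
  stationary. The limit therefore exists, and its constant coefficient comes from the first factor
  alone.\<close>

lemma qpoch_inf_0:
  assumes "fps_nth q 0 = 0"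
  shows "fps_nth (qpoch_inf a q) 0 = 1 - fps_nth a 0"
proof -
  define X where "X N = (\<Prod>i<N. 1 - a * q ^ i)" for N
  have step: "fps_nth (X (Suc N)) k = fps_nth (X N) k" if "k < N" for k N
  proof -
    have "X (Suc N) = X N - X N * a * q ^ N" by (simp add: X_def algebra_simps)
    moreover have "fps_nth (X N * a * q ^ N) k = 0"
      using that by (simp add: fps_mult_nth fps_power_nth_0[OF assms])
    ultimately show ?thesis by simp
  qed
  have stable: "fps_nth (X N) k = fps_nth (X (Suc k)) k" if "Suc k \<le> N" for k N
    using that by (induction N rule: dec_induct) (simp_all add: step)
  define L where "L = Abs_fps (\<lambda>k. fps_nth (X (Suc k)) k)"
  have "X \<longlonglongrightarrow> L"
  proof (rule tendsto_fpsI)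
    fix k
    have "fps_nth (X N) k = fps_nth L k" if "N \<ge> Suc k" for N
      using stable[OF that] by (simp add: L_def)
    thus "eventually (\<lambda>N. fps_nth (X N) k = fps_nth L k) sequentially"
      by (rule eventually_sequentiallyI)
  qed
  hence "qpoch_inf a q = L" unfolding qpoch_inf_def X_def[symmetric] by (rule limI)
  thus ?thesis by (simp add: L_def X_def)
qed

lemma fps_nth_prod_0: "fps_nth (\<Prod>i\<in>I. f i :: 'a::comm_ring_1 fps) 0 = (\<Prod>i\<in>I. fps_nth (f i) 0)"
  by (induction I rule: infinite_finite_induct) simp_all

lemma qS_0: "fps_nth (qS ^ 2) 0 = 0"
  by (simp add: qS_def)

lemma ratioS_0: "fps_nth (ratioS i j) 0 = fps_const (cm (al i j) 1)"
  by (simp add: ratioS_def)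

lemma tS_0: "fps_nth (tS ^ 2) 0 = fps_X ^ 2"
  by (simp add: tS_def power2_eq_square)

lemma troot_0: "fps_nth (troot a) 0 = 1"
  by (simp add: troot_def)

text \<open>At q = 0 every infinite product collapses to its first factor. The denominator is a unit
  because it is 1 at q = t = 0, so \<open>unit_quot\<close> is a genuine quotient.\<close>

lemma theta_quot:
  fixes num :: "nat \<times> nat \<Rightarrow> xseries"
  assumes "finite I"
  defines "f \<equiv> unit_quot (\<Prod>p\<in>I. qpoch_inf (num p) (qS ^ 2)) (\<Prod>(i, j)\<in>I. qpoch_inf (tS ^ 2 * ratioS i j) (qS ^ 2))"
  shows "(\<Prod>(i, j)\<in>I. troot (al i j)) * fps_nth f 0 = (\<Prod>p\<in>I. 1 - fps_nth (num p) 0)"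
proof -
  let ?b = "\<Prod>(i, j)\<in>I. qpoch_inf (tS ^ 2 * ratioS i j) (qS ^ 2)"
  have b0: "fps_nth ?b 0 = (\<Prod>(i, j)\<in>I. troot (al i j))"
    unfolding fps_nth_prod_0 by (rule prod.cong) (auto simp: qpoch_inf_0[OF qS_0] tS_0 ratioS_0 troot_def)
  have "fps_nth (\<Prod>(i, j)\<in>I. troot (al i j)) 0 * 1 = 1"
    unfolding fps_nth_prod_0 by (simp add: troot_0 case_prod_beta)
  then obtain y where "fps_nth ?b 0 * y = 1" unfolding b0 using fps_unit_inverse by blast
  then obtain b' where "?b * b' = 1" using fps_unit_inverse by blast
  hence "f * ?b = (\<Prod>p\<in>I. qpoch_inf (num p) (qS ^ 2))" unfolding f_def by (rule unit_quot_mult)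
  hence "fps_nth (f * ?b) 0 = (\<Prod>p\<in>I. 1 - fps_nth (num p) 0)"
    by (simp add: fps_nth_prod_0 qpoch_inf_0[OF qS_0])
  moreover have "fps_nth (f * ?b) 0 = fps_nth f 0 * (\<Prod>(i, j)\<in>I. troot (al i j))"
    unfolding fps_mult_nth_0 b0 ..
  ultimately show ?thesis by (simp only: mult.commute)
qed

lemma prod_pair_cm: "(\<Prod>(i, j)\<in>I. 1 - cm (f i j) c) = (\<Prod>p\<in>I. 1 - cm (case p of (i, j) \<Rightarrow> f i j) c)"
  by (rule prod.cong) auto

lemma prod_pair_troot: "(\<Prod>(i, j)\<in>I. troot (f i j)) = (\<Prod>p\<in>I. troot (case p of (i, j) \<Rightarrow> f i j))"
  by (rule prod.cong) auto

definition phi0 :: "nat \<Rightarrow> expo \<Rightarrow> rat fls" where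
  "phi0 n = coeff_q0 (fps_nth (trace_factor n) 0)"

text \<open>The arguments in the numerator carry q^2, so at q = 0 the trace factor is the reciprocal
  of \<open>lower_factor n\<close>.\<close>

lemma act_lower_factor_phi0: "act (lower_factor n) (phi0 n) = (\<lambda>w. if w = 0 then 1 else 0)"
proof -
  let ?I = "prod.swap ` posr n"
  have inj: "inj_on prod.swap (posr n)" by simp
  have "trace_factor n = unit_quot (\<Prod>(l, m)\<in>?I. qpoch_inf (qS ^ 2 * ratioS l m) (qS ^ 2))
      (\<Prod>(l, m)\<in>?I. qpoch_inf (tS ^ 2 * ratioS l m) (qS ^ 2))"
    unfolding trace_factor_def Let_def by (simp add: prod.reindex case_prod_beta)
  hence "(\<Prod>(i, j)\<in>?I. troot (al i j)) * fps_nth (trace_factor n) 0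
      = (\<Prod>p\<in>?I. 1 - fps_nth (case p of (l, m) \<Rightarrow> qS ^ 2 * ratioS l m) 0)"
    using theta_quot[of ?I "\<lambda>(l, m). qS ^ 2 * ratioS l m"] by (simp add: case_prod_beta)
  also have "\<dots> = 1" by (rule prod.neutral) (auto simp: qS_0)
  finally have "act (\<Prod>(i, j)\<in>?I. 1 - cm (al i j) T) (phi0 n) = coeff_q0 1"
    unfolding phi0_def prod_pair_cm prod_pair_troot by (subst coeff_q0_troots[symmetric]) simp_all
  moreover have "(\<Prod>(i, j)\<in>?I. 1 - cm (al i j) T) = lower_factor n"
    unfolding lower_factor_def by (simp add: prod.reindex case_prod_beta)
  ultimately show ?thesis by (simp add: coeff_q0_1)
qed

definition weight_series :: "nat \<Rightarrow> xseries" where "weight_series n = macdonald_weight n (qS ^ 2) (tS ^ 2)"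

lemma weight_series_0: "(\<Prod>(i, j)\<in>allr n. troot (al i j)) * fps_nth (weight_series n) 0 = (\<Prod>(i, j)\<in>allr n. 1 - fps_const (cm (al i j) 1))"
proof -
  have "weight_series n = unit_quot (\<Prod>(i, j)\<in>allr n. qpoch_inf (ratioS i j) (qS ^ 2))
      (\<Prod>(i, j)\<in>allr n. qpoch_inf (tS ^ 2 * ratioS i j) (qS ^ 2))"
    unfolding weight_series_def macdonald_weight_def Let_def ..
  thus ?thesis using theta_quot[of "allr n" "\<lambda>(i, j). ratioS i j"] by (simp add: case_prod_beta ratioS_0)
qed

lemma act_weight_series: "act (\<Prod>(i, j)\<in>allr n. 1 - cm (al i j) T) (coeff_q0 (fps_nth (weight_series n) 0)) = lk (\<Prod>(i, j)\<in>allr n. 1 - cm (al i j) 1)"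
proof -
  have "act (\<Prod>(i, j)\<in>allr n. 1 - cm (al i j) T) (coeff_q0 (fps_nth (weight_series n) 0))
      = coeff_q0 ((\<Prod>(i, j)\<in>allr n. troot (al i j)) * fps_nth (weight_series n) 0)"
    unfolding prod_pair_cm prod_pair_troot by (rule coeff_q0_troots[symmetric]) simp
  also have "\<dots> = coeff_q0 ((\<Prod>p\<in>allr n. 1 - fps_const (cm (case p of (i, j) \<Rightarrow> al i j) 1)) * 1)"
    unfolding weight_series_0 by (simp add: case_prod_beta)
  also have "\<dots> = lk (\<Prod>(i, j)\<in>allr n. 1 - cm (al i j) 1)"
    by (subst coeff_q0_roots) (simp_all add: coeff_q0_1 act_delta case_prod_beta)
  finally show ?thesis .
qed

lemma weight_series_0_0: "fps_nth (fps_nth (weight_series n) 0) 0 = (\<Prod>(i, j)\<in>allr n. 1 - cm (al i j) 1)"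
proof -
  have "fps_nth ((\<Prod>(i, j)\<in>allr n. troot (al i j)) * fps_nth (weight_series n) 0) 0 = fps_nth (fps_nth (weight_series n) 0) 0"
    by (simp add: fps_nth_prod_0 case_prod_beta troot_0)
  thus ?thesis unfolding weight_series_0 by (simp add: fps_nth_prod_0 case_prod_beta)
qed

section \<open>Geometric series for the positive roots\<close>

definition geo :: "expo \<Rightarrow> rat cpoly fps" where
  "geo a = Abs_fps (\<lambda>b. if even b then cm a 1 ^ (b div 2) else 0)"

lemma troot_geo: "troot a * geo a = 1"
proof (rule fps_ext)
  fix b
  have "fps_nth (fps_X ^ 2 * (fps_const (cm a 1) * geo a)) b = (if b < 2 then 0 else cm a 1 * fps_nth (geo a) (b - 2))"
    by (subst fps_X_power_mult_nth) simp
  moreover have "fps_nth (troot a * geo a) b = fps_nth (geo a) b - fps_nth (fps_X ^ 2 * (fps_const (cm a 1) * geo a)) b"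
    by (simp add: troot_def left_diff_distrib mult.assoc)
  moreover have "b = 0 \<or> b = 1 \<or> (\<exists>k. b = k + 2)" by presburger
  ultimately show "fps_nth (troot a * geo a) b = fps_nth 1 b" by (auto simp: geo_def)
qed

lemma cone_poly_power: "cone_poly P \<Longrightarrow> cone_poly (P ^ k)"
  by (induction k) (auto intro: cone_poly_mult)

lemma geo_cone: "i < j \<Longrightarrow> cone_poly (fps_nth (geo (al i j)) b)"
proof -
  assume "i < j"
  hence "cone_poly (cm (al i j) (1::rat))" by (intro cone_poly_cm psum_root)
  thus ?thesis by (auto simp: geo_def intro: cone_poly_power) (simp add: cone_poly_def)
qed

lemma fps_cone_prod:
  "(\<And>i b. i \<in> I \<Longrightarrow> cone_poly (fps_nth (f i) b)) \<Longrightarrow> cone_poly (fps_nth (\<Prod>i\<in>I. f i) b)"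
proof (induction I arbitrary: b rule: infinite_finite_induct)
  case (insert i I)
  thus ?case by (auto simp: fps_mult_nth intro!: cone_poly_sum cone_poly_mult)
qed (auto simp: cone_poly_def[of 0])

text \<open>Expanding every factor as a geometric series uses only nonnegative multiples of the
  roots x_i/x_j with i < j, whence the support in the dominance cone.\<close>

lemma positive_inverse:
  obtains \<psi> where "bdd \<psi>" "act (\<Prod>(i, j)\<in>posr n. 1 - cm (al i j) T) \<psi> = (\<lambda>w. if w = 0 then 1 else 0)"
    "\<And>w k. \<psi> w \<noteq> 0 \<Longrightarrow> 0 \<le> psum k w"
proof
  define g where "g = (\<Prod>(i, j)\<in>posr n. geo (al i j))"
  show "bdd (coeff_q0 g)" by (rule bdd_coeff_q0)
  have "(\<Prod>(i, j)\<in>posr n. troot (al i j)) * g = (\<Prod>(i, j)\<in>posr n. troot (al i j) * geo (al i j))"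
    unfolding g_def prod.distrib[symmetric] by (rule prod.cong) auto
  also have "\<dots> = 1" by (rule prod.neutral) (auto simp: troot_geo)
  finally have "coeff_q0 ((\<Prod>(i, j)\<in>posr n. troot (al i j)) * g) = coeff_q0 1" by simp
  thus "act (\<Prod>(i, j)\<in>posr n. 1 - cm (al i j) T) (coeff_q0 g) = (\<lambda>w. if w = 0 then 1 else 0)"
    unfolding prod_pair_cm prod_pair_troot by (subst (asm) coeff_q0_troots) (simp_all add: coeff_q0_1)
  have cone: "cone_poly (fps_nth g b)" for b
    unfolding g_def by (rule fps_cone_prod) (auto intro: geo_cone)
  show "0 \<le> psum k w" if "coeff_q0 g w \<noteq> 0" for w k
  proof -
    have "\<exists>b. lk (fps_nth g b) w \<noteq> 0"
    proof (rule ccontr)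
      assume "\<not> ?thesis"
      hence "Abs_fps (\<lambda>b. lk (fps_nth g b) w) = 0" by (intro fps_ext) simp
      thus False using that by (simp add: coeff_q0_def)
    qed
    then obtain b where "w \<in> kys (fps_nth g b)" by (auto simp: in_keys_iff)
    thus ?thesis using cone[of b] by (simp add: cone_poly_def)
  qed
qed

section \<open>Linear systems over power series\<close>

abbreviation c00 :: "rat fps fps \<Rightarrow> rat" where "c00 f \<equiv> fps_nth (fps_nth f 0) 0"

lemma c00_sum: "c00 (\<Sum>i\<in>I. f i) = (\<Sum>i\<in>I. c00 (f i))"
  by (simp add: fps_sum_nth)

lemma c00_det:
  assumes "A \<in> carrier_mat m m"
  shows "det (map_mat c00 A) = c00 (det A)"
proof -
  interpret comm_ring_hom c00 by unfold_locales (simp_all add: fps_one_nth)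
  show ?thesis by (rule hom_det)
qed

text \<open>Nondegeneracy at q = t = 0 makes the constant coefficient of the determinant nonzero, so
  the determinant is a unit and the adjugate gives an inverse with power series entries. Below, one
  side of the inverse yields existence of Macdonald polynomials and the other uniqueness.\<close>

lemma fps_matrix_inverse:
  fixes G :: "'i \<Rightarrow> 'i \<Rightarrow> rat fps fps"
  assumes fin: "finite I"
    and nondeg: "\<And>c. \<forall>j\<in>I. (\<Sum>i\<in>I. c i * c00 (G i j)) = 0 \<Longrightarrow> \<forall>i\<in>I. c i = 0"
  obtains H where
    "\<And>i k. i \<in> I \<Longrightarrow> k \<in> I \<Longrightarrow> (\<Sum>j\<in>I. G i j * H j k) = (if i = k then 1 else 0)"
    "\<And>i k. i \<in> I \<Longrightarrow> k \<in> I \<Longrightarrow> (\<Sum>j\<in>I. H i j * G j k) = (if i = k then 1 else 0)"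
proof -
  define m where "m = card I"
  obtain f where f: "bij_betw f {0..<m} I" using fin unfolding m_def by (metis ex_bij_betw_nat_finite)
  define f' where "f' = inv_into {0..<m} f"
  have f': "f' i < m" "f (f' i) = i" if "i \<in> I" for i
    using bij_betw_inv_into_right[OF f that] bij_betwE[OF bij_betw_inv_into[OF f]] that by (auto simp: f'_def)
  have f'f: "f' (f a) = a" if "a < m" for a
    using bij_betw_inv_into_left[OF f] that by (simp add: f'_def)
  define A where "A = mat m m (\<lambda>(a, b). G (f a) (f b))"
  have A: "A \<in> carrier_mat m m" by (simp add: A_def)
  have "det (map_mat c00 A) \<noteq> 0"
  proof
    assume "det (map_mat c00 A) = 0"
    hence "det (transpose_mat (map_mat c00 A)) = 0" using A by (subst det_transpose[of _ m]) auto
    then obtain v where v: "v \<in> carrier_vec m" "v \<noteq> 0\<^sub>v m" "transpose_mat (map_mat c00 A) *\<^sub>v v = 0\<^sub>v m"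
      using A by (subst (asm) det_0_iff_vec_prod_zero[of _ m]) auto
    have "\<forall>i\<in>I. v $ f' i = 0"
    proof (rule nondeg, rule ballI)
      fix j assume j: "j \<in> I"
      have "(transpose_mat (map_mat c00 A) *\<^sub>v v) $ f' j = (\<Sum>a\<in>{0..<m}. c00 (G (f a) j) * v $ a)"
        using v(1) f'[OF j] A by (simp add: scalar_prod_def A_def)
      also have "\<dots> = (\<Sum>i\<in>I. c00 (G i j) * v $ f' i)"
        by (rule sum.reindex_bij_betw[OF f, of "\<lambda>i. c00 (G i j) * v $ f' i", THEN trans[rotated]])
           (simp add: f'f)
      finally show "(\<Sum>i\<in>I. v $ f' i * c00 (G i j)) = 0"
        using v(3) f'[OF j] by (simp add: mult.commute)
    qed
    hence "v $ a = 0" if "a < m" for a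
      using bij_betwE[OF f] f'f[OF that] that by (metis atLeastLessThan_iff zero_le)
    hence "v = 0\<^sub>v m" using v(1) by (intro eq_vecI) auto
    thus False using v(2) by simp
  qed
  hence "c00 (det A) \<noteq> 0" unfolding c00_det[OF A] .
  hence "c00 (det A) * inverse (c00 (det A)) = 1" by simp
  then obtain y where "fps_nth (det A) 0 * y = 1" using fps_unit_inverse[of "fps_nth (det A) 0"] by blast
  then obtain d where d: "det A * d = 1" using fps_unit_inverse by blast
  define B where "B = adj_mat A"
  have B: "B \<in> carrier_mat m m" "A * B = det A \<cdot>\<^sub>m 1\<^sub>m m" "B * A = det A \<cdot>\<^sub>m 1\<^sub>m m"
    unfolding B_def using adj_mat[OF A] by auto
  define H where "H i j = d * B $$ (f' i, f' j)" for i j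
  have eq: "f' i = f' k \<longleftrightarrow> i = k" if "i \<in> I" "k \<in> I" for i k using f' that by metis
  have AB: "(A * B) $$ (f' i, f' k) = (\<Sum>j\<in>I. G i j * B $$ (f' j, f' k))" if "i \<in> I" "k \<in> I" for i k
  proof -
    have "(A * B) $$ (f' i, f' k) = (\<Sum>a\<in>{0..<m}. G i (f a) * B $$ (f' (f a), f' k))"
      using f'[OF that(1)] f'[OF that(2)] A B(1) by (simp add: scalar_prod_def A_def f'f)
    also have "\<dots> = (\<Sum>j\<in>I. G i j * B $$ (f' j, f' k))"
      by (rule sum.reindex_bij_betw[OF f, of "\<lambda>j. G i j * B $$ (f' j, f' k)"])
    finally show ?thesis .
  qed
  have BA: "(B * A) $$ (f' i, f' k) = (\<Sum>j\<in>I. B $$ (f' i, f' j) * G j k)" if "i \<in> I" "k \<in> I" for i k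
  proof -
    have "(B * A) $$ (f' i, f' k) = (\<Sum>a\<in>{0..<m}. B $$ (f' i, f' (f a)) * G (f a) k)"
      using f'[OF that(1)] f'[OF that(2)] A B(1) by (simp add: scalar_prod_def A_def f'f)
    also have "\<dots> = (\<Sum>j\<in>I. B $$ (f' i, f' j) * G j k)"
      by (rule sum.reindex_bij_betw[OF f, of "\<lambda>j. B $$ (f' i, f' j) * G j k"])
    finally show ?thesis .
  qed
  have unit: "d * (det A \<cdot>\<^sub>m 1\<^sub>m m) $$ (f' i, f' k) = (if i = k then 1 else 0)" if "i \<in> I" "k \<in> I" for i k
    using f'[OF that(1)] f'[OF that(2)] eq[OF that] d by (simp add: mult.commute)
  show ?thesis
  proof (rule that[of H])
    fix i k assume ik: "i \<in> I" "k \<in> I"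
    show "(\<Sum>j\<in>I. G i j * H j k) = (if i = k then 1 else 0)"
      using AB[OF ik] unit[OF ik] unfolding B(2) by (simp add: H_def sum_distrib_left mult_ac)
    show "(\<Sum>j\<in>I. H i j * G j k) = (if i = k then 1 else 0)"
      using BA[OF ik] unit[OF ik] unfolding B(3) by (simp add: H_def sum_distrib_left mult_ac)
  qed
qed

section \<open>Positivity of the constant terms\<close>

text \<open>Reflecting exponents exchanges the factors of a root and its negative; this is the
  adjointness that turns the constant term form into a sum of squares.\<close>

lemma act_reversed:
  "finite I \<Longrightarrow> act (\<Prod>i\<in>I. 1 - cm (- a i) 1) \<chi> w = act (\<Prod>i\<in>I. 1 - cm (a i) 1) (\<lambda>z. \<chi> (- z)) (- w)"
proof (induction I arbitrary: w rule: finite_induct)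
  case (insert i I)
  have "act (\<Prod>i\<in>insert i I. 1 - cm (- a i) 1) \<chi> w
      = act (\<Prod>i\<in>I. 1 - cm (- a i) 1) \<chi> w - act (\<Prod>i\<in>I. 1 - cm (- a i) 1) \<chi> (w - (- a i))"
    using insert by (simp add: act_mult act_diff)
  thus ?case using insert by (simp add: act_mult act_diff)
qed simp

text \<open>A polynomial killed by 1 - x^a is periodic along a, so if nonzero it would have infinite
  support.\<close>

lemma root_cancel:
  fixes f :: "rat cpoly"
  assumes "(1 - cm a 1) * f = 0" "a \<noteq> 0"
  shows "f = 0"
proof (rule ccontr)
  assume "f \<noteq> 0"
  then obtain v where v: "lk f v \<noteq> 0" by (metis poly_mapping_eqI lookup_zero)
  have step: "lk f w = lk f (w - a)" for w
  proof -
    have "lk ((1 - cm a 1) * f) w = 0" by (simp add: assms)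
    thus ?thesis by (simp add: lookup_mult_act act_diff)
  qed
  obtain i where i: "Poly_Mapping.lookup a i \<noteq> 0" using assms(2) by (metis poly_mapping_eqI lookup_zero)
  define u where "u k = v - (\<Sum>_<k. a)" for k :: nat
  have u: "lk f (u k) \<noteq> 0" for k
  proof (induction k)
    case (Suc k)
    have "u (Suc k) = u k - a" by (simp add: u_def algebra_simps)
    thus ?case using Suc step[of "u k"] by simp
  qed (use v in \<open>simp add: u_def\<close>)
  have "inj u"
  proof (rule injI)
    fix k l assume "u k = u l"
    hence "Poly_Mapping.lookup (u k) i = Poly_Mapping.lookup (u l) i" by simp
    thus "k = l" using i unfolding u_def lookup_minus lookup_sum by simp
  qed
  hence "infinite (range u)" by (rule range_inj_infinite)
  moreover have "range u \<subseteq> kys f"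
    by (intro image_subsetI) (simp only: in_keys_iff u simp_thms)
  ultimately show False using finite_subset[of "range u" "kys f"] by simp
qed

lemma xx_inject: "xx i 1 = xx j 1 \<longleftrightarrow> i = j"
  by (metis lookup_single_eq lookup_single_not_eq zero_neq_one)

lemma roots_cancel:
  fixes f :: "rat cpoly"
  assumes "finite I" "\<And>i. i \<in> I \<Longrightarrow> a i \<noteq> 0" "(\<Prod>i\<in>I. 1 - cm (a i) 1) * f = 0"
  shows "f = 0"
  using assms
proof (induction I rule: finite_induct)
  case (insert i I)
  hence "(1 - cm (a i) 1) * ((\<Prod>i\<in>I. 1 - cm (a i) 1) * f) = 0" by (simp add: mult.assoc)
  moreover have "a i \<noteq> 0" by (rule insert.prems(1)) simp
  ultimately have "(\<Prod>i\<in>I. 1 - cm (a i) 1) * f = 0" by (rule root_cancel)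
  thus ?case by (rule insert.IH[rotated]) (rule insert.prems(1), simp)
qed simp

text \<open>The constant term form is \<open>\<langle>f, f\<rangle> = \<Sum> (coefficients of f \<Prod>(1 - x\<^sub>i/x\<^sub>j))\<^sup>2\<close>, the product over
  \<open>i < j\<close>.\<close>

lemma weyl_form_definite:
  fixes f :: "rat cpoly"
  assumes "(\<Sum>w\<in>kys f. lk f w * act f (lk (\<Prod>(i, j)\<in>allr n. 1 - cm (al i j) 1)) w) = 0"
  shows "f = 0"
proof -
  define a where "a = (\<Prod>p\<in>posr n. 1 - cm (case p of (i, j) \<Rightarrow> al i j) (1::rat))"
  define b where "b = (\<Prod>p\<in>posr n. 1 - cm (- (case p of (i, j) \<Rightarrow> al i j)) (1::rat))"
  have ab: "(\<Prod>(i, j)\<in>allr n. 1 - cm (al i j) 1) = a * b"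
    unfolding allr_split a_def b_def prod.distrib[symmetric] by (rule prod.cong) auto
  define F where "F = f * a"
  have "act f (lk (a * b)) w = act a (\<lambda>z. lk F (- z)) (- w)" for w
  proof -
    have "act f (lk (a * b)) w = lk (b * F) w"
      unfolding lookup_mult_act[symmetric] F_def by (simp only: mult_ac)
    also have "\<dots> = act b (lk F) w" by (simp add: lookup_mult_act)
    also have "\<dots> = act a (\<lambda>z. lk F (- z)) (- w)" unfolding a_def b_def by (rule act_reversed) simp
    finally show ?thesis .
  qed
  hence "0 = (\<Sum>w\<in>kys f. lk f w * act a (\<lambda>z. lk F (- z)) (- w))"
    using assms unfolding ab by simp
  also have "\<dots> = act f (act a (\<lambda>z. lk F (- z))) 0" by (simp add: act_def[of f])
  also have "\<dots> = act F (\<lambda>z. lk F (- z)) 0" by (simp add: F_def act_mult)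
  also have "\<dots> = (\<Sum>v\<in>kys F. lk F v ^ 2)" by (simp add: act_def power2_eq_square)
  finally have "\<forall>v\<in>kys F. lk F v ^ 2 = 0" by (subst (asm) eq_commute, subst (asm) sum_nonneg_eq_0_iff) auto
  hence "F = 0" by (auto simp: in_keys_iff intro!: poly_mapping_eqI)
  hence "a * f = 0" by (simp add: F_def mult.commute)
  thus ?thesis unfolding a_def by (rule roots_cancel[rotated 2]) (auto simp: xx_inject)
qed

section \<open>Monomial symmetric functions\<close>

definition nv :: "nat list \<Rightarrow> expo" where "nv v = Poly_Mapping.nth (map of_nat v)"

definition expo_orbit :: "nat list \<Rightarrow> expo set" where "expo_orbit mu = nv ` {v. mset v = mset mu}"

lemma lookup_nv: "Poly_Mapping.lookup (nv v) i = (if i < length v then of_nat (v ! i) else 0)"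
  by (simp add: nv_def nth_default_def)

lemma finite_mset_eq [simp]: "finite {v. mset v = M}"
  using finite_permutations_of_multiset[of M] by (simp add: permutations_of_multiset_def)

lemma finite_expo_orbit [simp]: "finite (expo_orbit mu)"
  by (simp add: expo_orbit_def)

lemma nv_inj: "length u = length v \<Longrightarrow> nv u = nv v \<Longrightarrow> u = v"
proof (rule nth_equalityI)
  fix i assume "length u = length v" "nv u = nv v" "i < length u"
  thus "u ! i = v ! i" using lookup_nv[of u i] lookup_nv[of v i] by simp
qed

lemma inj_on_nv: "inj_on nv {v. mset v = mset mu}"
  by (rule inj_onI) (metis mem_Collect_eq nv_inj size_mset)

lemma act_monomial_sym: "act (monomial_sym mu) \<xi> w = (\<Sum>v\<in>expo_orbit mu. \<xi> (w - v))"
  unfolding monomial_sym_def act_sum expo_orbit_def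
  by (subst sum.reindex[OF inj_on_nv]) (simp add: xmon_def nv_def)

lemma lookup_monomial_sym: "lk (monomial_sym mu :: 'a::comm_ring_1 cpoly) e = (if e \<in> expo_orbit mu then 1 else 0)"
proof -
  have "lk (monomial_sym mu :: 'a cpoly) e = act (monomial_sym mu) (\<lambda>w. if w = 0 then 1 else 0) e"
    by (simp add: act_delta)
  also have "\<dots> = (\<Sum>v\<in>expo_orbit mu. if v = e then 1 else 0)"
    unfolding act_monomial_sym by (rule sum.cong) auto
  finally show ?thesis by simp
qed

lemma act_scalar: "act (cm 0 c * P) \<xi> w = c * act P \<xi> w"
  by (simp add: act_mult)

lemma partition_unique:
  fixes p q :: "nat list"
  assumes "sorted_wrt (\<ge>) p" "sorted_wrt (\<ge>) q" "mset p = mset q"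
  shows "p = q"
proof -
  have "sorted (rev p)" "sorted (rev q)" using assms by (simp_all add: sorted_wrt_rev)
  hence "rev p = rev q" using assms(3) by (metis mset_rev properties_for_sort)
  thus ?thesis by simp
qed

text \<open>Among all orderings of a multiset, the decreasing one has the largest partial
  sums.\<close>

lemma sum_take_le:
  fixes v \<nu> :: "nat list"
  shows "sorted_wrt (\<ge>) \<nu> \<Longrightarrow> mset v = mset \<nu> \<Longrightarrow> sum_list (take k v) \<le> sum_list (take k \<nu>)"
proof (induction \<nu> arbitrary: v k)
  case (Cons a \<nu>)
  show ?case
  proof (cases k)
    case (Suc k')
    have "a \<in> set v" using Cons.prems by (metis list.set_intros(1) set_mset_mset)
    then obtain v1 v2 where v: "v = v1 @ a # v2" by (meson split_list)
    have ms: "mset (v1 @ v2) = mset \<nu>" using Cons.prems by (simp add: v)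
    have IH: "sum_list (take k' (v1 @ v2)) \<le> sum_list (take k' \<nu>)"
      using Cons.IH[OF _ ms] Cons.prems(1) by simp
    show ?thesis
    proof (cases "length v1 \<le> k'")
      case True
      hence "take k v = take (length v1) v1 @ a # take (k' - length v1) v2"
        using Suc by (simp add: v Suc_diff_le)
      thus ?thesis using IH True Suc by simp
    next
      case False
      hence "take k v = take k' (v1 @ v2) @ [v1 ! k']"
        using Suc by (simp add: v take_Suc_conv_app_nth)
      moreover have "v1 ! k' \<in> set \<nu>" using ms False by (metis in_set_conv_decomp nth_mem not_le set_append set_mset_mset UnI1)
      hence "v1 ! k' \<le> a" using Cons.prems by simp
      ultimately show ?thesis using IH Suc by simp
    qed
  qed simp
qed simp

definition DomSet :: "nat \<Rightarrow> nat list \<Rightarrow> nat list set" where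
  "DomSet n lam = {mu \<in> partitions_le n. dominated mu lam}"

lemma finite_DomSet: "finite (DomSet n lam)"
proof (rule finite_subset)
  show "DomSet n lam \<subseteq> {xs. set xs \<subseteq> {..sum_list lam} \<and> length xs = n}"
    by (auto simp: DomSet_def partitions_le_def dominated_def dest: member_le_sum_list)
qed (rule finite_lists_length_eq, simp)

definition intm :: "nat list \<Rightarrow> int multiset" where "intm p = mset (map int p)"

lemma desc_list_intm: "p \<in> partitions_le n \<Longrightarrow> desc_list (intm p) = map int p"
  unfolding intm_def partitions_le_def by (intro desc_list_unique) (simp add: sorted_wrt_map)

lemma size_intm: "p \<in> partitions_le n \<Longrightarrow> size (intm p) = n"
  by (simp add: intm_def partitions_le_def)

lemma xl_nv: "xl (map int p) = nv p"
  by (intro poly_mapping_eqI) (simp add: lookup_xl lookup_nv)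

lemma nv_permute:
  assumes "mset u = mset v" "length v = n"
  obtains \<sigma> where "\<sigma> permutes {..<n}" "nv u = pm \<sigma> (nv v)"
proof -
  obtain \<sigma> where \<sigma>: "\<sigma> permutes {..<length v}" "permute_list \<sigma> v = u"
    using mset_eq_permutation[OF assms(1)] by blast
  have "nv u = pm \<sigma> (nv v)"
    using \<sigma> by (intro poly_mapping_eqI)
      (auto simp: lookup_pm[OF \<sigma>(1)] lookup_nv permute_list_nth permutes_less[OF \<sigma>(1)])
  thus ?thesis using that \<sigma> assms(2) by blast
qed

lemma pm_nv:
  assumes "\<sigma> permutes {..<length v}"
  shows "pm \<sigma> (nv v) = nv (permute_list \<sigma> v)" "mset (permute_list \<sigma> v) = mset v"
  using assms by (auto intro!: poly_mapping_eqI simp: lookup_pm[OF assms] lookup_nv permute_list_nth permutes_less)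

lemma psum_nv: "k \<le> length v \<Longrightarrow> psum k (nv v) = real (sum_list (take k v))"
  unfolding psum_def by (simp add: lookup_nv sum_list_sum_nth atLeast0LessThan)

lemma hlr_expo_orbit:
  assumes "size \<mu> = n" "length q = n" "w \<in> expo_orbit q"
  shows "lk (hlr n \<mu>) w = lk (hlr n \<mu>) (nv q)"
proof -
  obtain v where v: "w = nv v" "mset v = mset q" using assms by (auto simp: expo_orbit_def)
  obtain \<sigma> where "\<sigma> permutes {..<n}" "nv v = pm \<sigma> (nv q)" using nv_permute[OF v(2) assms(2)] .
  thus ?thesis using hlr_symmetric[OF _ assms(1)] v by simp
qed

text \<open>By symmetry the coefficient at the sorted exponent is nonzero too, and there the partial
  sum bounds of \<open>hlr_keys\<close> are exactly dominance.\<close>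

lemma hlr_dominance:
  assumes p: "p \<in> partitions_le n" and w: "lk (hlr n (intm p)) w \<noteq> 0"
  obtains q where "q \<in> DomSet n p" "w \<in> expo_orbit q"
proof -
  note size = size_intm[OF p]
  have wZ: "w \<in> int_expos n" and pos: "\<And>i. i < n \<Longrightarrow> 0 \<le> ipart w i"
    using hlr_keys(1)[OF size w] hlr_keys(4)[OF size w, of 0] by (auto simp: intm_def)
  define v where "v = map (\<lambda>i. nat (ipart w i)) [0..<n]"
  have wv: "w = nv v"
  proof (rule poly_mapping_eqI)
    fix i
    show "Poly_Mapping.lookup w i = Poly_Mapping.lookup (nv v) i"
    proof (cases "i < n")
      case True
      thus ?thesis using int_expos_ipart[OF wZ, of i] pos[OF True] by (simp add: lookup_nv v_def)
    next
      case False
      thus ?thesis using wZ by (simp add: lookup_nv v_def int_expos_def)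
    qed
  qed
  define q where "q = rev (sort v)"
  have q: "mset q = mset v" "sorted_wrt (\<ge>) q" "length q = n" by (simp_all add: q_def sorted_wrt_rev v_def)
  have wq: "w \<in> expo_orbit q" unfolding expo_orbit_def wv using q(1) by auto
  have nz: "lk (hlr n (intm p)) (nv q) \<noteq> 0" using hlr_expo_orbit[OF size q(3) wq] w by simp
  have plen: "length p = n" using p by (simp add: partitions_le_def)
  have ip: "ipart (nv q) i = int (q ! i)" if "i < n" for i
    using that q(3) by (simp add: ipart_def lookup_nv)
  have sums: "(\<Sum>i<k. ipart (nv q) i) = int (sum_list (take k q))" "(\<Sum>i<k. desc_list (intm p) ! i) = int (sum_list (take k p))"
    if "k \<le> n" for k
    using that q(3) plen by (simp_all add: desc_list_intm[OF p] sum_list_sum_nth atLeast0LessThan ip)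
  have "sum_mset (intm p) = int (sum_list p)" unfolding intm_def by (induction p) auto
  hence total: "sum_list q = sum_list p"
    using hlr_keys(3)[OF size nz] sums(1)[of n] q(3) by simp
  moreover have "sum_list (take k q) \<le> sum_list (take k p)" for k
  proof (cases "k \<le> n")
    case True
    thus ?thesis using hlr_keys(2)[OF size nz True] sums[OF True] by simp
  next
    case False
    thus ?thesis using total q(3) plen by simp
  qed
  ultimately have "q \<in> DomSet n p" using q by (simp add: DomSet_def partitions_le_def dominated_def)
  thus ?thesis using that wq by blast
qed

lemma expo_orbit_disjoint:
  assumes "p \<in> partitions_le n" "q \<in> partitions_le n" "w \<in> expo_orbit p" "w \<in> expo_orbit q"
  shows "p = q"
proof -
  obtain u where u: "w = nv u" "mset u = mset p" using assms(3) by (auto simp: expo_orbit_def)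
  obtain v where v: "w = nv v" "mset v = mset q" using assms(4) by (auto simp: expo_orbit_def)
  note uv = u v
  have "length u = length v" using uv assms(1,2) by (metis (mono_tags, lifting) mem_Collect_eq partitions_le_def size_mset)
  hence "u = v" using uv nv_inj by metis
  thus ?thesis using uv assms by (intro partition_unique) (auto simp: partitions_le_def)
qed

lemma nv_in_expo_orbit: "nv p \<in> expo_orbit p"
  by (auto simp: expo_orbit_def)

lemma lookup_sym_sum:
  assumes "Q \<subseteq> partitions_le n" "finite Q" "q \<in> Q" "w \<in> expo_orbit q"
  shows "lk (\<Sum>mu\<in>Q. cm 0 (c mu) * monomial_sym mu) w = c q"
proof -
  have "lk (\<Sum>mu\<in>Q. cm 0 (c mu) * monomial_sym mu) w = (\<Sum>mu\<in>Q. if mu = q then c mu else 0)"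
    unfolding lookup_sum
  proof (rule sum.cong[OF refl], goal_cases)
    case (1 mu)
    have "w \<in> expo_orbit mu \<longleftrightarrow> mu = q" using expo_orbit_disjoint[of mu n q w] assms 1 by auto
    thus ?case by (simp add: lookup_mult_act lookup_monomial_sym)
  qed
  thus ?thesis using assms by simp
qed

lemma hlr_expansion:
  assumes p: "p \<in> partitions_le n"
  shows "hlr n (intm p) = (\<Sum>q\<in>DomSet n p. cm 0 (lk (hlr n (intm p)) (nv q)) * monomial_sym q)"
proof (rule poly_mapping_eqI)
  fix w
  let ?R = "\<Sum>q\<in>DomSet n p. cm 0 (lk (hlr n (intm p)) (nv q)) * monomial_sym q"
  show "lk (hlr n (intm p)) w = lk ?R w"
  proof (cases "\<exists>q\<in>DomSet n p. w \<in> expo_orbit q")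
    case True
    then obtain q where q: "q \<in> DomSet n p" "w \<in> expo_orbit q" by blast
    have "lk ?R w = lk (hlr n (intm p)) (nv q)"
      using q by (intro lookup_sym_sum[of _ n] finite_DomSet) (auto simp: DomSet_def)
    moreover have "length q = n" using q by (simp add: DomSet_def partitions_le_def)
    ultimately show ?thesis using hlr_expo_orbit[OF size_intm[OF p] _ q(2)] by simp
  next
    case False
    hence "lk (hlr n (intm p)) w = 0" using hlr_dominance[OF p] by blast
    moreover have "lk ?R w = 0"
      unfolding lookup_sum using False by (intro sum.neutral) (auto simp: lookup_mult_act lookup_monomial_sym)
    ultimately show ?thesis by simp
  qed
qed

text \<open>A nonzero coefficient would give, for some rearrangement of q, partial sums at least
  those of p. They are at most those of q itself, which p dominates, so p and q would
  coincide.\<close>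

lemma hlr_orthogonal:
  assumes p: "p \<in> partitions_le n" and q: "q \<in> DomSet n p" "q \<noteq> p" and w: "w \<in> expo_orbit q"
  shows "act (hlr n (intm p)) (coeff_q0 (fps_nth (weight_series n) 0)) w = 0"
proof (rule ccontr)
  assume nz: "act (hlr n (intm p)) (coeff_q0 (fps_nth (weight_series n) 0)) w \<noteq> 0"
  obtain \<psi> where \<psi>: "bdd \<psi>" "act (\<Prod>(i, j)\<in>posr n. 1 - cm (al i j) T) \<psi> = (\<lambda>w. if w = 0 then 1 else 0)"
    "\<And>w k. \<psi> w \<noteq> 0 \<Longrightarrow> 0 \<le> psum k w"
    by (rule positive_inverse[of n], rule that)
  obtain \<sigma> where \<sigma>: "\<sigma> permutes {..<n}" "\<And>k. psum k (xl (desc_list (intm p))) \<le> psum k (pm \<sigma> w)"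
    by (rule hlr_weight_support[OF size_intm[OF p] bdd_coeff_q0 act_weight_series \<psi> nz], assumption, rule that)
  obtain v where v: "w = nv v" "mset v = mset q" using w by (auto simp: expo_orbit_def)
  have len: "length p = n" "length q = n" "length v = n"
    using p q v by (auto simp: DomSet_def partitions_le_def) (metis size_mset)
  define v' where "v' = permute_list \<sigma> v"
  have v': "pm \<sigma> w = nv v'" "mset v' = mset q" "length v' = n"
    using pm_nv[of \<sigma> v] \<sigma>(1) len v by (simp_all add: v'_def)
  have eq: "sum_list (take k p) = sum_list (take k q)" if "k \<le> n" for k
  proof (rule antisym)
    have "psum k (nv p) \<le> psum k (nv v')" using \<sigma>(2)[of k] by (simp add: desc_list_intm[OF p] xl_nv v')
    hence "sum_list (take k p) \<le> sum_list (take k v')" using that len v' by (simp add: psum_nv)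
    also have "\<dots> \<le> sum_list (take k q)"
      using q v' by (intro sum_take_le) (auto simp: DomSet_def partitions_le_def)
    finally show "sum_list (take k p) \<le> sum_list (take k q)" .
    show "sum_list (take k q) \<le> sum_list (take k p)" using q by (simp add: DomSet_def dominated_def)
  qed
  have "p = q"
  proof (rule nth_equalityI)
    fix i assume "i < length p"
    hence i: "i < n" using len by simp
    have "sum_list (take (Suc i) p) = sum_list (take i p) + p ! i" "sum_list (take (Suc i) q) = sum_list (take i q) + q ! i"
      using i len by (simp_all add: take_Suc_conv_app_nth)
    thus "p ! i = q ! i" using eq[of i] eq[of "Suc i"] i by simp
  qed (use len in simp)
  thus False using q by simp
qed

section \<open>Macdonald polynomials at \<open>q = 0\<close>\<close>

definition scalar_of :: "rat fps fps \<Rightarrow> scalar" where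
  "scalar_of f = fps_to_fls (Abs_fps (\<lambda>a. fps_to_fls (fps_nth f a)))"

lemma scalar_of_add: "scalar_of (f + g) = scalar_of f + scalar_of g"
  unfolding scalar_of_def fps_to_fls_plus[symmetric] by (rule arg_cong[of _ _ fps_to_fls], rule fps_ext) simp

lemma scalar_of_0 [simp]: "scalar_of 0 = 0"
proof -
  have "Abs_fps (\<lambda>a. fps_to_fls (fps_nth (0 :: rat fps fps) a)) = 0" by (rule fps_ext) simp
  thus ?thesis by (simp add: scalar_of_def)
qed

lemma scalar_of_1 [simp]: "scalar_of 1 = 1"
proof -
  have "Abs_fps (\<lambda>a. fps_to_fls (fps_nth (1 :: rat fps fps) a)) = 1" by (rule fps_ext) simp
  thus ?thesis by (simp add: scalar_of_def)
qed

lemma fps_to_fls_sum: "fps_to_fls (\<Sum>i\<in>I. f i) = (\<Sum>i\<in>I. fps_to_fls (f i))"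
  by (induction I rule: infinite_finite_induct) simp_all

lemma scalar_of_mult: "scalar_of (f * g) = scalar_of f * scalar_of g"
  unfolding scalar_of_def fls_times_fps_to_fls[symmetric]
  by (rule arg_cong[of _ _ fps_to_fls], rule fps_ext) (simp add: fps_mult_nth fps_to_fls_sum fls_times_fps_to_fls)

lemma scalar_of_sum: "scalar_of (\<Sum>i\<in>I. f i) = (\<Sum>i\<in>I. scalar_of (f i))"
  by (induction I rule: infinite_finite_induct) (simp_all add: scalar_of_add)

lemma scalar_of_uminus: "scalar_of (- f) = - scalar_of f"
  using scalar_of_add[of f "- f"] by (simp add: add_eq_0_iff)

lemma scalar_of_nth: "k < 0 \<Longrightarrow> fls_nth (scalar_of f) k = 0" "fls_nth (scalar_of f) 0 = fps_to_fls (fps_nth f 0)"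
  by (simp_all add: scalar_of_def)

definition coeff_qt :: "xseries \<Rightarrow> expo \<Rightarrow> rat fps fps" where
  "coeff_qt f w = Abs_fps (\<lambda>a. Abs_fps (\<lambda>b. lk (fps_nth (fps_nth f a) b) w))"

lemma xcoeff_scalar_of: "xcoeff f = (\<lambda>w. scalar_of (coeff_qt f w))"
  by (rule ext) (simp add: xcoeff_def scalar_of_def coeff_qt_def)

lemma coeff_q0_coeff_qt: "fps_to_fls (fps_nth (coeff_qt f w) 0) = coeff_q0 (fps_nth f 0) w"
  by (simp add: coeff_qt_def coeff_q0_def)

lemma c00_coeff_qt: "c00 (coeff_qt f w) = lk (fps_nth (fps_nth f 0) 0) w"
  by (simp add: coeff_qt_def)

text \<open>The pairing of two monomial symmetric functions, kept among power series in q and t, so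
  that it can be reduced at q = 0.\<close>

definition gram :: "nat \<Rightarrow> nat list \<Rightarrow> nat list \<Rightarrow> rat fps fps" where
  "gram n mu nu = (\<Sum>w\<in>expo_orbit nu. \<Sum>v\<in>expo_orbit mu. coeff_qt (weight_series n) (w - v))"

lemma pairing_monomial_sym:
  "macdonald_pairing n (qS ^ 2) (tS ^ 2) P (monomial_sym nu) = (\<Sum>w\<in>expo_orbit nu. act P (xcoeff (weight_series n)) w)"
proof -
  have "kys (monomial_sym nu :: scalar cpoly) = expo_orbit nu"
    by (auto simp: in_keys_iff lookup_monomial_sym split: if_splits)
  thus ?thesis
    unfolding macdonald_pairing_def weight_series_def[symmetric] act_def
    by (subst sum.swap) (simp add: lookup_monomial_sym)
qed

lemma pairing_expansion:
  "macdonald_pairing n (qS ^ 2) (tS ^ 2) (monomial_sym lam + (\<Sum>mu\<in>L. cm 0 (u mu) * monomial_sym mu)) (monomial_sym nu)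
    = scalar_of (gram n lam nu) + (\<Sum>mu\<in>L. u mu * scalar_of (gram n mu nu))"
proof -
  have *: "(\<Sum>w\<in>expo_orbit nu. act (monomial_sym mu) (xcoeff (weight_series n)) w) = scalar_of (gram n mu nu)" for mu
    unfolding act_monomial_sym gram_def scalar_of_sum xcoeff_scalar_of ..
  have "(\<Sum>w\<in>expo_orbit nu. act (\<Sum>mu\<in>L. cm 0 (u mu) * monomial_sym mu) (xcoeff (weight_series n)) w)
      = (\<Sum>mu\<in>L. u mu * (\<Sum>w\<in>expo_orbit nu. act (monomial_sym mu) (xcoeff (weight_series n)) w))"
    unfolding act_sum act_scalar sum_distrib_left by (rule sum.swap)
  thus ?thesis unfolding pairing_monomial_sym act_add sum.distrib * by simp
qed

text \<open>A null vector c makes the constant term form at q = t = 0 vanish at the polynomial with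
  coefficients c; by definiteness that polynomial is zero, and the orbits are disjoint.\<close>

lemma gram_nondegenerate:
  assumes L: "finite L" "L \<subseteq> partitions_le n" and c: "\<forall>\<nu>\<in>L. (\<Sum>\<mu>\<in>L. c \<mu> * c00 (gram n \<mu> \<nu>)) = 0"
  shows "\<forall>\<mu>\<in>L. c \<mu> = 0"
proof -
  define f where "f = (\<Sum>\<mu>\<in>L. cm 0 (c \<mu>) * monomial_sym \<mu>)"
  define D where "D = (\<Prod>(i, j)\<in>allr n. 1 - cm (al i j) (1::rat))"
  have gram: "c00 (gram n \<mu> \<nu>) = (\<Sum>w\<in>expo_orbit \<nu>. \<Sum>v\<in>expo_orbit \<mu>. lk D (w - v))" for \<mu> \<nu>
    unfolding gram_def c00_sum c00_coeff_qt weight_series_0_0 D_def ..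
  have act: "act f \<chi> w = (\<Sum>\<mu>\<in>L. c \<mu> * (\<Sum>v\<in>expo_orbit \<mu>. \<chi> (w - v)))" for \<chi> w
    unfolding f_def act_sum act_scalar act_monomial_sym ..
  have "(\<Sum>w\<in>kys f. lk f w * act f (lk D) w) = act f (\<lambda>z. act f (lk D) (- z)) 0"
    by (simp add: act_def[of f "\<lambda>z. act f (lk D) (- z)"])
  also have "\<dots> = (\<Sum>\<nu>\<in>L. c \<nu> * (\<Sum>w\<in>expo_orbit \<nu>. act f (lk D) w))"
    unfolding act[of "\<lambda>z. act f (lk D) (- z)"] by simp
  also have "\<dots> = (\<Sum>\<nu>\<in>L. c \<nu> * (\<Sum>\<mu>\<in>L. c \<mu> * c00 (gram n \<mu> \<nu>)))"
    unfolding act[of "lk D"] gram sum_distrib_left[of "c _"]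
    by (intro sum.cong refl) (simp add: sum.swap[of _ "expo_orbit _" L])
  also have "\<dots> = 0" using c by simp
  finally have "f = 0" unfolding D_def by (rule weyl_form_definite)
  show ?thesis
  proof
    fix \<mu> assume "\<mu> \<in> L"
    hence "lk f (nv \<mu>) = c \<mu>" unfolding f_def using L by (intro lookup_sym_sum[of _ n] nv_in_expo_orbit)
    thus "c \<mu> = 0" using \<open>f = 0\<close> by simp
  qed
qed

text \<open>Orthogonality to the smaller monomial functions is a linear system with matrix
  \<open>gram\<close>. Its inverse has power series entries, so the solution has no pole at q = 0
  and its reduction there solves the reduced system, as the normalized Hall-Littlewood coefficients
  do.\<close>

theorem macdonald_part_q0:
  assumes p: "p \<in> partitions_le n"
  obtains u where
    "macdonald_part n (qS ^ 2) (tS ^ 2) p = (\<Sum>mu\<in>DomSet n p. cm 0 (scalar_of (u mu)) * monomial_sym mu)"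
    "\<And>mu. mu \<in> DomSet n p \<Longrightarrow> fps_to_fls (fps_nth (u mu) 0) = lk (hlr n (intm p)) (nv mu) / hl_lead (intm p)"
proof -
  define L where "L = {mu \<in> partitions_le n. dominated mu p \<and> mu \<noteq> p}"
  have pD: "p \<in> DomSet n p" using p by (simp add: DomSet_def dominated_def)
  have L: "L = DomSet n p - {p}" by (auto simp: L_def DomSet_def)
  have finL: "finite L" "L \<subseteq> partitions_le n" using finite_DomSet[of n p] by (auto simp: L DomSet_def)
  obtain H where H:
    "\<And>i k. i \<in> L \<Longrightarrow> k \<in> L \<Longrightarrow> (\<Sum>j\<in>L. gram n i j * H j k) = (if i = k then 1 else 0)"
    "\<And>i k. i \<in> L \<Longrightarrow> k \<in> L \<Longrightarrow> (\<Sum>j\<in>L. H i j * gram n j k) = (if i = k then 1 else 0)"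
    by (rule fps_matrix_inverse[OF finL(1) gram_nondegenerate[OF finL]], assumption, rule that)
  \<comment> \<open>The orthogonality system solved with the inverse matrix H.\<close>
  define u0 where "u0 mu = - (\<Sum>nu\<in>L. gram n p nu * H nu mu)" for mu
  define u where "u mu = (if mu = p then 1 else u0 mu)" for mu
  define P where "P = (monomial_sym p + (\<Sum>mu\<in>L. cm 0 (scalar_of (u0 mu)) * monomial_sym mu) :: scalar cpoly)"
  have sol: "gram n p nu + (\<Sum>mu\<in>L. u0 mu * gram n mu nu) = 0" if "nu \<in> L" for nu
  proof -
    have "(\<Sum>mu\<in>L. u0 mu * gram n mu nu) = - (\<Sum>k\<in>L. gram n p k * (\<Sum>mu\<in>L. H k mu * gram n mu nu))"
      unfolding u0_def by (simp add: sum_distrib_right sum_distrib_left sum_negf mult.assoc)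
        (rule sum.swap)
    also have "\<dots> = - (\<Sum>k\<in>L. if k = nu then gram n p k else 0)"
      using H(2)[OF _ that] by (intro arg_cong[of _ _ uminus] sum.cong) auto
    also have "\<dots> = - gram n p nu" using that finL by simp
    finally show ?thesis by simp
  qed
  have isP: "is_macdonald n (qS ^ 2) (tS ^ 2) p P"
    unfolding is_macdonald_def Let_def L_def[symmetric]
  proof (intro conjI exI ballI)
    show "P = monomial_sym p + (\<Sum>mu\<in>L. cm 0 (scalar_of (u0 mu)) * monomial_sym mu)" by (rule P_def)
    fix nu assume "nu \<in> L"
    hence "scalar_of (gram n p nu + (\<Sum>mu\<in>L. u0 mu * gram n mu nu)) = 0" by (simp add: sol)
    thus "macdonald_pairing n (qS ^ 2) (tS ^ 2) P (monomial_sym nu) = 0"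
      unfolding P_def pairing_expansion by (simp add: scalar_of_add scalar_of_sum scalar_of_mult)
  qed
  have unique: "Q = P" if "is_macdonald n (qS ^ 2) (tS ^ 2) p Q" for Q
  proof -
    from that obtain x where Q: "Q = monomial_sym p + (\<Sum>mu\<in>L. cm 0 (x mu) * monomial_sym mu)"
      and orth: "\<And>nu. nu \<in> L \<Longrightarrow> macdonald_pairing n (qS ^ 2) (tS ^ 2) Q (monomial_sym nu) = 0"
      unfolding is_macdonald_def Let_def L_def[symmetric] by blast
    have "x k = scalar_of (u0 k)" if k: "k \<in> L" for k
    proof -
      have "(\<Sum>mu\<in>L. x mu * scalar_of (gram n mu nu)) = - scalar_of (gram n p nu)" if "nu \<in> L" for nu
        using orth[OF that] unfolding Q pairing_expansion by (simp add: add_eq_0_iff)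
      hence "(\<Sum>nu\<in>L. (\<Sum>mu\<in>L. x mu * scalar_of (gram n mu nu)) * scalar_of (H nu k)) = (\<Sum>nu\<in>L. - scalar_of (gram n p nu) * scalar_of (H nu k))"
        by (intro sum.cong) simp_all
      also have "\<dots> = scalar_of (u0 k)"
        unfolding u0_def scalar_of_uminus scalar_of_sum scalar_of_mult by (simp add: sum_negf)
      also have "(\<Sum>nu\<in>L. (\<Sum>mu\<in>L. x mu * scalar_of (gram n mu nu)) * scalar_of (H nu k))
          = (\<Sum>mu\<in>L. x mu * scalar_of (\<Sum>nu\<in>L. gram n mu nu * H nu k))"
        unfolding scalar_of_sum scalar_of_mult sum_distrib_left sum_distrib_right
        by (subst sum.swap) (simp add: mult.assoc)
      also have "\<dots> = (\<Sum>mu\<in>L. if mu = k then x mu else 0)"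
        using H(1)[OF _ k] by (intro sum.cong) auto
      also have "\<dots> = x k" using k finL by simp
      finally show ?thesis .
    qed
    thus ?thesis unfolding Q P_def by simp
  qed
  have "macdonald_part n (qS ^ 2) (tS ^ 2) p = P"
    unfolding macdonald_part_def using isP unique by (rule the_equality)
  also have "P = (\<Sum>mu\<in>DomSet n p. cm 0 (scalar_of (u mu)) * monomial_sym mu)"
  proof -
    have "(\<Sum>mu\<in>DomSet n p. cm 0 (scalar_of (u mu)) * monomial_sym mu) = cm 0 (scalar_of (u p)) * monomial_sym p
       + (\<Sum>mu\<in>L. cm 0 (scalar_of (u mu)) * monomial_sym mu)"
      unfolding L by (rule sum.remove[OF finite_DomSet pD])
    also have "cm 0 (scalar_of (u p)) = (1 :: scalar cpoly)" by (simp add: u_def)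
    also have "(\<Sum>mu\<in>L. cm 0 (scalar_of (u mu)) * monomial_sym mu) = (\<Sum>mu\<in>L. cm 0 (scalar_of (u0 mu)) * monomial_sym mu)"
      by (rule sum.cong) (auto simp: u_def L)
    finally show ?thesis by (simp add: P_def)
  qed
  finally have mac: "macdonald_part n (qS ^ 2) (tS ^ 2) p = (\<Sum>mu\<in>DomSet n p. cm 0 (scalar_of (u mu)) * monomial_sym mu)" .
  define io1 where "io1 f = fps_to_fls (fps_nth f 0)" for f :: "rat fps fps"
  have io1: "io1 (f * g) = io1 f * io1 g" "io1 (- f) = - io1 f" "io1 1 = 1" "io1 0 = 0" for f g
    by (simp_all add: io1_def fls_times_fps_to_fls)
  have io1_sum: "io1 (\<Sum>i\<in>I. f i) = (\<Sum>i\<in>I. io1 (f i))" for f and I :: "nat list set"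
    by (simp add: io1_def fps_sum_nth fps_to_fls_sum)
  define a where "a mu = lk (hlr n (intm p)) (nv mu) / hl_lead (intm p)" for mu
  have ap: "a p = 1"
    using hlr_leading[OF size_intm[OF p]] by (simp add: a_def desc_list_intm[OF p] xl_nv)
  have a_eq: "(\<Sum>mu\<in>L. a mu * io1 (gram n mu nu)) = - io1 (gram n p nu)" if nu: "nu \<in> L" for nu
  proof -
    have io1_gram: "io1 (gram n mu nu) = (\<Sum>w\<in>expo_orbit nu. act (monomial_sym mu) (coeff_q0 (fps_nth (weight_series n) 0)) w)" for mu
      unfolding act_monomial_sym gram_def io1_def by (simp add: fps_sum_nth fps_to_fls_sum coeff_q0_coeff_qt)
    have "(\<Sum>mu\<in>DomSet n p. lk (hlr n (intm p)) (nv mu) * io1 (gram n mu nu))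
        = (\<Sum>w\<in>expo_orbit nu. act (hlr n (intm p)) (coeff_q0 (fps_nth (weight_series n) 0)) w)"
      by (subst (2) hlr_expansion[OF p]) (simp add: act_sum act_scalar io1_gram sum_distrib_left sum.swap[of _ "expo_orbit nu"])
    also have "\<dots> = 0"
      using hlr_orthogonal[OF p, of nu] nu by (intro sum.neutral) (auto simp: L)
    finally have "(\<Sum>mu\<in>DomSet n p. a mu * io1 (gram n mu nu)) = 0"
      by (simp add: a_def sum_divide_distrib[symmetric])
    moreover have "(\<Sum>mu\<in>DomSet n p. a mu * io1 (gram n mu nu)) = a p * io1 (gram n p nu) + (\<Sum>mu\<in>L. a mu * io1 (gram n mu nu))"
      unfolding L by (rule sum.remove[OF finite_DomSet pD])
    ultimately show ?thesis by (simp add: ap add_eq_0_iff2)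
  qed
  \<comment> \<open>Reduction at q = 0 is a ring homomorphism, so the reduction of H inverts the
    reduced matrix and the two solutions must agree.\<close>
  have "io1 (u mu) = a mu" if mu: "mu \<in> DomSet n p" for mu
  proof (cases "mu = p")
    case True
    thus ?thesis by (simp add: u_def io1 ap)
  next
    case False
    hence k: "mu \<in> L" using mu by (simp add: L)
    have "io1 (u mu) = (\<Sum>nu\<in>L. - io1 (gram n p nu) * io1 (H nu mu))"
      using False by (simp add: u_def u0_def io1 io1_sum sum_negf)
    also have "\<dots> = (\<Sum>nu\<in>L. (\<Sum>m\<in>L. a m * io1 (gram n m nu)) * io1 (H nu mu))"
      by (rule sum.cong) (simp_all add: a_eq)
    also have "\<dots> = (\<Sum>m\<in>L. a m * io1 (\<Sum>nu\<in>L. gram n m nu * H nu mu))"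
      unfolding io1_sum io1 sum_distrib_left sum_distrib_right
      by (subst sum.swap) (simp add: mult.assoc)
    also have "\<dots> = (\<Sum>m\<in>L. if m = mu then a m else 0)"
      using H(1)[OF _ k] by (intro sum.cong) (auto simp: io1)
    also have "\<dots> = a mu" using k finL by simp
    finally show ?thesis .
  qed
  thus ?thesis using mac that by (simp add: io1_def a_def)
qed

lemma weights_shift_partition:
  assumes "lam \<in> weights n" "n \<ge> 1"
  shows "\<exists>a p. p \<in> partitions_le n \<and> lam = shift a (map of_nat p)"
proof -
  \<comment> \<open>Taking the last entry as offset makes the remaining list a partition ending in
    0.\<close>
  define a where "a = lam ! (n - 1)"
  have len: "length lam = n" using assms by (simp add: weights_def)
  have "\<exists>i<n. lam ! i - a \<in> \<int>" using assms by (intro exI[of _ "n - 1"]) (simp add: a_def)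
  then obtain \<mu> where \<mu>: "lam = lamw a \<mu>" "size \<mu> = n" by (rule weights_lamw[OF assms])
  have "lamw a \<mu> ! (n - 1) = of_int (desc_list \<mu> ! (n - 1)) + a"
    by (rule lamw_nth) (use \<mu>(2) assms(2) in simp)
  moreover have "lamw a \<mu> ! (n - 1) = a" unfolding \<mu>(1)[symmetric] by (rule a_def[symmetric])
  ultimately have "desc_list \<mu> ! (n - 1) = 0" by simp
  hence nonneg: "0 \<le> desc_list \<mu> ! i" if "i < n" for i
    using desc_list_nth_mono[of i "n - 1" \<mu>] that \<mu>(2) by (cases "i = n - 1") auto
  define p where "p = map nat (desc_list \<mu>)"
  have "p \<in> partitions_le n"
    unfolding p_def partitions_le_def
    using \<mu>(2) by (auto simp: sorted_wrt_map intro: sorted_wrt_mono_rel[OF _ sorted_desc_list])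
  moreover have "map int p = desc_list \<mu>" using nonneg \<mu>(2) by (intro nth_equalityI) (auto simp: p_def)
  hence "map of_nat p = (map of_int (desc_list \<mu>) :: complex list)" by (simp add: \<open>map int p = desc_list \<mu>\<close>[symmetric])
  hence "lam = shift a (map of_nat p)" using \<mu>(1) by (simp only: lamw_def)
  ultimately show ?thesis by blast
qed

theorem theorem1p5:
  fixes n :: nat and lam :: "complex list" and w :: "nat \<Rightarrow>\<^sub>0 complex"
  assumes "n \<ge> 1" and "lam \<in> weights n"
  shows "has_limit_q0 (trace_coeff n lam w)
     ((1 - tK ^ 2) ^ n / b_weight (tK ^ 2) lam *
      (\<Sum>S\<in>{S \<in> chains n lam. Poly_Mapping.nth (wt S) = w}. sk_chain (tK ^ 2) S))"
proof -
  \<comment> \<open>The pair chosen inside \<open>macdonald_P\<close> is fixed here, and the chains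
    are described with the same offset, so the choice never has to be compared with another.\<close>
  define R where "R = (\<lambda>(a, p). p \<in> partitions_le n \<and> lam = shift a (map of_nat p))"
  have "\<exists>x. R x" using weights_shift_partition[OF assms(2,1)] by (auto simp: R_def)
  hence "R (SOME x. R x)" by (rule someI_ex)
  moreover obtain a p where ap: "(SOME x. R x) = (a, p)" by (cases "SOME x. R x")
  ultimately have p: "p \<in> partitions_le n" and lam: "lam = shift a (map of_nat p)" by (auto simp: R_def)
  have lamw: "lam = lamw a (intm p)" by (simp add: lam lamw_def desc_list_intm[OF p] comp_def)
  note size = size_intm[OF p]
  obtain u where
    mac: "macdonald_part n (qS ^ 2) (tS ^ 2) p = (\<Sum>mu\<in>DomSet n p. cm 0 (scalar_of (u mu)) * monomial_sym mu)"
    and u: "\<And>mu. mu \<in> DomSet n p \<Longrightarrow> fps_to_fls (fps_nth (u mu) 0) = lk (hlr n (intm p)) (nv mu) / hl_lead (intm p)"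
    by (rule macdonald_part_q0[OF p], rule that)
  have "Poly_Mapping.nth (replicate n a) = xall n a"
    by (intro poly_mapping_eqI) (simp add: lookup_xall nth_default_def)
  hence P: "macdonald_P n (qS ^ 2) (tS ^ 2) lam = cm (xall n a) 1 * macdonald_part n (qS ^ 2) (tS ^ 2) p"
    unfolding macdonald_P_def R_def[symmetric] ap by (simp add: xmon_def)
  \<comment> \<open>The coefficient computed with power series scalars only: once it is known to be
    \<open>scalar_of X\<close> there is no pole, and the limit is the constant coefficient of
    X.\<close>
  define X where "X = (\<Sum>mu\<in>DomSet n p. u mu * (\<Sum>v\<in>expo_orbit mu. coeff_qt (trace_factor n) (w - xall n a - v)))"
  have "trace_coeff n lam w = act (macdonald_P n (qS ^ 2) (tS ^ 2) lam) (xcoeff (trace_factor n)) w"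
    unfolding trace_coeff_def Let_def act_def ..
  also have "\<dots> = scalar_of X"
    unfolding P act_mult act_single mac act_sum act_scalar act_monomial_sym xcoeff_scalar_of X_def
    by (simp add: scalar_of_sum scalar_of_mult)
  finally have X: "trace_coeff n lam w = scalar_of X" .
  have "fps_to_fls (fps_nth X 0)
      = (\<Sum>mu\<in>DomSet n p. fps_to_fls (fps_nth (u mu) 0) * (\<Sum>v\<in>expo_orbit mu. phi0 n (w - xall n a - v)))"
    by (simp add: X_def fps_sum_nth fps_to_fls_sum fls_times_fps_to_fls coeff_q0_coeff_qt phi0_def)
  also have "\<dots> = (\<Sum>mu\<in>DomSet n p. lk (hlr n (intm p)) (nv mu) * (\<Sum>v\<in>expo_orbit mu. phi0 n (w - xall n a - v))) / hl_lead (intm p)"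
    unfolding sum_divide_distrib by (rule sum.cong) (simp_all add: u)
  also have "(\<Sum>mu\<in>DomSet n p. lk (hlr n (intm p)) (nv mu) * (\<Sum>v\<in>expo_orbit mu. phi0 n (w - xall n a - v)))
      = act (cm (xall n a) 1 * hlr n (intm p)) (phi0 n) w"
    unfolding act_mult act_single by (subst (2) hlr_expansion[OF p]) (simp add: act_sum act_scalar act_monomial_sym)
  also have "act (cm (xall n a) 1 * hlr n (intm p)) (phi0 n) = chain_sum n a (intm p)"
    using chain_sum_eq_act_hlr[OF assms(1) size _ act_lower_factor_phi0] bdd_coeff_q0 by (simp add: phi0_def)
  finally have X0: "fps_to_fls (fps_nth X 0) = chain_sum n a (intm p) w / hl_lead (intm p)" .
  have "b_weight T lam = (\<Prod>j\<in>set_mset (intm p). tphi T (count (intm p) j))"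
    unfolding lamw using assms(1) size by (intro b_weight_lamw) simp
  \<comment> \<open>The leading coefficient becomes the prefactor: \<open>hl_lead\<close> is b over
    (1 - T)^n.\<close>
  hence "chain_sum n a (intm p) w / hl_lead (intm p) = (1 - T) ^ n / b_weight T lam * chain_sum n a (intm p) w"
    by (simp add: hl_lead_def size)
  moreover have "(\<Sum>S\<in>{S \<in> chains n lam. Poly_Mapping.nth (wt S) = w}. sk_chain T S) = chain_sum n a (intm p) w"
    by (simp only: chain_sum_def lamw)
  ultimately show ?thesis
    unfolding has_limit_q0_def X T_def[symmetric] using X0 scalar_of_nth by simp
qed

end
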